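(* Let $P$ be a probability distribution on $\mathbb N$ with $P(1)<1$, let $n_o\sim P$, and assume $\mathbb E[e^{\theta n_o}]<\infty$ for some $\theta>0$. Let $Z_l$ be the number of vertices in generation $l$ of the Erlang Weighted Tree with potential degree distribution $P$, and let $\beta_0,f_0$ be as in the context. Then $$\frac{\mathbb E[Z_l]}{\beta_0^{\,l}}\xrightarrow{l\to\infty}\left(\sum_{m=1}^\infty P(m)\int_0^\infty\frac{e^{-x}x^m}{m!}\,\frac mx f_0(x)\,dx\right)\left(\int_0^\infty\sum_{k=1}^\infty P(k)\frac{e^{-z}z^{k-1}}{(k-1)!}f_0(z)\,dz\right).$$
   Context: $\mathbb N=\{1,2,\dots\}$, $\mathbb Z_+=\{0,1,\dots\}$, $\mathbb R_+=[0,\infty)$. $\mathrm{Erlang}(k)$ has density $e^{-x}x^{k-1}/(k-1)!$. **Erlang Weighted Tree (EWT).** Let $\mathbb N^f=\bigcup_{i\ge0}\mathbb N^i$, $\mathbb N^0=\{o\}$, and $\widehat P(k)=P(k+1)$, $k\in\mathbb Z_+$. Independently over $\boldsymbol i\in\mathbb N^f$: $n_o\sim P$, $n_{\boldsymbol i}\sim\widehat P$ for $\boldsymbol i\ne o$; given $n_{\boldsymbol i}$, $v_{\boldsymbol i}\sim\mathrm{Erlang}(n_{\boldsymbol i}+1)$; given $(n_{\boldsymbol i},v_{\boldsymbol i})$, the costs $\zeta_{(\boldsymbol i,1)},\dots,\zeta_{(\boldsymbol i,n_{\boldsymbol i})}$ are i.i.d. uniform on $[0,v_{\boldsymbol i}]$.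 The backbone tree is the component of $o$ in the graph with edges $\{\boldsymbol i,(\boldsymbol i,j)\}$, $1\le j\le n_{\boldsymbol i}$. The EWT is the component of the root $o$ after keeping $\{\boldsymbol i,(\boldsymbol i,j)\}$ iff $\zeta_{(\boldsymbol i,j)}<v_{(\boldsymbol i,j)}$. Generation $l$ is the set of its vertices at distance $l$ from $o$. **Spectral quantities.** $g_2(x)=e^{-x}\sum_{k=2}^\infty P(k)\frac{x^{k-2}}{(k-2)!}$; $G_0\equiv1$, $G_i(x)=\int_{y=x}^\infty\int_{z=y}^\infty g_2(z)G_{i-1}(z)\,dz\,dy$ for $i\ge1$; $L(\beta,x)=\sum_{i\ge0}G_i(x)(-1/\beta)^i$. $\beta_0$ is the largest $\beta>0$ with $L(\beta,0)=0$, and $f_0(x)=L(\beta_0,x)\big/\big(\int_0^\infty g_2(y)L(\beta_0,y)^2dy\big)^{1/2}$, so $\int_0^\infty g_2f_0^2=1$. *)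

theory Defs
  imports "HOL-Probability.Probability"
begin

text \<open>
  Vertices are finite words: the root is \<open>[]\<close> and \<open>i @ [j]\<close> is the \<open>j\<close>-th child of \<open>i\<close>.
  Graphs are sets of parent-child pairs; walks may use an edge in both directions.
\<close>

definition walk_step :: "('v \<times> 'v) set \<Rightarrow> ('v \<times> 'v) set" where
  "walk_step E = E \<union> E\<inverse>"

definition component :: "('v \<times> 'v) set \<Rightarrow> 'v \<Rightarrow> 'v set" where
  "component E r = {u. (r, u) \<in> (walk_step E)\<^sup>*}"

definition graph_dist :: "('v \<times> 'v) set \<Rightarrow> 'v \<Rightarrow> 'v \<Rightarrow> nat" where
  "graph_dist E r u = (LEAST l. (r, u) \<in> walk_step E ^^ l)"

definition potential_edges :: "(nat list \<Rightarrow> nat) \<Rightarrow> (nat list \<times> nat list) set" where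
  "potential_edges n = {(i, i @ [j]) | i j. i \<in> lists {1..} \<and> 1 \<le> j \<and> j \<le> n i}"

definition backbone_tree :: "(nat list \<Rightarrow> nat) \<Rightarrow> nat list set" where
  "backbone_tree n = component (potential_edges n) []"

definition kept_edges ::
  "(nat list \<Rightarrow> nat) \<Rightarrow> (nat list \<Rightarrow> real) \<Rightarrow> (nat list \<Rightarrow> real) \<Rightarrow> (nat list \<times> nat list) set" where
  "kept_edges n v \<zeta> =
     {(i, c) \<in> potential_edges n. i \<in> backbone_tree n \<and> c \<in> backbone_tree n \<and> \<zeta> c < v c}"

definition ewt_vertices ::
  "(nat list \<Rightarrow> nat) \<Rightarrow> (nat list \<Rightarrow> real) \<Rightarrow> (nat list \<Rightarrow> real) \<Rightarrow> nat list set" where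
  "ewt_vertices n v \<zeta> = component (kept_edges n v \<zeta>) []"

definition ewt_generation ::
  "(nat list \<Rightarrow> nat) \<Rightarrow> (nat list \<Rightarrow> real) \<Rightarrow> (nat list \<Rightarrow> real) \<Rightarrow> nat \<Rightarrow> nat list set" where
  "ewt_generation n v \<zeta> l =
     {u \<in> ewt_vertices n v \<zeta>. graph_dist (kept_edges n v \<zeta>) [] u = l}"

definition potential_degree_prob :: "nat pmf \<Rightarrow> nat list \<Rightarrow> nat \<Rightarrow> real" where
  "potential_degree_prob P i k = (if i = [] then pmf P k else pmf P (k + 1))"

text \<open>
  The marks of vertex \<open>i\<close> are \<open>n i\<close>, \<open>v i\<close> and the costs of the potential children
  \<open>1, \<dots>, n i\<close>; a cost \<open>\<zeta> (i @ [j])\<close> with \<open>j > n i\<close> does not exist in the model, so it is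
  masked by \<open>restrict\<close> and left unconstrained. \<open>marks_law\<close> is the joint law of these marks,
  i.e. the composition of the law of \<open>n i\<close>, of \<open>v i\<close> given \<open>n i\<close>, and of the costs given
  both. Note that \<open>erlang_density k 1\<close> is the density of the Erlang distribution with shape
  \<open>k + 1\<close>.
\<close>

locale erlang_weighted_tree = prob_space M
  for M :: "'w measure" +
  fixes P :: "nat pmf"
    and n :: "nat list \<Rightarrow> 'w \<Rightarrow> nat"
    and v :: "nat list \<Rightarrow> 'w \<Rightarrow> real"
    and \<zeta> :: "nat list \<Rightarrow> 'w \<Rightarrow> real"
  assumes degree_pos: "set_pmf P \<subseteq> {1..}"
    and marks_indep:
      "indep_vars (\<lambda>_. count_space UNIV \<Otimes>\<^sub>M borel \<Otimes>\<^sub>M Pi\<^sub>M UNIV (\<lambda>_. borel))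
         (\<lambda>i \<omega>. (n i \<omega>, v i \<omega>, restrict (\<lambda>j. \<zeta> (i @ [j]) \<omega>) {1..n i \<omega>}))
         (lists {1..})"
    and marks_law:
      "\<And>i k A C. i \<in> lists {1..} \<Longrightarrow> A \<in> sets borel \<Longrightarrow> (\<And>j. C j \<in> sets borel) \<Longrightarrow>
         emeasure M {\<omega> \<in> space M. n i \<omega> = k \<and> v i \<omega> \<in> A \<and> (\<forall>j\<in>{1..k}. \<zeta> (i @ [j]) \<omega> \<in> C j)} =
         ennreal (potential_degree_prob P i k) *
           (\<integral>\<^sup>+x\<in>A. ennreal (erlang_density k 1 x) *
              (\<Prod>j=1..k. emeasure (uniform_measure lborel {0..x}) (C j)) \<partial>lborel)"

definition g2 :: "nat pmf \<Rightarrow> real \<Rightarrow> real" where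
  "g2 P x = exp (- x) * (\<Sum>\<^sub>\<infinity>k\<in>{2..}. pmf P k * (x ^ (k - 2) / fact (k - 2)))"

fun G :: "nat pmf \<Rightarrow> nat \<Rightarrow> real \<Rightarrow> real" where
  "G P 0 x = 1"
| "G P (Suc i) x = (LBINT y:{x..}. LBINT z:{y..}. g2 P z * G P i z)"

definition L :: "nat pmf \<Rightarrow> real \<Rightarrow> real \<Rightarrow> real" where
  "L P \<beta> x = (\<Sum>i. G P i x * (- 1 / \<beta>) ^ i)"

definition beta0 :: "nat pmf \<Rightarrow> real" where
  "beta0 P = (GREATEST \<beta>. 0 < \<beta> \<and> L P \<beta> 0 = 0)"

definition f0 :: "nat pmf \<Rightarrow> real \<Rightarrow> real" where
  "f0 P x = L P (beta0 P) x / sqrt (LBINT y:{0..}. g2 P y * (L P (beta0 P) y)\<^sup>2)"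

end

theory Submission
  imports Defs
begin

text \<open>
  Conditioning on the cost \<open>x\<close> of a vertex, the expected number of its descendants \<open>l\<close>
  generations below solves \<open>h\<^sub>l(x) = \<integral>\<^sub>x\<^sup>\<infinity> g2(y) \<integral>\<^sub>0\<^sup>y h\<^sub>l\<^sub>-\<^sub>1(z) dz dy\<close>. The primitives
  \<open>F\<^sub>l(y) = \<integral>\<^sub>0\<^sup>y h\<^sub>l\<close> are therefore iterates of \<open>T u(x) = \<integral> min(x,y) u(y) g2(y) dy\<close>, an operator
  symmetric with respect to \<open>\<mu> = g2(y) dy\<close>, and \<open>E Z\<^sub>l\<^sub>+\<^sub>1 = \<integral> F\<^sub>l d\<nu>\<close> with \<open>F\<^sub>0(x) = \<integral> min(x,y) d\<nu>(y)\<close>,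
  where \<open>\<nu>\<close> has density \<open>\<Sum>\<^sub>k P(k) e\<^sup>-\<^sup>y y\<^sup>k\<^sup>-\<^sup>1 / (k-1)!\<close>. No spectral theorem is needed for the
  asymptotics. At the smallest \<open>l0 > 0\<close> with \<open>L(1/l0, 0) = 0\<close>, the function \<open>f = L(1/l0, \<sqdot>)\<close> is a
  nonnegative solution of \<open>l0 T f = f\<close> and is comparable to \<open>min(x,1)\<close>. As
  \<open>min(x,1) min(1,z) \<le> min(x,z)\<close>, this is a Doeblin minorisation: if \<open>a f \<le> u \<le> b f\<close>, then
  \<open>a' f \<le> l0 T u \<le> b' f\<close> with \<open>b' - a'\<close> smaller than \<open>b - a\<close> by a fixed factor. Since
  \<open>\<integral> u f d\<mu>\<close> is conserved, \<open>l0\<^sup>l F\<^sub>l\<close> converges to the multiple of \<open>f\<close> with the right such integral.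
\<close>

section \<open>The kernel \<open>min x y\<close> and its principal eigenfunction\<close>

text \<open>The cost axis is unbounded, so compactness has to be replaced by decay. With r = exp (-
  \<theta>) the moment assumption gives P(k) \<le> E r^k, hence g2(x) \<le> E r^2 exp (- (1 - r) x).
  This makes the series \<open>L\<close> converge for every value of 1 / \<beta>, uniformly in x,
  and gives \<mu> a first moment. The number l0 is constructed as the supremum of the l for which
  L(1/l, x) is nonnegative for all x \<ge> 0; that it is the smallest zero, so that beta0 = 1 / l0,
  is a separate comparison argument. The measure \<nu> enters at both ends, for different reasons.
  At the root it is the mean measure of potential children: k times the Erlang density, divided by
  y. At the last generation it is the law of v at a non-root vertex, which decides whether the last
  edge is kept. That the two agree makes the limit a square, (\<integral> f d\<nu>)^2 / \<integral>
  f^2 d\<mu>, and each factor in the theorem is \<integral> f0 d\<nu>. The combinatorial part is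
  computed with nonnegative extended integrals; finiteness follows only when the iterates F_l are
  shown to be bounded.\<close>

lemma min_le_mult: "min x 1 * min 1 z \<le> min x z" if "0 \<le> x" "0 \<le> z" for x z :: real
  using that mult_mono[of "min x 1" x "min 1 z" 1] mult_mono[of "min x 1" 1 "min 1 z" z] by simp

text \<open>Counterpart of the previous bound: together they confine the kernel between multiples of
  \<open>min x 1\<close> whose weights in z are integrable.\<close>

lemma min_ge_mult: "min x z \<le> min x 1 * max 1 z" if "0 \<le> x" "0 \<le> z" for x z :: real
proof (cases "x \<le> 1")
  case True
  then have "min x z \<le> x * 1" "x * 1 \<le> x * max 1 z" using that by (simp, intro mult_left_mono) auto
  then show ?thesis using True by simp
qed simp

text \<open>The bound \<open>decay\<close> is what makes the iterated integrals \<open>H i\<close> below as small as \<open>B\<^sup>i / i!\<close>.\<close>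

locale min_kernel = finite_measure \<mu> for \<mu> :: "real measure" +
  fixes B c :: real
  assumes sets_mu [measurable_cong, simp]: "sets \<mu> = sets borel"
    and AE_pos: "AE x in \<mu>. 0 < x"
    and first_moment: "integrable \<mu> (\<lambda>x. x)"
    and nonzero: "emeasure \<mu> (space \<mu>) \<noteq> 0"
    and B_nonneg: "0 \<le> B" and c_nonneg: "0 \<le> c"
    and decay: "\<And>i x. 0 \<le> x \<Longrightarrow>
      (\<integral>z. max 0 (z - x) * exp (- (real i * c * z)) \<partial>\<mu>) \<le> B / real (Suc i) * exp (- (real (Suc i) * c * x))"
begin

section \<open>Integration against a finite measure with a first moment\<close>

lemma space_mu [simp]: "space \<mu> = UNIV"
  using sets_eq_imp_space_eq[OF sets_mu] by simp

text \<open>The integrands below are mostly a kernel such as \<open>min x z\<close> or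
  \<open>max 0 (z - x)\<close> times a bounded function, so the first moment of \<mu>
  suffices.\<close>

lemma integrable_dominated:
  fixes k q :: "real \<Rightarrow> real"
  assumes [measurable]: "k \<in> borel_measurable borel" "q \<in> borel_measurable borel"
    and k: "\<And>z. 0 < z \<Longrightarrow> \<bar>k z\<bar> \<le> z" and q: "\<And>z. 0 < z \<Longrightarrow> \<bar>q z\<bar> \<le> K"
  shows "integrable \<mu> (\<lambda>z. k z * q z)"
proof (rule Bochner_Integration.integrable_bound)
  show "integrable \<mu> (\<lambda>z. z * K)" using first_moment by simp
  show "AE z in \<mu>. norm (k z * q z) \<le> norm (z * K)"
    using AE_pos
  proof eventually_elim
    case (elim z)
    have "0 \<le> K" using q[OF elim] by linarith
    then show ?case using k[OF elim] q[OF elim] elim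
      by (simp add: abs_mult mult_mono)
  qed
qed measurable

lemma integral_nonneg_pos:
  fixes q :: "real \<Rightarrow> real"
  assumes "\<And>z. 0 < z \<Longrightarrow> 0 \<le> q z"
  shows "0 \<le> (\<integral>z. q z \<partial>\<mu>)"
  by (rule integral_nonneg_AE) (use AE_pos assms in \<open>auto elim: eventually_mono\<close>)

lemma integral_mono_pos:
  fixes p q :: "real \<Rightarrow> real"
  assumes "integrable \<mu> p" "integrable \<mu> q" "\<And>z. 0 < z \<Longrightarrow> p z \<le> q z"
  shows "(\<integral>z. p z \<partial>\<mu>) \<le> (\<integral>z. q z \<partial>\<mu>)"
  by (rule integral_mono_AE) (use assms AE_pos in \<open>auto elim: eventually_mono\<close>)

lemma integral_cong_pos:
  fixes p q :: "real \<Rightarrow> real"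
  assumes "\<And>z. 0 < z \<Longrightarrow> p z = q z"
    and [measurable]: "p \<in> borel_measurable borel" "q \<in> borel_measurable borel"
  shows "(\<integral>z. p z \<partial>\<mu>) = (\<integral>z. q z \<partial>\<mu>)"
  by (rule integral_cong_AE) (use assms AE_pos in \<open>auto elim: eventually_mono\<close>)

section \<open>Iterated tail integrals and the series \<open>\<phi>\<close>\<close>

primrec H :: "nat \<Rightarrow> real \<Rightarrow> real" where
  "H 0 = (\<lambda>x. 1)"
| "H (Suc i) = (\<lambda>x. \<integral>z. max 0 (z - x) * H i z \<partial>\<mu>)"

lemma H_measurable [measurable]: "H i \<in> borel_measurable borel"
  by (induction i) simp_all

text \<open>A bound by constants alone would give only B^i. The decay rate grows by \<open>c\<close>
  at each step, and integrating against the faster decay supplies the extra factor 1 / (i +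
  1).\<close>

lemma H_bound_exp:
  assumes "0 \<le> x"
  shows "0 \<le> H i x \<and> H i x \<le> B ^ i / fact i * exp (- (real i * c * x))"
  using assms
proof (induction i arbitrary: x)
  case (Suc i)
  have bd: "\<bar>H i z\<bar> \<le> B ^ i / fact i" if "0 < z" for z
  proof -
    have "B ^ i / fact i * exp (- (real i * c * z)) \<le> B ^ i / fact i * 1"
      using that B_nonneg c_nonneg by (intro mult_left_mono) auto
    then show ?thesis using Suc.IH[of z] that by simp
  qed
  have e: "\<bar>exp (- (real i * c * z))\<bar> \<le> 1" if "0 < z" for z
    using that c_nonneg by simp
  have i1: "integrable \<mu> (\<lambda>z. max 0 (z - x) * H i z)"
    by (rule integrable_dominated[OF _ _ _ bd]) (use Suc.prems in auto)
  have i2: "integrable \<mu> (\<lambda>z. max 0 (z - x) * exp (- (real i * c * z)))"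
    by (rule integrable_dominated[OF _ _ _ e]) (use Suc.prems in auto)
  have "H (Suc i) x \<le> (\<integral>z. B ^ i / fact i * (max 0 (z - x) * exp (- (real i * c * z))) \<partial>\<mu>)"
    unfolding H.simps
  proof (rule integral_mono_pos[OF i1])
    show "integrable \<mu> (\<lambda>z. B ^ i / fact i * (max 0 (z - x) * exp (- (real i * c * z))))"
      using i2 by (rule integrable_mult_right)
    show "max 0 (z - x) * H i z \<le> B ^ i / fact i * (max 0 (z - x) * exp (- (real i * c * z)))"
      if "0 < z" for z
      using mult_left_mono[of "H i z" "B ^ i / fact i * exp (- (real i * c * z))" "max 0 (z - x)"]
        Suc.IH[of z] that by (simp add: mult_ac)
  qed
  also have "\<dots> = B ^ i / fact i * (\<integral>z. max 0 (z - x) * exp (- (real i * c * z)) \<partial>\<mu>)"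
    by simp
  also have "\<dots> \<le> B ^ i / fact i * (B / real (Suc i) * exp (- (real (Suc i) * c * x)))"
    using decay[OF Suc.prems, of i] B_nonneg by (intro mult_left_mono) auto
  also have "\<dots> = B ^ Suc i / fact (Suc i) * exp (- (real (Suc i) * c * x))"
    by (simp add: field_simps)
  finally have "H (Suc i) x \<le> \<dots>" .
  moreover have "0 \<le> H (Suc i) x"
    unfolding H.simps by (rule integral_nonneg_pos) (use Suc.IH in auto)
  ultimately show ?case by blast
qed simp

lemma H_nonneg: "0 \<le> x \<Longrightarrow> 0 \<le> H i x"
  using H_bound_exp by blast

lemma H_bound: assumes "0 \<le> x" shows "H i x \<le> B ^ i / fact i"
proof -
  have "B ^ i / fact i * exp (- (real i * c * x)) \<le> B ^ i / fact i * 1"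
    using assms B_nonneg c_nonneg by (intro mult_left_mono) auto
  then show ?thesis using H_bound_exp[OF assms, of i] by simp
qed

text \<open>The parameter \<open>l\<close> is the reciprocal of the \<open>\<beta>\<close> in \<open>L(\<beta>, x)\<close>.\<close>

definition \<phi> :: "real \<Rightarrow> real \<Rightarrow> real" where
  "\<phi> l x = (\<Sum>i. H i x * (- l) ^ i)"

lemma exp_summable: "summable (\<lambda>i. B ^ i / fact i * l ^ i)" for l :: real
  using summable_exp_generic[of "B * l"] by (simp add: divide_inverse power_mult_distrib mult_ac)

lemma exp_suminf: "(\<Sum>i. B ^ i / fact i * l ^ i) = exp (B * l)" for l :: real
  by (simp add: exp_def divide_inverse power_mult_distrib mult_ac)

lemma \<phi>_term_bound:
  assumes "0 \<le> x" shows "\<bar>H i x * (- l) ^ i\<bar> \<le> B ^ i / fact i * \<bar>l\<bar> ^ i"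
  using mult_right_mono[OF H_bound[OF assms, of i], of "\<bar>l\<bar> ^ i"] H_nonneg[OF assms, of i]
  by (simp add: abs_mult power_abs)

lemma \<phi>_summable_abs: assumes "0 \<le> x" shows "summable (\<lambda>i. \<bar>H i x * (- l) ^ i\<bar>)"
  by (rule summable_comparison_test'[OF exp_summable[of "\<bar>l\<bar>"], of 0])
     (use \<phi>_term_bound[OF assms] in auto)

lemma \<phi>_summable: "0 \<le> x \<Longrightarrow> summable (\<lambda>i. H i x * (- l) ^ i)"
  by (rule summable_rabs_cancel[OF \<phi>_summable_abs])

lemma \<phi>_measurable [measurable]: "\<phi> l \<in> borel_measurable borel"
  unfolding \<phi>_def by measurable

lemma \<phi>_bound: assumes "0 \<le> x" shows "\<bar>\<phi> l x\<bar> \<le> exp (B * \<bar>l\<bar>)"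
proof -
  have "\<bar>\<phi> l x\<bar> \<le> (\<Sum>i. \<bar>H i x * (- l) ^ i\<bar>)"
    unfolding \<phi>_def by (rule summable_rabs[OF \<phi>_summable_abs[OF assms]])
  also have "\<dots> \<le> (\<Sum>i. B ^ i / fact i * \<bar>l\<bar> ^ i)"
    by (rule suminf_le[OF \<phi>_term_bound[OF assms] \<phi>_summable_abs[OF assms] exp_summable])
  finally show ?thesis by (simp only: exp_suminf)
qed

text \<open>The sign (-1)^i is common to both terms, so each difference is at most B^i / i! (m^i -
  l^i), which sums to a difference of exponentials. The bound is uniform in x, as the arguments
  about \<open>l0\<close> require.\<close>

lemma \<phi>_diff:
  assumes "0 \<le> x" "0 \<le> l" "l \<le> m"
  shows "\<bar>\<phi> m x - \<phi> l x\<bar> \<le> exp (B * m) - exp (B * l)"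
proof -
  let ?d = "\<lambda>i. H i x * (- m) ^ i - H i x * (- l) ^ i"
  have bd: "\<bar>?d i\<bar> \<le> B ^ i / fact i * m ^ i - B ^ i / fact i * l ^ i" for i
  proof -
    have "?d i = (-1) ^ i * (H i x * (m ^ i - l ^ i))"
      by (simp add: power_minus[of m] power_minus[of l] algebra_simps)
    then have "\<bar>?d i\<bar> = H i x * (m ^ i - l ^ i)"
      using assms H_nonneg[OF assms(1)] power_mono[OF assms(3,2)] by (simp add: abs_mult)
    also have "\<dots> \<le> B ^ i / fact i * (m ^ i - l ^ i)"
      using power_mono[OF assms(3,2)] H_bound[OF assms(1)] by (intro mult_right_mono) auto
    finally show ?thesis by (simp add: algebra_simps)
  qed
  note su = summable_diff[OF exp_summable[of m] exp_summable[of l]]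
  have sd: "summable (\<lambda>i. \<bar>?d i\<bar>)"
    by (rule summable_comparison_test'[OF su, of 0]) (use bd in auto)
  have "\<bar>\<phi> m x - \<phi> l x\<bar> = \<bar>\<Sum>i. ?d i\<bar>"
    unfolding \<phi>_def by (simp add: suminf_diff \<phi>_summable[OF assms(1)])
  also have "\<dots> \<le> (\<Sum>i. \<bar>?d i\<bar>)" by (rule summable_rabs[OF sd])
  also have "\<dots> \<le> (\<Sum>i. B ^ i / fact i * m ^ i - B ^ i / fact i * l ^ i)"
    by (rule suminf_le[OF bd sd su])
  also have "\<dots> = exp (B * m) - exp (B * l)"
    by (simp only: suminf_diff[OF exp_summable exp_summable, symmetric] exp_suminf)
  finally show ?thesis .
qed

lemma \<phi>_continuous:
  assumes "0 \<le> l" "0 < e"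
  shows "\<exists>d>0. \<forall>m\<ge>0. \<bar>m - l\<bar> < d \<longrightarrow> (\<forall>x\<ge>0. \<bar>\<phi> m x - \<phi> l x\<bar> < e)"
proof -
  have "isCont (\<lambda>m. exp (B * m)) l" by (intro continuous_intros)
  then have "\<exists>d>0. \<forall>m. \<bar>m - l\<bar> < d \<longrightarrow> \<bar>exp (B * m) - exp (B * l)\<bar> < e"
    using assms(2) unfolding continuous_at_eps_delta by (simp add: dist_real_def)
  then obtain d where d: "d > 0" "\<And>m. \<bar>m - l\<bar> < d \<Longrightarrow> \<bar>exp (B * m) - exp (B * l)\<bar> < e"
    by blast
  have "\<bar>\<phi> m x - \<phi> l x\<bar> < e" if "0 \<le> m" "\<bar>m - l\<bar> < d" "0 \<le> x" for m x
  proof (cases "l \<le> m")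
    case True
    then show ?thesis using \<phi>_diff[OF that(3) assms(1)] d(2)[OF that(2)] by force
  next
    case False
    then show ?thesis using \<phi>_diff[OF that(3) that(1), of l] d(2)[OF that(2)] by force
  qed
  then show ?thesis using d(1) by blast
qed

lemma \<phi>_0: "\<phi> 0 x = 1"
proof -
  have "\<phi> 0 x = (\<Sum>i. H i x * 0 ^ i)" unfolding \<phi>_def by (simp only: minus_zero)
  also have "\<dots> = H 0 x" by (rule powser_zero)
  finally show ?thesis by simp
qed

lemma integrable_\<phi>:
  assumes [measurable]: "k \<in> borel_measurable borel" and "\<And>z. 0 < z \<Longrightarrow> \<bar>k z\<bar> \<le> z"
  shows "integrable \<mu> (\<lambda>z. k z * \<phi> l z)"
proof (rule integrable_dominated[where K = "exp (B * \<bar>l\<bar>)"])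
  show "\<bar>\<phi> l z\<bar> \<le> exp (B * \<bar>l\<bar>)" if "0 < z" for z
    by (rule \<phi>_bound) (use that in simp)
qed (use assms in \<open>simp_all\<close>)

text \<open>The kernel \<open>max 0 (z - x)\<close> sends \<open>H i\<close> to
  \<open>H (Suc i)\<close>, so integrating the series shifts its index. When \<mu> has a density g,
  this is the integral form of \<phi>'' = - l g \<phi> with value 1 at infinity.\<close>

lemma \<phi>_eq:
  assumes "0 \<le> x"
  shows "\<phi> l x = 1 - l * (\<integral>z. max 0 (z - x) * \<phi> l z \<partial>\<mu>)"
proof -
  let ?t = "\<lambda>i z. max 0 (z - x) * (H i z * (- l) ^ i)"
  have bd: "\<bar>H i z * (- l) ^ i\<bar> \<le> B ^ i / fact i * \<bar>l\<bar> ^ i" if "0 < z" for i z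
    using \<phi>_term_bound that by simp
  have int: "integrable \<mu> (?t i)" for i
    by (rule integrable_dominated[OF _ _ _ bd]) (use assms in auto)
  have s1: "AE z in \<mu>. summable (\<lambda>i. norm (?t i z))"
    using AE_pos
  proof eventually_elim
    case (elim z)
    then show ?case
      unfolding real_norm_def abs_mult[of "max 0 (z - x)"]
      by (intro summable_mult \<phi>_summable_abs) simp
  qed
  have s2: "summable (\<lambda>i. \<integral>z. norm (?t i z) \<partial>\<mu>)"
  proof (rule summable_comparison_test'[of "\<lambda>i. (\<integral>z. z \<partial>\<mu>) * (B ^ i / fact i * \<bar>l\<bar> ^ i)" 0])
    show "summable (\<lambda>i. (\<integral>z. z \<partial>\<mu>) * (B ^ i / fact i * \<bar>l\<bar> ^ i))"
      by (rule summable_mult[OF exp_summable])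
    fix i :: nat
    have "(\<integral>z. norm (?t i z) \<partial>\<mu>) \<le> (\<integral>z. z * (B ^ i / fact i * \<bar>l\<bar> ^ i) \<partial>\<mu>)"
    proof (rule integral_mono_pos)
      show "integrable \<mu> (\<lambda>z. norm (?t i z))" using int by (rule integrable_norm)
      show "integrable \<mu> (\<lambda>z. z * (B ^ i / fact i * \<bar>l\<bar> ^ i))" using first_moment by simp
      show "norm (?t i z) \<le> z * (B ^ i / fact i * \<bar>l\<bar> ^ i)" if "0 < z" for z
        unfolding real_norm_def abs_mult[of "max 0 (z - x)"]
        by (rule mult_mono) (use bd[OF that] that assms in auto)
    qed
    then show "norm (\<integral>z. norm (?t i z) \<partial>\<mu>) \<le> (\<integral>z. z \<partial>\<mu>) * (B ^ i / fact i * \<bar>l\<bar> ^ i)"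
      by simp
  qed
  have "(\<integral>z. max 0 (z - x) * \<phi> l z \<partial>\<mu>) = (\<integral>z. (\<Sum>i. ?t i z) \<partial>\<mu>)"
  proof (rule integral_cong_pos)
    show "max 0 (z - x) * \<phi> l z = (\<Sum>i. ?t i z)" if "0 < z" for z
      unfolding \<phi>_def by (rule suminf_mult[symmetric], rule \<phi>_summable) (use that in simp)
  qed measurable
  also have "\<dots> = (\<Sum>i. \<integral>z. ?t i z \<partial>\<mu>)"
    by (rule integral_suminf[OF int s1 s2])
  also have "\<dots> = (\<Sum>i. H (Suc i) x * (- l) ^ i)"
    by (simp only: mult.assoc[symmetric] integral_mult_left_zero H.simps)
  finally have eq: "(\<integral>z. max 0 (z - x) * \<phi> l z \<partial>\<mu>) = (\<Sum>i. H (Suc i) x * (- l) ^ i)" .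
  have "\<phi> l x = H 0 x * (- l) ^ 0 + (\<Sum>i. H (Suc i) x * (- l) ^ Suc i)"
    unfolding \<phi>_def using suminf_split_head[OF \<phi>_summable[OF assms, of l]]
    by (simp only: diff_eq_eq add.commute)
  also have "(\<Sum>i. H (Suc i) x * (- l) ^ Suc i) = - l * (\<Sum>i. H (Suc i) x * (- l) ^ i)"
  \<comment> \<open>Summability of the shifted series is recovered by cancelling the factor
    \<open>- l\<close>, so l = 0 is separate.\<close>
  proof (cases "l = 0")
    case False
    have t: "H (Suc i) x * (- l) ^ Suc i = - l * (H (Suc i) x * (- l) ^ i)" for i
      by (simp only: power_Suc mult.left_commute)
    have "summable (\<lambda>i. H (Suc i) x * (- l) ^ Suc i)"
      by (subst summable_Suc_iff[of "\<lambda>i. H i x * (- l) ^ i"]) (rule \<phi>_summable[OF assms])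
    then have "summable (\<lambda>i. - l * (H (Suc i) x * (- l) ^ i))"
      by (simp only: t)
    then have "summable (\<lambda>i. H (Suc i) x * (- l) ^ i)"
      by (rule summable_mult_D) (use False in simp)
    then show ?thesis
      by (simp only: t suminf_mult)
  qed simp
  finally show ?thesis using eq by simp
qed

section \<open>Positivity of \<open>\<phi> l\<close> and the critical parameter
  \<open>l0\<close>\<close>

lemma AE_nonzero:
  assumes "AE z in \<mu>. q z = 0"
  shows "\<exists>z>0. q z = 0"
proof (rule ccontr)
  assume "\<not> ?thesis"
  then have "AE z in \<mu>. False"
    using assms AE_pos by (auto elim: eventually_elim2)
  then show False using nonzero by (simp add: AE_iff_null null_sets_def)
qed

definition J :: "real \<Rightarrow> real" where "J l = (\<integral>z. min 1 z * \<phi> l z \<partial>\<mu>)"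

lemma J_nonneg: assumes "\<And>x. 0 \<le> x \<Longrightarrow> 0 \<le> \<phi> l x" shows "0 \<le> J l"
  unfolding J_def by (rule integral_nonneg_pos) (use assms in auto)

text \<open>Otherwise \<open>\<phi> l\<close> vanishes almost everywhere, and then
  \<open>\<phi>_eq\<close> makes it equal to 1 on the whole half-line.\<close>

lemma J_pos:
  assumes nn: "\<And>x. 0 \<le> x \<Longrightarrow> 0 \<le> \<phi> l x"
  shows "0 < J l"
proof (rule ccontr)
  assume "\<not> 0 < J l"
  then have "J l = 0" using J_nonneg[OF nn] by simp
  have "AE z in \<mu>. min 1 z * \<phi> l z = 0"
  proof (rule iffD1[OF integral_nonneg_eq_0_iff_AE])
    show "integrable \<mu> (\<lambda>z. min 1 z * \<phi> l z)" by (rule integrable_\<phi>) auto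
    show "AE z in \<mu>. 0 \<le> min 1 z * \<phi> l z"
      using AE_pos by eventually_elim (use nn in auto)
    show "(\<integral>z. min 1 z * \<phi> l z \<partial>\<mu>) = 0" using \<open>J l = 0\<close> by (simp add: J_def)
  qed
  then have z: "AE z in \<mu>. \<phi> l z = 0"
    using AE_pos by eventually_elim (auto simp: min_def split: if_splits)
  have "\<phi> l x = 1" if "0 \<le> x" for x
  proof -
    have "(\<integral>z. max 0 (z - x) * \<phi> l z \<partial>\<mu>) = (\<integral>z. 0 \<partial>\<mu>)"
      by (rule integral_cong_AE) (use z in \<open>auto elim: eventually_mono\<close>)
    then show ?thesis using \<phi>_eq[OF that, of l] by simp
  qed
  with AE_nonzero[OF z] show False by force
qed

text \<open>For x, z \<ge> 0 one has z = max 0 (z - x) + min x z, so the difference of the integral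
  equation at x and at 0 has kernel \<open>min\<close>. Hence \<open>\<phi> l\<close> is an
  eigenfunction of the min kernel once it vanishes at 0.\<close>

lemma \<phi>_eq_min:
  assumes "0 \<le> x"
  shows "\<phi> l x = \<phi> l 0 + l * (\<integral>z. min x z * \<phi> l z \<partial>\<mu>)"
proof -
  have i: "integrable \<mu> (\<lambda>z. max 0 (z - x) * \<phi> l z)" by (rule integrable_\<phi>) (use assms in auto)
  have j: "integrable \<mu> (\<lambda>z. min x z * \<phi> l z)" by (rule integrable_\<phi>) (use assms in auto)
  have "(\<integral>z. max 0 (z - 0) * \<phi> l z \<partial>\<mu>) = (\<integral>z. max 0 (z - x) * \<phi> l z + min x z * \<phi> l z \<partial>\<mu>)"
    by (rule integral_cong_pos) (use assms in \<open>auto simp: max_def min_def algebra_simps\<close>)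
  also have "\<dots> = (\<integral>z. max 0 (z - x) * \<phi> l z \<partial>\<mu>) + (\<integral>z. min x z * \<phi> l z \<partial>\<mu>)"
    by (rule Bochner_Integration.integral_add[OF i j])
  finally show ?thesis
    using \<phi>_eq[OF assms, of l] \<phi>_eq[of 0 l] by (simp add: algebra_simps)
qed

text \<open>The kernel dominates \<open>min x 1 * min 1 z\<close>, and the part in z integrates to
  \<open>J l\<close>.\<close>

lemma \<phi>_lower:
  assumes nn: "\<And>x. 0 \<le> x \<Longrightarrow> 0 \<le> \<phi> l x" and "0 \<le> l" "0 \<le> x"
  shows "\<phi> l 0 + l * J l * min x 1 \<le> \<phi> l x"
proof -
  have "min x 1 * J l = (\<integral>z. min x 1 * (min 1 z * \<phi> l z) \<partial>\<mu>)" by (simp add: J_def)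
  also have "\<dots> \<le> (\<integral>z. min x z * \<phi> l z \<partial>\<mu>)"
  proof (rule integral_mono_pos)
    show "integrable \<mu> (\<lambda>z. min x 1 * (min 1 z * \<phi> l z))"
      by (rule integrable_mult_right[OF integrable_\<phi>]) auto
    show "integrable \<mu> (\<lambda>z. min x z * \<phi> l z)" by (rule integrable_\<phi>) (use assms in auto)
    show "min x 1 * (min 1 z * \<phi> l z) \<le> min x z * \<phi> l z" if "0 < z" for z
      using mult_right_mono[OF min_le_mult[of x z] nn[of z]] that assms by (simp add: mult.assoc)
  qed
  finally have "min x 1 * J l \<le> (\<integral>z. min x z * \<phi> l z \<partial>\<mu>)" .
  from mult_left_mono[OF this assms(2)] show ?thesis
    using \<phi>_eq_min[OF assms(3), of l] by (simp add: mult_ac)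
qed

definition nonneg_params :: "real set" where "nonneg_params = {l. 0 \<le> l \<and> (\<forall>x\<ge>0. 0 \<le> \<phi> l x)}"

text \<open>Integrating \<open>\<phi>_lower\<close> against \<open>min 1 z\<close> gives l * J l *
  ?q \<le> J l, and the positive factor \<open>J l\<close> cancels.\<close>

lemma nonneg_params_bdd: "\<exists>b. \<forall>l\<in>nonneg_params. l \<le> b"
proof -
  let ?q = "\<integral>z. min 1 z * min 1 z \<partial>\<mu>"
  have int: "integrable \<mu> (\<lambda>z. min 1 z * min 1 z)"
    by (rule integrable_dominated[where K = 1]) auto
  have q: "0 < ?q"
  proof (rule ccontr)
    assume "\<not> 0 < ?q"
    moreover have "0 \<le> ?q" by (rule integral_nonneg_pos) auto
    ultimately have "?q = 0" by simp
    then have "AE z in \<mu>. min 1 z * min 1 z = 0"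
      by (subst integral_nonneg_eq_0_iff_AE[OF int, symmetric]) auto
    from AE_nonzero[OF this] show False by (auto simp: min_def split: if_splits)
  qed
  have "l \<le> 1 / ?q" if "l \<in> nonneg_params" for l
  proof -
    have nn: "\<And>x. 0 \<le> x \<Longrightarrow> 0 \<le> \<phi> l x" and l: "0 \<le> l" using that by (auto simp: nonneg_params_def)
    have "(\<integral>z. l * J l * (min 1 z * min 1 z) \<partial>\<mu>) \<le> J l"
      unfolding J_def[of l]
    \<comment> \<open>The unfolding opened both occurrences of \<open>J l\<close>; the one on the
      left is folded back to stay a constant.\<close>
    proof (subst J_def[symmetric], rule integral_mono_pos)
      show "integrable \<mu> (\<lambda>z. l * J l * (min 1 z * min 1 z))"
        using int by (rule integrable_mult_right)
      show "integrable \<mu> (\<lambda>z. min 1 z * \<phi> l z)" by (rule integrable_\<phi>) auto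
      show "l * J l * (min 1 z * min 1 z) \<le> min 1 z * \<phi> l z" if "0 < z" for z
      proof -
        have "l * J l * min z 1 \<le> \<phi> l z" using \<phi>_lower[OF nn l, of z] nn[of 0] that by simp
        from mult_left_mono[OF this, of "min 1 z"] show ?thesis
          using that by (simp add: mult_ac min.commute)
      qed
    qed
    then have "l * J l * ?q \<le> J l" by (simp only: integral_mult_right_zero)
    then have "(l * ?q) * J l \<le> 1 * J l" by (simp only: mult_1 mult_ac)
    then have "l * ?q \<le> 1" using J_pos[OF nn] by (rule mult_right_le_imp_le)
    then show ?thesis using q by (simp add: pos_le_divide_eq)
  qed
  then show ?thesis by blast
qed

definition l0 :: real where "l0 = Sup nonneg_params"

lemma zero_in_nonneg_params: "0 \<in> nonneg_params"
  by (simp add: nonneg_params_def \<phi>_0)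

lemma nonneg_params_le_l0: "l \<in> nonneg_params \<Longrightarrow> l \<le> l0"
  unfolding l0_def using nonneg_params_bdd by (intro cSup_upper) (auto simp: bdd_above_def)

lemma l0_nonneg: "0 \<le> l0"
  using nonneg_params_le_l0[OF zero_in_nonneg_params] .

text \<open>A negative value of \<open>\<phi> l0\<close> would persist at all nearby parameters, yet
  members of the set come arbitrarily close to \<open>l0\<close> from below.\<close>

lemma l0_in_nonneg_params: "l0 \<in> nonneg_params"
proof (rule ccontr)
  assume "l0 \<notin> nonneg_params"
  then obtain x where x: "0 \<le> x" "0 < - \<phi> l0 x" using l0_nonneg by (auto simp: nonneg_params_def not_le)
  from \<phi>_continuous[OF l0_nonneg x(2)] obtain d where d: "d > 0"
    "\<And>m x'. 0 \<le> m \<Longrightarrow> \<bar>m - l0\<bar> < d \<Longrightarrow> 0 \<le> x' \<Longrightarrow> \<bar>\<phi> m x' - \<phi> l0 x'\<bar> < - \<phi> l0 x" by blast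
  obtain m where m: "m \<in> nonneg_params" "l0 - d < m"
    using less_cSupE[of "l0 - d" nonneg_params] zero_in_nonneg_params d(1) unfolding l0_def by auto
  have "0 \<le> m" "0 \<le> \<phi> m x" using m(1) x(1) by (auto simp: nonneg_params_def)
  moreover have "\<bar>m - l0\<bar> < d" using m(2) nonneg_params_le_l0[OF m(1)] d(1) by simp
  ultimately show False using d(2)[OF _ _ x(1), of m] by simp
qed

definition f :: "real \<Rightarrow> real" where "f = \<phi> l0"

lemma f_measurable [measurable]: "f \<in> borel_measurable borel"
  unfolding f_def by (rule \<phi>_measurable)

lemma f_nonneg: "0 \<le> x \<Longrightarrow> 0 \<le> f x"
  using l0_in_nonneg_params by (simp add: nonneg_params_def f_def)

definition I :: real where "I = (\<integral>z. min 1 z * f z \<partial>\<mu>)"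

lemma I_pos: "0 < I"
  using J_pos[of l0] f_nonneg by (simp add: I_def f_def J_def)

text \<open>If \<open>f 0\<close> were positive, \<open>\<phi>_lower\<close> would keep
  \<open>f\<close> above \<open>f 0\<close> on the half-line. By uniform continuity a slightly
  larger parameter would still be nonnegative, against the choice of \<open>l0\<close>.\<close>

lemma f_0: "f 0 = 0"
proof (rule ccontr)
  assume "f 0 \<noteq> 0"
  then have e: "0 < f 0" using f_nonneg[of 0] by simp
  from \<phi>_continuous[OF l0_nonneg e] obtain d where d: "d > 0"
    "\<And>m x. 0 \<le> m \<Longrightarrow> \<bar>m - l0\<bar> < d \<Longrightarrow> 0 \<le> x \<Longrightarrow> \<bar>\<phi> m x - \<phi> l0 x\<bar> < f 0" by blast
  have "l0 + d / 2 \<in> nonneg_params"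
    unfolding nonneg_params_def
  proof safe
    fix x :: real assume x: "0 \<le> x"
    have "f 0 + l0 * J l0 * min x 1 \<le> f x"
      unfolding f_def by (rule \<phi>_lower) (use f_nonneg l0_nonneg x in \<open>auto simp: f_def\<close>)
    moreover have "0 \<le> l0 * J l0 * min x 1"
      using J_nonneg[of l0] f_nonneg l0_nonneg x by (simp add: f_def)
    ultimately have "f 0 \<le> f x" by simp
    moreover have "\<bar>\<phi> (l0 + d / 2) x - f x\<bar> < f 0"
      using d(2)[of "l0 + d / 2" x] d(1) l0_nonneg x by (simp add: f_def)
    ultimately show "0 \<le> \<phi> (l0 + d / 2) x" by simp
  qed (use d(1) l0_nonneg in simp)
  from nonneg_params_le_l0[OF this] d(1) show False by simp
qed

lemma l0_pos: "0 < l0"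
proof -
  have "l0 \<noteq> 0" using f_0 \<phi>_0[of 0] by (auto simp: f_def)
  then show ?thesis using l0_nonneg by simp
qed

section \<open>The operator \<open>T\<close> and its contraction\<close>

definition T :: "(real \<Rightarrow> real) \<Rightarrow> real \<Rightarrow> real" where
  "T u x = (\<integral>z. min x z * u z \<partial>\<mu>)"

lemma T_measurable [measurable]:
  assumes [measurable]: "u \<in> borel_measurable borel"
  shows "T u \<in> borel_measurable borel"
  unfolding T_def by measurable

lemma T_eigen: assumes "\<phi> l 0 = 0" "0 \<le> x" shows "l * T (\<phi> l) x = \<phi> l x"
  using \<phi>_eq_min[OF assms(2), of l] assms(1) by (simp add: T_def)

lemma T_f: "0 \<le> x \<Longrightarrow> l0 * T f x = f x"
  using T_eigen[of l0] f_0 by (simp add: f_def)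

lemma f_bound: "0 \<le> x \<Longrightarrow> f x \<le> exp (B * l0)"
  using \<phi>_bound[of x l0] l0_nonneg by (simp add: f_def)

lemma f_lower: assumes "0 \<le> x" shows "l0 * I * min x 1 \<le> f x"
proof -
  have "\<phi> l0 0 + l0 * J l0 * min x 1 \<le> \<phi> l0 x"
    by (rule \<phi>_lower) (use f_nonneg l0_nonneg assms in \<open>auto simp: f_def\<close>)
  then show ?thesis using f_0 by (simp add: f_def I_def J_def)
qed

lemma f_pos: "0 < x \<Longrightarrow> 0 < f x"
  using f_lower[of x] I_pos l0_pos by (smt (verit) mult_pos_pos min_less_iff_conj)

definition K :: real where "K = (\<integral>z. max 1 z \<partial>\<mu>)"

lemma integrable_max: "integrable \<mu> (\<lambda>z. max 1 z)"
  using first_moment by (intro integrable_max) auto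

lemma K_nonneg: "0 \<le> K"
  unfolding K_def by (rule integral_nonneg_pos) auto

text \<open>\<open>min_ge_mult\<close> splits off \<open>min x 1\<close>; with
  \<open>f_lower\<close>, one application of \<open>T\<close> brings any bounded function below a
  multiple of \<open>f\<close>.\<close>

lemma T_upper:
  assumes [measurable]: "u \<in> borel_measurable borel" and u: "\<And>z. 0 < z \<Longrightarrow> \<bar>u z\<bar> \<le> W" and x: "0 \<le> x"
  shows "\<bar>T u x\<bar> \<le> W * K * min x 1"
proof -
  have i: "integrable \<mu> (\<lambda>z. min x z * u z)"
    by (rule integrable_dominated[OF _ _ _ u]) (use x in auto)
  have "\<bar>T u x\<bar> \<le> (\<integral>z. \<bar>min x z * u z\<bar> \<partial>\<mu>)"
    unfolding T_def by (rule integral_abs_bound)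
  also have "\<dots> \<le> (\<integral>z. (W * min x 1) * max 1 z \<partial>\<mu>)"
  proof (rule integral_mono_pos)
    show "integrable \<mu> (\<lambda>z. \<bar>min x z * u z\<bar>)" using i by (rule integrable_abs)
    show "integrable \<mu> (\<lambda>z. (W * min x 1) * max 1 z)" by (rule integrable_mult_right[OF integrable_max])
    show "\<bar>min x z * u z\<bar> \<le> (W * min x 1) * max 1 z" if "0 < z" for z
      using mult_mono[OF min_ge_mult[of x z] u[OF that]] that x
      by (simp add: abs_mult mult_ac)
  qed
  finally show ?thesis by (simp add: K_def mult_ac)
qed

text \<open>Obtained by inserting the uniform bound exp (B * l0) on \<open>f\<close> into f = l0 T f
  and applying \<open>T_upper\<close>.\<close>

definition C :: real where "C = l0 * exp (B * l0) * K"

lemma f_upper: assumes "0 \<le> x" shows "f x \<le> C * min x 1"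
proof -
  have "\<bar>T f x\<bar> \<le> exp (B * l0) * K * min x 1"
    by (rule T_upper) (use f_nonneg f_bound assms in auto)
  then have "l0 * T f x \<le> l0 * (exp (B * l0) * K * min x 1)"
    using l0_nonneg by (intro mult_left_mono) auto
  then show ?thesis using T_f[OF assms] by (simp add: C_def mult_ac)
qed

text \<open>Compares the two bounds on \<open>f\<close> at x = 1; it keeps the contraction factor 1
  - l0 * I / C nonnegative.\<close>

lemma C_ge: "l0 * I \<le> C"
  using f_lower[of 1] f_upper[of 1] by simp

lemma C_pos: "0 < C"
  using C_ge I_pos l0_pos by (smt (verit) mult_pos_pos)

text \<open>The Doeblin minorisation: the kernel dominates a product whose part in x,
  \<open>min x 1\<close>, dominates \<open>f / C\<close>.\<close>

lemma T_lower:
  assumes [measurable]: "w \<in> borel_measurable borel" and w: "\<And>z. 0 < z \<Longrightarrow> 0 \<le> w z"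
    and W: "\<And>z. 0 < z \<Longrightarrow> w z \<le> W" and x: "0 \<le> x"
  shows "(\<integral>z. min 1 z * w z \<partial>\<mu>) / C * f x \<le> T w x"
proof -
  have w': "\<bar>w z\<bar> \<le> W" if "0 < z" for z using w[OF that] W[OF that] by simp
  have n: "0 \<le> (\<integral>z. min 1 z * w z \<partial>\<mu>)" by (rule integral_nonneg_pos) (use w in auto)
  have "(\<integral>z. min 1 z * w z \<partial>\<mu>) / C * f x \<le> (\<integral>z. min 1 z * w z \<partial>\<mu>) / C * (C * min x 1)"
    using n C_pos by (intro mult_left_mono f_upper[OF x]) auto
  also have "\<dots> = (\<integral>z. min x 1 * (min 1 z * w z) \<partial>\<mu>)" using C_pos by simp
  also have "\<dots> \<le> T w x"
    unfolding T_def
  proof (rule integral_mono_pos)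
    show "integrable \<mu> (\<lambda>z. min x 1 * (min 1 z * w z))"
      by (rule integrable_mult_right, rule integrable_dominated[OF _ _ _ w']) auto
    show "integrable \<mu> (\<lambda>z. min x z * w z)"
      by (rule integrable_dominated[OF _ _ _ w']) (use x in auto)
    show "min x 1 * (min 1 z * w z) \<le> min x z * w z" if "0 < z" for z
      using mult_right_mono[OF min_le_mult[of x z] w[OF that]] that x by (simp add: mult.assoc)
  qed
  finally show ?thesis .
qed

lemma integrable_T:
  assumes "u \<in> borel_measurable borel" "\<And>z. 0 < z \<Longrightarrow> \<bar>u z\<bar> \<le> W" "0 \<le> x"
  shows "integrable \<mu> (\<lambda>z. min x z * u z)"
  by (rule integrable_dominated[OF _ assms(1) _ assms(2)]) (use assms(3) in auto)

lemma f_abs_bound: "0 < z \<Longrightarrow> \<bar>f z\<bar> \<le> exp (B * l0)"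
  using f_bound[of z] f_nonneg[of z] by simp

lemma sandwich_abs_bound:
  assumes "a * f z \<le> u z \<and> u z \<le> b * f z" "0 < z"
  shows "\<bar>u z\<bar> \<le> (\<bar>a\<bar> + \<bar>b\<bar>) * exp (B * l0)"
proof -
  have "\<bar>u z\<bar> \<le> \<bar>a * f z\<bar> + \<bar>b * f z\<bar>" using assms(1) by linarith
  also have "\<dots> = (\<bar>a\<bar> + \<bar>b\<bar>) * \<bar>f z\<bar>" by (simp add: abs_mult algebra_simps)
  also have "\<dots> \<le> (\<bar>a\<bar> + \<bar>b\<bar>) * exp (B * l0)"
    by (rule mult_left_mono[OF f_abs_bound[OF assms(2)]]) simp
  finally show ?thesis .
qed

text \<open>The minorisation is applied to the nonnegative functions u - a f and b f - u. Their
  pairings \<open>m1\<close> and \<open>m2\<close> with \<open>min 1 z\<close> add up to (b - a) * I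
  for every u, so the two gains together shrink the gap by a fixed factor.\<close>

lemma contraction_step:
  assumes [measurable]: "u \<in> borel_measurable borel"
    and u: "\<And>x. 0 \<le> x \<Longrightarrow> a * f x \<le> u x \<and> u x \<le> b * f x"
  shows "\<exists>a' b'. b' - a' = (1 - l0 * I / C) * (b - a) \<and>
    (\<forall>x\<ge>0. a' * f x \<le> l0 * T u x \<and> l0 * T u x \<le> b' * f x)"
proof -
  define W where "W = (\<bar>a\<bar> + \<bar>b\<bar>) * exp (B * l0)"
  have af: "\<bar>a * f z\<bar> + \<bar>b * f z\<bar> \<le> W" if "0 < z" for z
    using mult_left_mono[OF f_abs_bound[OF that], of "\<bar>a\<bar> + \<bar>b\<bar>"] by (simp add: abs_mult W_def algebra_simps)
  have uW: "\<bar>u z\<bar> \<le> W" if "0 < z" for z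
    using u[OF less_imp_le[OF that]] af[OF that] by linarith
  have i1: "integrable \<mu> (\<lambda>z. k z * f z)"
    if "k \<in> borel_measurable borel" "\<And>z. 0 < z \<Longrightarrow> \<bar>k z\<bar> \<le> z" for k
    using integrable_dominated[OF that(1) _ that(2) f_abs_bound] by simp
  have i2: "integrable \<mu> (\<lambda>z. k z * u z)"
    if "k \<in> borel_measurable borel" "\<And>z. 0 < z \<Longrightarrow> \<bar>k z\<bar> \<le> z" for k
    using integrable_dominated[OF that(1) _ that(2) uW] by simp
  define m1 m2 where "m1 = (\<integral>z. min 1 z * (u z - a * f z) \<partial>\<mu>)"
    and "m2 = (\<integral>z. min 1 z * (b * f z - u z) \<partial>\<mu>)"
  note ints = i1[of "min 1"] i2[of "min 1"]
  have m1: "m1 = (\<integral>z. min 1 z * u z \<partial>\<mu>) - a * I"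
  proof -
    have "m1 = (\<integral>z. min 1 z * u z - a * (min 1 z * f z) \<partial>\<mu>)" by (simp add: m1_def algebra_simps)
    then show ?thesis using ints by (simp add: I_def)
  qed
  have m2: "m2 = b * I - (\<integral>z. min 1 z * u z \<partial>\<mu>)"
  proof -
    have "m2 = (\<integral>z. b * (min 1 z * f z) - min 1 z * u z \<partial>\<mu>)" by (simp add: m2_def algebra_simps)
    then show ?thesis using ints by (simp add: I_def)
  qed
  let ?a = "a + l0 * m1 / C" and ?b = "b - l0 * m2 / C"
  have "?a * f x \<le> l0 * T u x" if x: "0 \<le> x" for x
  proof -
    have "m1 / C * f x \<le> T (\<lambda>z. u z - a * f z) x"
      unfolding m1_def
    proof (rule T_lower[where W = W, OF _ _ _ x])
      show "u z - a * f z \<le> W" if "0 < z" for z using u[OF less_imp_le[OF that]] af[OF that] by linarith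
    qed (use u in auto)
    also have "\<dots> = (\<integral>z. min x z * u z - a * (min x z * f z) \<partial>\<mu>)"
      by (simp add: T_def algebra_simps)
    also have "\<dots> = T u x - a * T f x"
      using i1[of "min x"] i2[of "min x"] x by (simp add: T_def)
    finally have "l0 * (m1 / C * f x) \<le> l0 * (T u x - a * T f x)" using l0_nonneg by (rule mult_left_mono)
    also have "\<dots> = l0 * T u x - a * f x"
      using T_f[OF x] by (simp add: right_diff_distrib mult.left_commute[of l0 a])
    finally show ?thesis by (simp add: algebra_simps)
  qed
  moreover have "l0 * T u x \<le> ?b * f x" if x: "0 \<le> x" for x
  proof -
    have "m2 / C * f x \<le> T (\<lambda>z. b * f z - u z) x"
      unfolding m2_def
    proof (rule T_lower[where W = W, OF _ _ _ x])
      show "b * f z - u z \<le> W" if "0 < z" for z using u[OF less_imp_le[OF that]] af[OF that] by linarith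
    qed (use u in auto)
    also have "\<dots> = (\<integral>z. b * (min x z * f z) - min x z * u z \<partial>\<mu>)"
      by (simp add: T_def algebra_simps)
    also have "\<dots> = b * T f x - T u x"
      using i1[of "min x"] i2[of "min x"] x by (simp add: T_def)
    finally have "l0 * (m2 / C * f x) \<le> l0 * (b * T f x - T u x)" using l0_nonneg by (rule mult_left_mono)
    also have "\<dots> = b * f x - l0 * T u x"
      using T_f[OF x] by (simp add: right_diff_distrib mult.left_commute[of l0 b])
    finally show ?thesis by (simp add: algebra_simps)
  qed
  moreover have "?b - ?a = (1 - l0 * I / C) * (b - a)"
    using C_pos by (simp add: m1 m2 field_simps)
  ultimately show ?thesis by blast
qed

lemma iterate_measurable [measurable]:
  assumes "u \<in> borel_measurable borel"
  shows "((\<lambda>u x. l0 * T u x) ^^ n) u \<in> borel_measurable borel"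
proof (induction n)
  case (Suc n)
  then show ?case by simp
qed (use assms in simp)

lemma contraction:
  assumes u: "u \<in> borel_measurable borel" "\<And>x. 0 \<le> x \<Longrightarrow> a * f x \<le> u x \<and> u x \<le> b * f x"
  shows "\<exists>a' b'. b' - a' = (1 - l0 * I / C) ^ n * (b - a) \<and>
    (\<forall>x\<ge>0. a' * f x \<le> ((\<lambda>u x. l0 * T u x) ^^ n) u x \<and> ((\<lambda>u x. l0 * T u x) ^^ n) u x \<le> b' * f x)"
proof (induction n)
  case 0
  then show ?case using u(2) by auto
next
  case (Suc n)
  then obtain a' b' where ab: "b' - a' = (1 - l0 * I / C) ^ n * (b - a)"
    "\<And>x. 0 \<le> x \<Longrightarrow> a' * f x \<le> ((\<lambda>u x. l0 * T u x) ^^ n) u x \<and> ((\<lambda>u x. l0 * T u x) ^^ n) u x \<le> b' * f x"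
    by blast
  from contraction_step[OF iterate_measurable[OF u(1)] ab(2)] show ?case
    unfolding ab(1) by (simp add: mult.assoc)
qed

text \<open>A zero l < l0 would make \<open>\<phi> l\<close> an eigenfunction of l T. Starting from
  |\<phi> l| \<le> A f, each application of l T gains a factor l / l0, because l0 T f = f; so
  \<open>\<phi> l\<close> vanishes on the half-line, which contradicts the constant 1 in
  \<open>\<phi>_eq\<close>. The sign of \<open>\<phi> l\<close> is left open, so all zeros are
  covered.\<close>

lemma eigenvalue_minimal:
  assumes l: "0 < l" "\<phi> l 0 = 0"
  shows "l0 \<le> l"
proof (rule ccontr)
  assume "\<not> l0 \<le> l"
  then have ll: "l < l0" by simp
  \<comment> \<open>The numerator is the bound from \<open>T_upper\<close> on l T (\<phi> l) =
    \<phi> l; the denominator comes from \<open>f_lower\<close>.\<close>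
  define A where "A = l * exp (B * l) * K / (l0 * I)"
  have base: "\<bar>\<phi> l x\<bar> \<le> A * f x" if x: "0 \<le> x" for x
  proof -
    have "\<bar>T (\<phi> l) x\<bar> \<le> exp (B * l) * K * min x 1"
      by (rule T_upper) (use \<phi>_bound[of _ l] l x in auto)
    then have "l * \<bar>T (\<phi> l) x\<bar> \<le> l * (exp (B * l) * K * min x 1)"
      using l by (intro mult_left_mono) auto
    also have "\<dots> = A * (l0 * I * min x 1)" using l0_pos I_pos by (simp add: A_def)
    also have "\<dots> \<le> A * f x"
      using l K_nonneg l0_pos I_pos by (intro mult_left_mono f_lower[OF x]) (auto simp: A_def)
    finally show ?thesis using T_eigen[OF l(2) x] l by (metis abs_mult abs_of_pos)
  qed
  have A0: "0 \<le> A" using l K_nonneg l0_pos I_pos by (auto simp: A_def)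
  have step: "\<bar>\<phi> l x\<bar> \<le> (l / l0) ^ n * A * f x" if x: "0 \<le> x" for x n
    using x
  proof (induction n arbitrary: x)
    case 0
    then show ?case using base by simp
  next
    case (Suc n)
    let ?c = "(l / l0) ^ n * A"
    have c0: "0 \<le> ?c" using A0 l l0_pos by simp
    have if': "integrable \<mu> (\<lambda>z. min x z * f z)"
      unfolding f_def by (rule integrable_\<phi>) (use Suc.prems in auto)
    have "\<bar>T (\<phi> l) x\<bar> \<le> (\<integral>z. \<bar>min x z * \<phi> l z\<bar> \<partial>\<mu>)"
      unfolding T_def by (rule integral_abs_bound)
    also have "\<dots> \<le> (\<integral>z. ?c * (min x z * f z) \<partial>\<mu>)"
    proof (rule integral_mono_pos)
      show "integrable \<mu> (\<lambda>z. \<bar>min x z * \<phi> l z\<bar>)"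
        by (rule integrable_abs, rule integrable_\<phi>) (use Suc.prems in auto)
      show "integrable \<mu> (\<lambda>z. ?c * (min x z * f z))" using if' by (rule integrable_mult_right)
      show "\<bar>min x z * \<phi> l z\<bar> \<le> ?c * (min x z * f z)" if "0 < z" for z
        using mult_left_mono[OF Suc.IH[of z], of "min x z"] that Suc.prems by (simp add: abs_mult mult_ac)
    qed
    also have "\<dots> = ?c * T f x" by (simp add: T_def)
    finally have "l * \<bar>T (\<phi> l) x\<bar> \<le> l * (?c * T f x)" using l by (intro mult_left_mono) auto
    also have "\<dots> = (l / l0) * ?c * (l0 * T f x)" using l0_pos by simp
    also have "l * \<bar>T (\<phi> l) x\<bar> = \<bar>\<phi> l x\<bar>"
      using T_eigen[OF l(2) Suc.prems] l by (metis abs_mult abs_of_pos)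
    finally show ?case using T_f[OF Suc.prems] by (simp add: mult_ac)
  qed
  have zero: "\<phi> l x = 0" if "0 \<le> x" for x
  proof -
    have "(\<lambda>n. (l / l0) ^ n * A * f x) \<longlonglongrightarrow> 0 * A * f x"
      by (intro tendsto_mult LIMSEQ_power_zero tendsto_const) (use l ll in auto)
    then have "\<bar>\<phi> l x\<bar> \<le> 0 * A * f x"
      by (rule LIMSEQ_le_const) (use step[OF that] in blast)
    then show ?thesis by simp
  qed
  have "(\<integral>z. max 0 (z - 0) * \<phi> l z \<partial>\<mu>) = (\<integral>z. 0 \<partial>\<mu>)"
    by (rule integral_cong_pos) (use zero in auto)
  then show False using \<phi>_eq[of 0 l] l by simp
qed

section \<open>Symmetry of \<open>T\<close> and the conserved pairing with \<open>f\<close>\<close>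

lemma Fubini_min:
  fixes u w :: "real \<Rightarrow> real"
  assumes nu: "finite_measure \<nu>" "sets \<nu> = sets borel" "AE z in \<nu>. 0 < z"
    and [measurable]: "u \<in> borel_measurable borel" "w \<in> borel_measurable borel"
    and u: "\<And>z. 0 < z \<Longrightarrow> \<bar>u z\<bar> \<le> U" and w: "\<And>z. 0 < z \<Longrightarrow> \<bar>w z\<bar> \<le> V"
  shows "(\<integral>x. (\<integral>z. min x z * u z \<partial>\<nu>) * w x \<partial>\<mu>) = (\<integral>z. u z * T w z \<partial>\<nu>)"
proof -
  interpret N: finite_measure \<nu> by fact
  note nu(2) [measurable_cong, simp]
  interpret P: pair_sigma_finite \<mu> \<nu> ..
  \<comment> \<open>This bound is integrable on the product, as \<nu> is finite and \<mu> has a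
    first moment. Two different measures cover both the symmetry of \<open>T\<close> and the pairing
    of the starting function with \<open>f\<close>.\<close>
  have bd: "\<bar>min x z * u z * w x\<bar> \<le> x * (U * V)" if "0 < x" "0 < z" for x z
  proof -
    have "0 \<le> U" using u[OF that(2)] by linarith
    then have "\<bar>u z\<bar> * \<bar>w x\<bar> \<le> U * V" using u[OF that(2)] w[OF that(1)] by (intro mult_mono) auto
    moreover have "\<bar>min x z\<bar> \<le> x" using that by auto
    ultimately have "\<bar>min x z\<bar> * (\<bar>u z\<bar> * \<bar>w x\<bar>) \<le> x * (U * V)"
      by (intro mult_mono[OF \<open>\<bar>min x z\<bar> \<le> x\<close>]) (use that in auto)
    then show ?thesis by (simp only: abs_mult mult.assoc)
  qed
  have int1: "integrable \<nu> (\<lambda>z. min x z * u z * w x)" if x: "0 < x" for x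
    by (rule N.integrable_const_bound[where B = "x * (U * V)"])
       (use nu(3) bd[OF x] in \<open>auto elim: eventually_mono\<close>)
  have "integrable (\<mu> \<Otimes>\<^sub>M \<nu>) (\<lambda>(x, z). min x z * u z * w x)"
  proof (rule P.Fubini_integrable)
    show "AE x in \<mu>. integrable \<nu> (\<lambda>z. case (x, z) of (x, z) \<Rightarrow> min x z * u z * w x)"
      using AE_pos
    proof eventually_elim
      case (elim x)
      then show ?case unfolding prod.case by (rule int1)
    qed
    show "integrable \<mu> (\<lambda>x. \<integral>z. norm (case (x, z) of (x, z) \<Rightarrow> min x z * u z * w x) \<partial>\<nu>)"
    proof (rule Bochner_Integration.integrable_bound)
      show "integrable \<mu> (\<lambda>x. x * (U * V * measure \<nu> (space \<nu>)))" using first_moment by simp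
      show "AE x in \<mu>. norm (\<integral>z. norm (case (x, z) of (x, z) \<Rightarrow> min x z * u z * w x) \<partial>\<nu>)
          \<le> norm (x * (U * V * measure \<nu> (space \<nu>)))"
        using AE_pos
      proof eventually_elim
        case (elim x)
        have "(\<integral>z. \<bar>min x z * u z * w x\<bar> \<partial>\<nu>) \<le> (\<integral>z. x * (U * V) \<partial>\<nu>)"
          by (rule integral_mono_AE)
             (use int1[OF elim] nu(3) bd[OF elim] in \<open>auto elim: eventually_mono intro: integrable_abs\<close>)
        also have "\<dots> = x * (U * V * measure \<nu> (space \<nu>))" by simp
        finally show ?case by simp
      qed
    qed measurable
  qed measurable
  from P.Fubini_integral[OF this]
  have "(\<integral>x. (\<integral>z. min x z * u z * w x \<partial>\<nu>) \<partial>\<mu>) = (\<integral>z. (\<integral>x. min x z * u z * w x \<partial>\<mu>) \<partial>\<nu>)"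
    by simp
  also have "(\<integral>x. (\<integral>z. min x z * u z * w x \<partial>\<nu>) \<partial>\<mu>) = (\<integral>x. (\<integral>z. min x z * u z \<partial>\<nu>) * w x \<partial>\<mu>)"
    by simp
  also have "(\<lambda>z. \<integral>x. min x z * u z * w x \<partial>\<mu>) = (\<lambda>z. u z * T w z)"
  proof
    fix z
    have "(\<integral>x. min x z * u z * w x \<partial>\<mu>) = (\<integral>x. u z * (min z x * w x) \<partial>\<mu>)"
      by (simp add: mult_ac min.commute)
    then show "(\<integral>x. min x z * u z * w x \<partial>\<mu>) = u z * T w z" by (simp add: T_def)
  qed
  finally show ?thesis .
qed

text \<open>Symmetry moves \<open>T\<close> onto \<open>f\<close>, where \<open>l0 * T\<close> acts
  as the identity.\<close>

lemma self_adjoint: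
  assumes [measurable]: "u \<in> borel_measurable borel" and u: "\<And>z. 0 < z \<Longrightarrow> \<bar>u z\<bar> \<le> U"
  shows "(\<integral>x. l0 * T u x * f x \<partial>\<mu>) = (\<integral>x. u x * f x \<partial>\<mu>)"
proof -
  have "(\<integral>x. T u x * f x \<partial>\<mu>) = (\<integral>z. u z * T f z \<partial>\<mu>)"
    unfolding T_def[of u]
    by (rule Fubini_min[OF finite_measure_axioms sets_mu AE_pos _ _ u f_abs_bound]) auto
  then have "(\<integral>x. l0 * T u x * f x \<partial>\<mu>) = (\<integral>z. l0 * (u z * T f z) \<partial>\<mu>)"
    by (simp add: mult.assoc)
  also have "\<dots> = (\<integral>z. u z * f z \<partial>\<mu>)"
  proof (rule integral_cong_pos)
    show "l0 * (u z * T f z) = u z * f z" if "0 < z" for z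
      using T_f[of z] that by (simp add: mult.left_commute)
  qed auto
  finally show ?thesis .
qed

text \<open>The squared norm of \<open>f\<close> in L2(\<mu>), whose root normalises
  \<open>f0\<close>.\<close>

definition D :: real where "D = (\<integral>x. f x * f x \<partial>\<mu>)"

lemma integrable_f_mult:
  assumes [measurable]: "u \<in> borel_measurable borel" and u: "\<And>z. 0 < z \<Longrightarrow> \<bar>u z\<bar> \<le> U"
  shows "integrable \<mu> (\<lambda>x. u x * f x)"
proof (rule integrable_const_bound)
  show "AE x in \<mu>. norm (u x * f x) \<le> U * exp (B * l0)"
    using AE_pos
  proof eventually_elim
    case (elim x)
    have "0 \<le> U" using u[OF elim] by linarith
    then show ?case unfolding real_norm_def abs_mult
      by (intro mult_mono u f_abs_bound elim) auto
  qed
qed measurable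

lemma D_pos: "0 < D"
proof (rule ccontr)
  assume "\<not> 0 < D"
  moreover have "0 \<le> D" unfolding D_def by (rule integral_nonneg_pos) auto
  ultimately have "D = 0" by simp
  then have "AE x in \<mu>. f x * f x = 0"
    unfolding D_def by (subst integral_nonneg_eq_0_iff_AE[OF integrable_f_mult[OF _ f_abs_bound], symmetric]) auto
  from AE_nonzero[OF this] obtain z where "0 < z" "f z = 0" by auto
  with f_pos[of z] show False by simp
qed

text \<open>\<open>self_adjoint\<close> asks for bounded functions; the sandwich from
  \<open>contraction\<close> bounds every iterate.\<close>

lemma iterate_self_adjoint:
  assumes u: "u \<in> borel_measurable borel" "\<And>x. 0 \<le> x \<Longrightarrow> a * f x \<le> u x \<and> u x \<le> b * f x"
  shows "(\<integral>x. ((\<lambda>u x. l0 * T u x) ^^ n) u x * f x \<partial>\<mu>) = (\<integral>x. u x * f x \<partial>\<mu>)"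
proof (induction n)
  case (Suc n)
  let ?u = "((\<lambda>u x. l0 * T u x) ^^ n) u"
  from contraction[OF u, of n] obtain a' b' where ab:
    "\<And>x. 0 \<le> x \<Longrightarrow> a' * f x \<le> ?u x \<and> ?u x \<le> b' * f x" by blast
  have "\<bar>?u z\<bar> \<le> (\<bar>a'\<bar> + \<bar>b'\<bar>) * exp (B * l0)" if "0 < z" for z
    by (rule sandwich_abs_bound[where u = ?u, OF ab[OF less_imp_le[OF that]] that])
  from self_adjoint[OF iterate_measurable[OF u(1)] this] Suc.IH show ?case by simp
qed simp

text \<open>Pairing a' f \<le> u_n \<le> b' f with \<open>f\<close> and using the conserved integral
  puts the limiting coefficient between a' and b' as well, so the error is at most the gap times
  \<open>f\<close>.\<close>

lemma iterate_limit:
  assumes u: "u \<in> borel_measurable borel" "\<And>x. 0 \<le> x \<Longrightarrow> a * f x \<le> u x \<and> u x \<le> b * f x"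
    and x: "0 \<le> x"
  shows "\<bar>((\<lambda>u x. l0 * T u x) ^^ n) u x - (\<integral>x. u x * f x \<partial>\<mu>) / D * f x\<bar>
    \<le> (1 - l0 * I / C) ^ n * (b - a) * f x"
proof -
  let ?u = "((\<lambda>u x. l0 * T u x) ^^ n) u" and ?N = "\<integral>x. u x * f x \<partial>\<mu>"
  from contraction[OF u, of n] obtain a' b' where gap: "b' - a' = (1 - l0 * I / C) ^ n * (b - a)"
    and ab: "\<And>x. 0 \<le> x \<Longrightarrow> a' * f x \<le> ?u x \<and> ?u x \<le> b' * f x" by blast
  have uW: "\<bar>?u z\<bar> \<le> (\<bar>a'\<bar> + \<bar>b'\<bar>) * exp (B * l0)" if "0 < z" for z
    by (rule sandwich_abs_bound[where u = ?u, OF ab[OF less_imp_le[OF that]] that])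
  note iu = integrable_f_mult[OF iterate_measurable[OF u(1)] uW]
  note iff = integrable_f_mult[OF f_measurable f_abs_bound]
  have "(\<integral>x. a' * (f x * f x) \<partial>\<mu>) \<le> (\<integral>x. ?u x * f x \<partial>\<mu>)"
  proof (rule integral_mono_pos[OF integrable_mult_right[OF iff] iu])
    show "a' * (f z * f z) \<le> ?u z * f z" if "0 < z" for z
      using mult_right_mono[of "a' * f z" "?u z" "f z"] ab[of z] f_nonneg[of z] that by (simp add: mult.assoc)
  qed
  then have 1: "a' \<le> ?N / D"
    using iterate_self_adjoint[OF u, of n] D_pos by (simp add: D_def[symmetric] field_simps)
  have "(\<integral>x. ?u x * f x \<partial>\<mu>) \<le> (\<integral>x. b' * (f x * f x) \<partial>\<mu>)"
  proof (rule integral_mono_pos[OF iu integrable_mult_right[OF iff]])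
    show "?u z * f z \<le> b' * (f z * f z)" if "0 < z" for z
      using mult_right_mono[of "?u z" "b' * f z" "f z"] ab[of z] f_nonneg[of z] that by (simp add: mult.assoc)
  qed
  then have 2: "?N / D \<le> b'"
    using iterate_self_adjoint[OF u, of n] D_pos by (simp add: D_def[symmetric] field_simps)
  have "a' * f x \<le> ?N / D * f x" "?N / D * f x \<le> b' * f x"
    by (rule mult_right_mono[OF 1 f_nonneg[OF x]], rule mult_right_mono[OF 2 f_nonneg[OF x]])
  then have "\<bar>?u x - ?N / D * f x\<bar> \<le> b' * f x - a' * f x" using ab[OF x] by linarith
  then show ?thesis unfolding gap[symmetric] by (simp add: algebra_simps)
qed

text \<open>With m = \<integral> f d\<nu>, Fubini and T f = f / l0 give \<integral> F 0 f d\<mu> = m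
  / l0, so the coefficient of \<open>f\<close> is m / (l0 D). The final integration contributes a
  second m, and the extra power in \<open>Suc l\<close> removes the l0.\<close>

theorem iterate_integral_limit:
  fixes F :: "nat \<Rightarrow> real \<Rightarrow> real"
  assumes nu: "finite_measure \<nu>" "sets \<nu> = sets borel" "AE z in \<nu>. 0 < z" "integrable \<nu> (\<lambda>x. x)"
    and F0: "F 0 = (\<lambda>x. \<integral>y. min x y \<partial>\<nu>)" and FS: "\<And>l. F (Suc l) = T (F l)"
  shows "(\<lambda>l. l0 ^ Suc l * (\<integral>x. F l x \<partial>\<nu>)) \<longlonglongrightarrow> (\<integral>x. f x \<partial>\<nu>)\<^sup>2 / D"
proof -
  interpret N: finite_measure \<nu> by fact
  note nu(2) [measurable_cong, simp]
  have [simp]: "space \<nu> = UNIV" using sets_eq_imp_space_eq[OF nu(2)] by simp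
  define Q where "Q = (\<integral>z. max 1 z \<partial>\<nu>)"
  have iQ: "integrable \<nu> (\<lambda>z. max 1 z)" using nu(4) by (intro Bochner_Integration.integrable_max) auto
  have F0m: "F 0 \<in> borel_measurable borel" unfolding F0 by measurable
  have F0b: "0 \<le> F 0 x \<and> F 0 x \<le> Q * min x 1" if x: "0 \<le> x" for x
  proof
    show "0 \<le> F 0 x"
      unfolding F0 by (rule integral_nonneg_AE) (use nu(3) x in \<open>auto elim: eventually_mono\<close>)
    have "F 0 x \<le> (\<integral>z. min x 1 * max 1 z \<partial>\<nu>)"
      unfolding F0
    proof (rule integral_mono_AE)
      show "integrable \<nu> (min x)" using nu(4) by (intro Bochner_Integration.integrable_min) auto
      show "integrable \<nu> (\<lambda>z. min x 1 * max 1 z)" using iQ by (rule integrable_mult_right)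
      show "AE z in \<nu>. min x z \<le> min x 1 * max 1 z"
        using nu(3) by eventually_elim (use x min_ge_mult in auto)
    qed
    then show "F 0 x \<le> Q * min x 1" by (simp add: Q_def mult.commute)
  qed
  have Q0: "0 \<le> Q" unfolding Q_def by (rule Bochner_Integration.integral_nonneg) auto
  \<comment> \<open>From F 0 x \<le> Q * min x 1 and \<open>f_lower\<close>.\<close>
  define b where "b = Q / (l0 * I)"
  have F0ab: "0 * f x \<le> F 0 x \<and> F 0 x \<le> b * f x" if x: "0 \<le> x" for x
  proof -
    have "F 0 x \<le> b * (l0 * I * min x 1)" using F0b[OF x] l0_pos I_pos by (simp add: b_def)
    also have "\<dots> \<le> b * f x"
      using Q0 l0_pos I_pos by (intro mult_left_mono f_lower[OF x]) (auto simp: b_def)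
    finally show ?thesis using F0b[OF x] by simp
  qed
  have iter: "((\<lambda>u x. l0 * T u x) ^^ l) (F 0) = (\<lambda>x. l0 ^ l * F l x)" for l
  proof (induction l)
    case (Suc l)
    have "l0 * T (\<lambda>x. l0 ^ l * F l x) x = l0 ^ Suc l * T (F l) x" for x
    proof -
      have "T (\<lambda>x. l0 ^ l * F l x) x = (\<integral>z. l0 ^ l * (min x z * F l z) \<partial>\<mu>)"
        by (simp add: T_def mult.left_commute)
      then show ?thesis by (simp add: T_def)
    qed
    then show ?case by (simp only: funpow.simps o_apply Suc.IH FS)
  qed simp
  define m where "m = (\<integral>x. f x \<partial>\<nu>)"
  have fE: "AE z in \<nu>. norm (f z) \<le> exp (B * l0)"
    using nu(3) by eventually_elim (use f_abs_bound in auto)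
  have fnu: "integrable \<nu> f"
    by (rule N.integrable_const_bound[OF fE]) measurable
  have Nval: "(\<integral>x. F 0 x * f x \<partial>\<mu>) = m / l0"
  proof -
    have "(\<integral>x. (\<integral>z. min x z * 1 \<partial>\<nu>) * f x \<partial>\<mu>) = (\<integral>z. 1 * T f z \<partial>\<nu>)"
      by (rule Fubini_min[OF nu(1-3), where U = 1, OF _ _ _ f_abs_bound]) auto
    also have "\<dots> = (\<integral>z. f z / l0 \<partial>\<nu>)"
    proof (rule integral_cong_AE)
      show "AE z in \<nu>. 1 * T f z = f z / l0"
        using nu(3) by eventually_elim (use T_f l0_pos in \<open>auto simp: field_simps\<close>)
    qed auto
    finally show ?thesis by (simp add: F0 m_def)
  qed
  define \<rho> where "\<rho> = 1 - l0 * I / C"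
  have \<rho>: "0 \<le> \<rho>" "\<rho> < 1"
    using C_ge C_pos l0_pos I_pos by (auto simp: \<rho>_def field_simps)
  let ?k = "m / l0 / D"
  have Fm: "(\<lambda>x. l0 ^ l * F l x) \<in> borel_measurable borel" for l
    using iterate_measurable[OF F0m, of l] by (simp add: iter)
  have diff: "\<bar>l0 ^ l * F l x - ?k * f x\<bar> \<le> \<rho> ^ l * b * f x" if "0 \<le> x" for x l
    using iterate_limit[OF F0m F0ab that, of l] unfolding iter Nval \<rho>_def by simp
  \<comment> \<open>The pointwise error is a geometric factor times the \<nu>-integrable function
    \<open>f\<close>, so it can be integrated.\<close>
  have bound: "\<bar>l0 ^ l * (\<integral>x. F l x \<partial>\<nu>) - ?k * m\<bar> \<le> \<rho> ^ l * (b * m)" for l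
  proof -
    have id: "integrable \<nu> (\<lambda>x. l0 ^ l * F l x - ?k * f x)"
    proof (rule Bochner_Integration.integrable_bound)
      show "integrable \<nu> (\<lambda>x. \<rho> ^ l * b * f x)" using fnu by simp
      show "AE x in \<nu>. norm (l0 ^ l * F l x - ?k * f x) \<le> norm (\<rho> ^ l * b * f x)"
        using nu(3)
      proof eventually_elim
        case (elim x)
        then show ?case using diff[of x l] by simp
      qed
      show "(\<lambda>x. l0 ^ l * F l x - ?k * f x) \<in> borel_measurable \<nu>"
        by (rule borel_measurable_diff) (use Fm[of l] in simp_all)
    qed
    have iF: "integrable \<nu> (\<lambda>x. l0 ^ l * F l x)"
      using Bochner_Integration.integrable_add[OF id integrable_mult_right[OF fnu, of ?k]] by simp
    have "(\<integral>x. l0 ^ l * F l x - ?k * f x \<partial>\<nu>) = l0 ^ l * (\<integral>x. F l x \<partial>\<nu>) - ?k * m"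
      using iF fnu by (simp add: m_def)
    then have "\<bar>l0 ^ l * (\<integral>x. F l x \<partial>\<nu>) - ?k * m\<bar> \<le> (\<integral>x. \<bar>l0 ^ l * F l x - ?k * f x\<bar> \<partial>\<nu>)"
      using integral_abs_bound[of \<nu> "\<lambda>x. l0 ^ l * F l x - ?k * f x"] by simp
    also have "\<dots> \<le> (\<integral>x. \<rho> ^ l * b * f x \<partial>\<nu>)"
    proof (rule integral_mono_AE)
      show "AE x in \<nu>. \<bar>l0 ^ l * F l x - ?k * f x\<bar> \<le> \<rho> ^ l * b * f x"
        using nu(3) by eventually_elim (use diff in auto)
    qed (use id fnu in \<open>auto intro: integrable_abs\<close>)
    finally show ?thesis by (simp add: m_def mult.assoc)
  qed
  have "(\<lambda>l. l0 ^ l * (\<integral>x. F l x \<partial>\<nu>) - ?k * m) \<longlonglongrightarrow> 0"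
  proof (rule Lim_null_comparison)
    show "\<forall>\<^sub>F l in sequentially. norm (l0 ^ l * (\<integral>x. F l x \<partial>\<nu>) - ?k * m) \<le> \<rho> ^ l * (b * m)"
      using bound by simp
    show "(\<lambda>l. \<rho> ^ l * (b * m)) \<longlonglongrightarrow> 0"
      by (intro tendsto_mult_left_zero LIMSEQ_power_zero) (use \<rho> in simp)
  qed
  then have "(\<lambda>l. l0 ^ l * (\<integral>x. F l x \<partial>\<nu>)) \<longlonglongrightarrow> ?k * m"
    by (simp add: LIM_zero_iff)
  then have "(\<lambda>l. l0 * (l0 ^ l * (\<integral>x. F l x \<partial>\<nu>))) \<longlonglongrightarrow> l0 * (?k * m)"
    by (rule tendsto_mult_left)
  then show ?thesis using l0_pos by (simp add: m_def power2_eq_square mult_ac)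
qed

end

section \<open>Generations as sets of words\<close>

text \<open>Replaces components and walks by a condition along the path from the root, which
  involves only the marks of prefixes of \<open>u\<close>.\<close>

definition kept :: "(nat list \<Rightarrow> nat) \<Rightarrow> (nat list \<Rightarrow> real) \<Rightarrow> (nat list \<Rightarrow> real) \<Rightarrow> nat list \<Rightarrow> bool" where
  "kept n v \<zeta> u \<longleftrightarrow> (\<forall>k<length u. 1 \<le> u ! k \<and> u ! k \<le> n (take k u) \<and>
     \<zeta> (take (Suc k) u) < v (take (Suc k) u))"

lemma kept_Nil [simp]: "kept n v \<zeta> []"
  by (simp add: kept_def)

lemma kept_snoc [simp]:
  "kept n v \<zeta> (u @ [j]) \<longleftrightarrow> kept n v \<zeta> u \<and> 1 \<le> j \<and> j \<le> n u \<and> \<zeta> (u @ [j]) < v (u @ [j])"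
  unfolding kept_def by (auto simp: All_less_Suc nth_append)

lemma kept_in_lists: "kept n v \<zeta> u \<Longrightarrow> u \<in> lists {1..}"
  by (induction u rule: rev_induct) auto

lemma kept_in_backbone: "kept n v \<zeta> u \<Longrightarrow> u \<in> backbone_tree n"
proof (induction u rule: rev_induct)
  case Nil
  show ?case by (simp add: backbone_tree_def component_def)
next
  case (snoc j u)
  then have "(u, u @ [j]) \<in> potential_edges n"
    using kept_in_lists[of n v \<zeta> u] by (auto simp: potential_edges_def)
  moreover have "u \<in> backbone_tree n" using snoc by simp
  ultimately show ?case
    unfolding backbone_tree_def component_def walk_step_def
    by (auto intro: rtrancl_into_rtrancl)
qed

lemma kept_walk:
  "kept n v \<zeta> u \<Longrightarrow> ([], u) \<in> walk_step (kept_edges n v \<zeta>) ^^ length u"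
proof (induction u rule: rev_induct)
  case (snoc j u)
  have "(u, u @ [j]) \<in> kept_edges n v \<zeta>"
    using snoc.prems kept_in_lists[of n v \<zeta> u] kept_in_backbone[OF snoc.prems] kept_in_backbone[of n v \<zeta> u]
    by (auto simp: kept_edges_def potential_edges_def)
  then show ?case using snoc by (auto simp: walk_step_def)
qed simp

text \<open>A walk may go back along an edge, but \<open>kept\<close> passes to prefixes, so both
  directions preserve it.\<close>

lemma walk_kept:
  assumes "([], u) \<in> (walk_step (kept_edges n v \<zeta>))\<^sup>*"
  shows "kept n v \<zeta> u"
  using assms
proof (induction rule: rtrancl_induct)
  case (step y z)
  then show ?case
    by (auto simp: walk_step_def kept_edges_def potential_edges_def)
qed simp

text \<open>An edge changes the length by exactly one; with \<open>kept_walk\<close> this identifies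
  the distance from the root with the length.\<close>

lemma walk_length:
  "([], u) \<in> walk_step (kept_edges n v \<zeta>) ^^ k \<Longrightarrow> length u \<le> k"
proof (induction k arbitrary: u)
  case (Suc k)
  then obtain w where w: "([], w) \<in> walk_step (kept_edges n v \<zeta>) ^^ k" "(w, u) \<in> walk_step (kept_edges n v \<zeta>)"
    by auto
  have "length u \<le> Suc (length w)"
    using w(2) by (auto simp: walk_step_def kept_edges_def potential_edges_def)
  then show ?case using Suc.IH[OF w(1)] by simp
qed simp

lemma ewt_generation_eq:
  "ewt_generation n v \<zeta> l = {u. length u = l \<and> kept n v \<zeta> u}"
proof -
  have dist: "graph_dist (kept_edges n v \<zeta>) [] u = length u" if "kept n v \<zeta> u" for u
    unfolding graph_dist_def
    by (rule Least_equality[where P = "\<lambda>l. ([], u) \<in> walk_step (kept_edges n v \<zeta>) ^^ l"])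
       (use kept_walk[OF that] walk_length in auto)
  have "u \<in> ewt_vertices n v \<zeta> \<longleftrightarrow> kept n v \<zeta> u" for u
    unfolding ewt_vertices_def component_def
    using walk_kept[of u n v \<zeta>] kept_walk[of n v \<zeta> u] by (auto intro: relpow_imp_rtrancl)
  then show ?thesis using dist by (auto simp: ewt_generation_def)
qed

lemma finite_kept: "finite {u. length u = l \<and> kept n v \<zeta> u}"
proof (induction l)
  case (Suc l)
  have "{u. length u = Suc l \<and> kept n v \<zeta> u} \<subseteq>
    (\<Union>u\<in>{u. length u = l \<and> kept n v \<zeta> u}. (\<lambda>j. u @ [j]) ` {1..n u})"
  proof
    fix u assume u: "u \<in> {u. length u = Suc l \<and> kept n v \<zeta> u}"
    then obtain w j where "u = w @ [j]" by (cases u rule: rev_cases) auto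
    with u show "u \<in> (\<Union>u\<in>{u. length u = l \<and> kept n v \<zeta> u}. (\<lambda>j. u @ [j]) ` {1..n u})" by auto
  qed
  then show ?case by (rule finite_subset) (use Suc in auto)
qed simp

definition words :: "nat \<Rightarrow> nat list set" where
  "words l = {u \<in> lists {1..}. length u = l}"

lemma words_0: "words 0 = {[]}"
  by (auto simp: words_def)

lemma nn_integral_words_Suc:
  "(\<integral>\<^sup>+u. q u \<partial>count_space (words (Suc l))) =
   (\<integral>\<^sup>+w. (\<integral>\<^sup>+j. q (w @ [j]) \<partial>count_space {1..}) \<partial>count_space (words l))"
proof -
  have bij: "bij_betw (\<lambda>(w, j). w @ [j]) (words l \<times> {1..}) (words (Suc l))"
    unfolding bij_betw_def
  proof
    show "(\<lambda>(w, j). w @ [j]) ` (words l \<times> {1..}) = words (Suc l)"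
    proof safe
      fix u assume u: "u \<in> words (Suc l)"
      then obtain w j where "u = w @ [j]" by (cases u rule: rev_cases) (auto simp: words_def)
      with u show "u \<in> (\<lambda>(w, j). w @ [j]) ` (words l \<times> {1..})"
        by (auto simp: words_def intro!: image_eqI[of _ _ "(w, j)"])
    qed (auto simp: words_def)
  qed (auto simp: inj_on_def)
  have "(\<integral>\<^sup>+u. q u \<partial>count_space (words (Suc l))) =
      (\<integral>\<^sup>+p. q (case p of (w, j) \<Rightarrow> w @ [j]) \<partial>count_space (words l \<times> {1..}))"
    by (rule nn_integral_bij_count_space[OF bij, symmetric])
  also have "\<dots> = (\<integral>\<^sup>+p. q (case p of (w, j) \<Rightarrow> w @ [j]) * indicator (words l \<times> {1..}) p \<partial>count_space UNIV)"
    by (rule nn_integral_count_space_indicator) simp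
  also have "\<dots> = (\<integral>\<^sup>+w. \<integral>\<^sup>+j. q (w @ [j]) * indicator (words l \<times> {1..}) (w, j)
      \<partial>count_space UNIV \<partial>count_space UNIV)"
    by (subst nn_integral_fst_count_space[symmetric]) simp
  also have "\<dots> = (\<integral>\<^sup>+w. (\<integral>\<^sup>+j. q (w @ [j]) * indicator {1..} j \<partial>count_space UNIV) * indicator (words l) w
      \<partial>count_space UNIV)"
  proof (intro nn_integral_cong, goal_cases)
    case (1 w)
    show ?case by (cases "w \<in> words l") (simp_all add: indicator_times)
  qed
  also have "\<dots> = (\<integral>\<^sup>+w. (\<integral>\<^sup>+j. q (w @ [j]) \<partial>count_space {1..}) \<partial>count_space (words l))"
    by (simp add: nn_integral_count_space_indicator)
  finally show ?thesis .
qed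

text \<open>Summing over the deterministic set \<open>words l\<close> lets the expectation pass
  inside. \<open>finite_kept\<close> is essential, since \<open>card\<close> of an infinite set
  would be 0.\<close>

lemma card_generation:
  "of_nat (card (ewt_generation n v \<zeta> l)) = (\<integral>\<^sup>+u. indicator {u. kept n v \<zeta> u} u \<partial>count_space (words l))"
proof -
  have eq: "words l \<inter> {u. kept n v \<zeta> u} = {u. length u = l \<and> kept n v \<zeta> u}"
    unfolding words_def using kept_in_lists[of n v \<zeta>] by blast
  have "(\<integral>\<^sup>+u. indicator {u. kept n v \<zeta> u} u \<partial>count_space (words l)) =
      (\<integral>\<^sup>+u. indicator (words l \<inter> {u. kept n v \<zeta> u}) u \<partial>count_space (words l))"
    by (intro nn_integral_cong) (auto split: split_indicator)
  also have "\<dots> = emeasure (count_space (words l)) (words l \<inter> {u. kept n v \<zeta> u})"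
    by (rule nn_integral_indicator) auto
  also have "\<dots> = of_nat (card (words l \<inter> {u. kept n v \<zeta> u}))"
    by (rule emeasure_count_space_finite) (use finite_kept[of l n v \<zeta>] eq in auto)
  finally show ?thesis by (simp add: eq ewt_generation_eq)
qed

section \<open>The expected size of a generation\<close>

definition \<S> :: "(real \<Rightarrow> ennreal) \<Rightarrow> real \<Rightarrow> ennreal" where
  "\<S> h y = (\<integral>\<^sup>+z. h z * indicator {0..y} z \<partial>lborel)"

text \<open>Written with \<open>if\<close>, the indicator is measurable in both variables jointly,
  as Fubini requires.\<close>

lemma indicator_cbox_eq: "indicator {0..y} z = (if 0 \<le> z \<and> z \<le> y then 1 else 0)" for y z :: real
  by (simp add: indicator_def)

lemma \<S>_measurable [measurable]:
  assumes [measurable]: "h \<in> borel_measurable borel"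
  shows "\<S> h \<in> borel_measurable borel"
  unfolding \<S>_def indicator_cbox_eq by measurable

text \<open>The left side integrates \<open>h\<close> against Lebesgue measure on [0, y] mixed over
  y with weight \<open>a\<close>; the exchange does the z-integral first.\<close>

lemma nn_integral_mixture:
  fixes a h :: "real \<Rightarrow> ennreal"
  assumes [measurable]: "a \<in> borel_measurable borel" "h \<in> borel_measurable borel"
  shows "(\<integral>\<^sup>+z. (\<integral>\<^sup>+y. a y * indicator {0..y} z \<partial>lborel) * h z \<partial>lborel) = (\<integral>\<^sup>+y. a y * \<S> h y \<partial>lborel)"
proof -
  have "(\<integral>\<^sup>+z. (\<integral>\<^sup>+y. a y * indicator {0..y} z \<partial>lborel) * h z \<partial>lborel) =
      (\<integral>\<^sup>+z. (\<integral>\<^sup>+y. a y * indicator {0..y} z * h z \<partial>lborel) \<partial>lborel)"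
    unfolding indicator_cbox_eq by (intro nn_integral_cong nn_integral_multc[symmetric]) measurable
  also have "\<dots> = (\<integral>\<^sup>+y. (\<integral>\<^sup>+z. a y * indicator {0..y} z * h z \<partial>lborel) \<partial>lborel)"
    unfolding indicator_cbox_eq by (rule lborel_pair.Fubini') measurable
  also have "\<dots> = (\<integral>\<^sup>+y. a y * \<S> h y \<partial>lborel)"
    unfolding \<S>_def
    by (intro nn_integral_cong) (subst nn_integral_cmult[symmetric]; simp add: mult_ac)
  finally show ?thesis .
qed

section \<open>Law of the marks at a single vertex\<close>

context erlang_weighted_tree
begin

abbreviation mark_space :: "(nat \<times> real \<times> (nat \<Rightarrow> real)) measure" where
  "mark_space \<equiv> count_space UNIV \<Otimes>\<^sub>M borel \<Otimes>\<^sub>M Pi\<^sub>M UNIV (\<lambda>_. borel)"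

definition X :: "nat list \<Rightarrow> 'w \<Rightarrow> nat \<times> real \<times> (nat \<Rightarrow> real)" where
  "X i \<omega> = (n i \<omega>, v i \<omega>, restrict (\<lambda>j. \<zeta> (i @ [j]) \<omega>) {1..n i \<omega>})"

lemma X_indep: "indep_vars (\<lambda>_. mark_space) X (lists {1..})"
  using marks_indep unfolding X_def[abs_def] .

lemma X_measurable: "i \<in> lists {1..} \<Longrightarrow> X i \<in> M \<rightarrow>\<^sub>M mark_space"
  using X_indep unfolding indep_vars_def by blast

lemma n_measurable: "i \<in> lists {1..} \<Longrightarrow> n i \<in> M \<rightarrow>\<^sub>M count_space UNIV"
  using measurable_compose[OF X_measurable measurable_fst] by (simp add: X_def)

lemma v_measurable: "i \<in> lists {1..} \<Longrightarrow> v i \<in> M \<rightarrow>\<^sub>M borel"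
  using measurable_compose[OF X_measurable measurable_compose[OF measurable_snd measurable_fst]]
  by (simp add: X_def)

text \<open>Unlike \<open>\<zeta> (i @ [j])\<close>, the masked cost is measurable even where child \<open>j\<close> does not exist.\<close>

definition cost :: "nat list \<Rightarrow> nat \<Rightarrow> 'w \<Rightarrow> real" where
  "cost i j \<omega> = snd (snd (X i \<omega>)) j"

lemma cost_eq: "1 \<le> j \<Longrightarrow> j \<le> n i \<omega> \<Longrightarrow> cost i j \<omega> = \<zeta> (i @ [j]) \<omega>"
  by (simp add: cost_def X_def)

lemma cost_measurable: "i \<in> lists {1..} \<Longrightarrow> cost i j \<in> M \<rightarrow>\<^sub>M borel"
  unfolding cost_def[abs_def]
  by (rule measurable_compose[OF X_measurable
        measurable_compose[OF measurable_snd measurable_compose[OF measurable_snd measurable_component_singleton]]]) auto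

text \<open>Only the j-th of the k independent costs is constrained: its factor is the length of U
  inside [0, y] divided by y, and all other factors are 1.\<close>

lemma cost_law:
  assumes i: "i \<in> lists {1..}" and j: "1 \<le> j" "j \<le> k" and [measurable]: "A \<in> sets borel" "U \<in> sets borel"
  shows "emeasure M {\<omega> \<in> space M. n i \<omega> = k \<and> v i \<omega> \<in> A \<and> cost i j \<omega> \<in> U} =
    ennreal (potential_degree_prob P i k) *
      (\<integral>\<^sup>+y. ennreal (erlang_density k 1 y / y) * indicator A y * \<S> (indicator U) y \<partial>lborel)"
proof -
  define C where "C = (\<lambda>j'. if j' = j then U else (UNIV :: real set))"
  have "{\<omega> \<in> space M. n i \<omega> = k \<and> v i \<omega> \<in> A \<and> cost i j \<omega> \<in> U} =
      {\<omega> \<in> space M. n i \<omega> = k \<and> v i \<omega> \<in> A \<and> (\<forall>j\<in>{1..k}. \<zeta> (i @ [j]) \<omega> \<in> C j)}"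
    using j cost_eq[of j i] by (auto simp: C_def)
  also have "emeasure M \<dots> = ennreal (potential_degree_prob P i k) *
      (\<integral>\<^sup>+y\<in>A. ennreal (erlang_density k 1 y) *
         (\<Prod>j=1..k. emeasure (uniform_measure lborel {0..y}) (C j)) \<partial>lborel)"
    by (rule marks_law[OF i]) (auto simp: C_def)
  also have "(\<integral>\<^sup>+y\<in>A. ennreal (erlang_density k 1 y) *
         (\<Prod>j=1..k. emeasure (uniform_measure lborel {0..y}) (C j)) \<partial>lborel) =
      (\<integral>\<^sup>+y. ennreal (erlang_density k 1 y / y) * indicator A y * \<S> (indicator U) y \<partial>lborel)"
  proof (rule nn_integral_cong_AE)
    show "AE y in lborel. ennreal (erlang_density k 1 y) *
         (\<Prod>j=1..k. emeasure (uniform_measure lborel {0..y}) (C j)) * indicator A y =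
       ennreal (erlang_density k 1 y / y) * indicator A y * \<S> (indicator U) y"
      \<comment> \<open>At y = 0 the interval has length zero and \<open>uniform_measure\<close> is
        no probability; for y < 0 the Erlang density vanishes.\<close>
      using AE_lborel_singleton[of "0::real"]
    proof eventually_elim
      case (elim y)
      show ?case
      proof (cases "0 < y")
        case True
        have one: "emeasure (uniform_measure lborel {0..y}) UNIV = 1"
          using True by (simp add: divide_ennreal)
        have "(\<Prod>j'=1..k. emeasure (uniform_measure lborel {0..y}) (C j')) =
            emeasure (uniform_measure lborel {0..y}) (C j) *
            (\<Prod>j'\<in>{1..k} - {j}. emeasure (uniform_measure lborel {0..y}) (C j'))"
          using j by (intro prod.remove) auto
        also have "(\<Prod>j'\<in>{1..k} - {j}. emeasure (uniform_measure lborel {0..y}) (C j')) = 1"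
          by (intro prod.neutral) (auto simp: C_def one simp del: emeasure_uniform_measure)
        also have "emeasure (uniform_measure lborel {0..y}) (C j) * 1 =
            emeasure lborel ({0..y} \<inter> U) / ennreal y"
          using True by (simp add: C_def)
        also have "emeasure lborel ({0..y} \<inter> U) = \<S> (indicator U) y"
        proof -
          have "\<S> (indicator U) y = (\<integral>\<^sup>+z. indicator ({0..y} \<inter> U) z \<partial>lborel)"
            unfolding \<S>_def by (intro nn_integral_cong) (auto split: split_indicator)
          then show ?thesis by simp
        qed
        finally have "(\<Prod>j'=1..k. emeasure (uniform_measure lborel {0..y}) (C j')) = \<S> (indicator U) y / ennreal y" .
        moreover have "ennreal (erlang_density k 1 y / y) = ennreal (erlang_density k 1 y) / ennreal y"
          using True by (simp add: divide_ennreal)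
        ultimately show ?thesis
          by (simp add: divide_ennreal_def mult_ac)
      next
        case False
        with elim have "erlang_density k 1 y = 0" by (simp add: erlang_density_def)
        then show ?thesis by simp
      qed
    qed
  qed
  finally show ?thesis .
qed

text \<open>As functions of \<open>h\<close> both sides are integrals against measures on the line,
  and these agree on Borel sets by \<open>cost_law\<close>.\<close>

lemma cost_integral:
  assumes i: "i \<in> lists {1..}" and j: "1 \<le> j" "j \<le> k" and [measurable]: "A \<in> sets borel" "h \<in> borel_measurable borel"
  shows "(\<integral>\<^sup>+\<omega>. indicator {\<omega>. n i \<omega> = k \<and> v i \<omega> \<in> A} \<omega> * h (cost i j \<omega>) \<partial>M) =
    ennreal (potential_degree_prob P i k) *
      (\<integral>\<^sup>+y. ennreal (erlang_density k 1 y / y) * indicator A y * \<S> h y \<partial>lborel)"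
proof -
  note [measurable] = n_measurable[OF i] v_measurable[OF i] cost_measurable[OF i]
  let ?p = "ennreal (potential_degree_prob P i k)"
  let ?a = "\<lambda>y. ennreal (erlang_density k 1 y / y) * indicator A y"
  let ?I = "indicator {\<omega>\<in>space M. n i \<omega> = k \<and> v i \<omega> \<in> A} :: 'w \<Rightarrow> ennreal"
  let ?d = "\<lambda>z. ?p * (\<integral>\<^sup>+y. ?a y * indicator {0..y} z \<partial>lborel)"
  have dm[measurable]: "?d \<in> borel_measurable borel"
    unfolding indicator_cbox_eq by measurable
  have Im[measurable]: "?I \<in> borel_measurable M" by measurable
  have dint: "(\<integral>\<^sup>+z. ?d z * g z \<partial>lborel) = ?p * (\<integral>\<^sup>+y. ?a y * \<S> g y \<partial>lborel)"
    if [measurable]: "g \<in> borel_measurable borel" for g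
  proof -
    have m: "(\<lambda>z. (\<integral>\<^sup>+y. ?a y * indicator {0..y} z \<partial>lborel)) \<in> borel_measurable borel"
      unfolding indicator_cbox_eq by measurable
    have "(\<integral>\<^sup>+z. ?d z * g z \<partial>lborel) = ?p * (\<integral>\<^sup>+z. (\<integral>\<^sup>+y. ?a y * indicator {0..y} z \<partial>lborel) * g z \<partial>lborel)"
      unfolding mult.assoc[of ?p] using m by (intro nn_integral_cmult) simp
    also have "(\<integral>\<^sup>+z. (\<integral>\<^sup>+y. ?a y * indicator {0..y} z \<partial>lborel) * g z \<partial>lborel) = (\<integral>\<^sup>+y. ?a y * \<S> g y \<partial>lborel)"
      by (rule nn_integral_mixture) measurable
    finally show ?thesis .
  qed
  have "distr (density M ?I) borel (cost i j) = density lborel ?d"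
  proof (rule measure_eqI)
    fix U assume "U \<in> sets (distr (density M ?I) borel (cost i j))"
    then have U[measurable]: "U \<in> sets borel" by simp
    have "emeasure (distr (density M ?I) borel (cost i j)) U = emeasure (density M ?I) (cost i j -` U \<inter> space M)"
      by (simp add: emeasure_distr)
    also have "\<dots> = (\<integral>\<^sup>+\<omega>. ?I \<omega> * indicator (cost i j -` U \<inter> space M) \<omega> \<partial>M)"
      by (rule emeasure_density) measurable
    also have "\<dots> = (\<integral>\<^sup>+\<omega>. indicator {\<omega> \<in> space M. n i \<omega> = k \<and> v i \<omega> \<in> A \<and> cost i j \<omega> \<in> U} \<omega> \<partial>M)"
      by (intro nn_integral_cong) (auto split: split_indicator)
    also have "\<dots> = emeasure M {\<omega> \<in> space M. n i \<omega> = k \<and> v i \<omega> \<in> A \<and> cost i j \<omega> \<in> U}"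
      by (rule nn_integral_indicator) measurable
    also have "\<dots> = ?p * (\<integral>\<^sup>+y. ?a y * \<S> (indicator U) y \<partial>lborel)"
      by (rule cost_law[OF i j]) measurable
    also have "\<dots> = (\<integral>\<^sup>+z. ?d z * indicator U z \<partial>lborel)"
      by (rule dint[symmetric]) measurable
    also have "\<dots> = emeasure (density lborel ?d) U"
      by (rule emeasure_density[symmetric]) auto
    finally show "emeasure (distr (density M ?I) borel (cost i j)) U = emeasure (density lborel ?d) U" .
  qed simp
  then have "(\<integral>\<^sup>+z. h z \<partial>distr (density M ?I) borel (cost i j)) = (\<integral>\<^sup>+z. h z \<partial>density lborel ?d)"
    by simp
  moreover have "(\<integral>\<^sup>+z. h z \<partial>distr (density M ?I) borel (cost i j)) = (\<integral>\<^sup>+\<omega>. ?I \<omega> * h (cost i j \<omega>) \<partial>M)"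
    by (subst nn_integral_distr) (auto simp: nn_integral_density)
  moreover have "(\<integral>\<^sup>+\<omega>. ?I \<omega> * h (cost i j \<omega>) \<partial>M) =
      (\<integral>\<^sup>+\<omega>. indicator {\<omega>. n i \<omega> = k \<and> v i \<omega> \<in> A} \<omega> * h (cost i j \<omega>) \<partial>M)"
    by (intro nn_integral_cong) (auto split: split_indicator)
  moreover have "(\<integral>\<^sup>+z. h z \<partial>density lborel ?d) = (\<integral>\<^sup>+z. ?d z * h z \<partial>lborel)"
    by (subst nn_integral_density) auto
  ultimately show ?thesis by (simp only: dint[OF assms(5)])
qed

text \<open>The factor \<open>1 / y\<close> is the density of a cost that is uniform on \<open>[0, y]\<close>.\<close>

definition Q :: "nat list \<Rightarrow> real \<Rightarrow> ennreal" where
  "Q i y = (\<integral>\<^sup>+k. ennreal (potential_degree_prob P i k) * (of_nat k * ennreal (erlang_density k 1 y / y))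
     \<partial>count_space UNIV)"

lemma Q_measurable [measurable]: "Q i \<in> borel_measurable borel"
  unfolding Q_def[abs_def] nn_integral_count_space_nat by measurable

lemma split_degree:
  "indicator {\<omega>. v i \<omega> \<in> A \<and> j \<le> n i \<omega>} \<omega> * (c :: ennreal) =
    (\<integral>\<^sup>+k. indicator {..k} j * (indicator {\<omega>. n i \<omega> = k \<and> v i \<omega> \<in> A} \<omega> * c) \<partial>count_space UNIV)"
proof -
  have "(\<integral>\<^sup>+k. indicator {..k} j * (indicator {\<omega>. n i \<omega> = k \<and> v i \<omega> \<in> A} \<omega> * c) \<partial>count_space UNIV) =
      (\<integral>\<^sup>+k. (indicator {\<omega>. v i \<omega> \<in> A \<and> j \<le> n i \<omega>} \<omega> * c) * indicator {n i \<omega>} k \<partial>count_space UNIV)"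
    by (intro nn_integral_cong) (auto split: split_indicator)
  then show ?thesis by simp
qed

text \<open>On n i = k every potential child contributes the same integral, so summing over j \<le>
  k produces the factor \<open>of_nat k\<close> in \<open>Q\<close>.\<close>

lemma child_sum:
  assumes i: "i \<in> lists {1..}" and [measurable]: "A \<in> sets borel" "h \<in> borel_measurable borel"
  shows "(\<integral>\<^sup>+j. (\<integral>\<^sup>+\<omega>. indicator {\<omega>. v i \<omega> \<in> A \<and> j \<le> n i \<omega>} \<omega> * h (cost i j \<omega>) \<partial>M) \<partial>count_space {1..}) =
    (\<integral>\<^sup>+y. indicator A y * Q i y * \<S> h y \<partial>lborel)"
proof -
  note [measurable] = n_measurable[OF i] v_measurable[OF i] cost_measurable[OF i]
  let ?p = "\<lambda>k. ennreal (potential_degree_prob P i k)"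
  define J where "J = (\<lambda>k. ?p k * (\<integral>\<^sup>+y. ennreal (erlang_density k 1 y / y) * indicator A y * \<S> h y \<partial>lborel))"
  have 1: "(\<integral>\<^sup>+\<omega>. indicator {\<omega>. v i \<omega> \<in> A \<and> j \<le> n i \<omega>} \<omega> * h (cost i j \<omega>) \<partial>M) =
      (\<integral>\<^sup>+k. indicator {..k} j * J k \<partial>count_space UNIV)" if j: "j \<in> {1..}" for j
  proof -
    have m: "(\<lambda>\<omega>. indicator {..k} j * (indicator {\<omega>. n i \<omega> = k \<and> v i \<omega> \<in> A} \<omega> * h (cost i j \<omega>))) \<in> borel_measurable M" for k
    proof -
      have "(\<lambda>\<omega>. indicator {..k} j * ((if n i \<omega> = k \<and> v i \<omega> \<in> A then 1 else 0) * h (cost i j \<omega>))) \<in> borel_measurable M"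
        by measurable
      then show ?thesis by (simp add: indicator_def)
    qed
    have "(\<integral>\<^sup>+\<omega>. indicator {\<omega>. v i \<omega> \<in> A \<and> j \<le> n i \<omega>} \<omega> * h (cost i j \<omega>) \<partial>M) =
        (\<integral>\<^sup>+\<omega>. (\<integral>\<^sup>+k. indicator {..k} j * (indicator {\<omega>. n i \<omega> = k \<and> v i \<omega> \<in> A} \<omega> * h (cost i j \<omega>))
          \<partial>count_space UNIV) \<partial>M)"
      by (simp only: split_degree)
    also have "\<dots> = (\<integral>\<^sup>+k. (\<integral>\<^sup>+\<omega>. indicator {..k} j * (indicator {\<omega>. n i \<omega> = k \<and> v i \<omega> \<in> A} \<omega> * h (cost i j \<omega>))
          \<partial>M) \<partial>count_space UNIV)"
      by (rule nn_integral_count_space_nn_integral) (use m in auto)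
    also have "\<dots> = (\<integral>\<^sup>+k. indicator {..k} j * J k \<partial>count_space UNIV)"
    proof (intro nn_integral_cong, goal_cases)
      case (1 k)
      show ?case
      proof (cases "j \<le> k")
        case True
        with j cost_integral[OF i _ True assms(2,3)] show ?thesis by (simp add: J_def)
      qed simp
    qed
    finally show ?thesis .
  qed
  have "(\<integral>\<^sup>+j. (\<integral>\<^sup>+\<omega>. indicator {\<omega>. v i \<omega> \<in> A \<and> j \<le> n i \<omega>} \<omega> * h (cost i j \<omega>) \<partial>M) \<partial>count_space {1..}) =
      (\<integral>\<^sup>+j. (\<integral>\<^sup>+k. indicator {..k} j * J k \<partial>count_space UNIV) \<partial>count_space {1..})"
    by (intro nn_integral_cong) (use 1 in simp)
  also have "\<dots> = (\<integral>\<^sup>+k. (\<integral>\<^sup>+j. indicator {..k} j * J k \<partial>count_space {1..}) \<partial>count_space UNIV)"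
    by (rule nn_integral_count_space_nn_integral) auto
  also have "\<dots> = (\<integral>\<^sup>+k. of_nat k * J k \<partial>count_space UNIV)"
  proof (intro nn_integral_cong, goal_cases)
    case (1 k)
    have "(\<integral>\<^sup>+j. indicator {..k} j * J k \<partial>count_space {1..}) = (\<integral>\<^sup>+j. indicator {1..k} j \<partial>count_space {1..}) * J k"
      by (subst nn_integral_multc[symmetric]) (auto intro!: nn_integral_cong split: split_indicator)
    also have "(\<integral>\<^sup>+j. indicator {1..k} j \<partial>count_space {1..}) = of_nat k"
      by (subst nn_integral_indicator) (auto simp: emeasure_count_space_finite)
    finally show ?case .
  qed
  also have "\<dots> = (\<integral>\<^sup>+k. (\<integral>\<^sup>+y. ?p k * (of_nat k * ennreal (erlang_density k 1 y / y)) * (indicator A y * \<S> h y) \<partial>lborel)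
      \<partial>count_space UNIV)"
  proof (intro nn_integral_cong, goal_cases)
    case (1 k)
    have "of_nat k * J k = (of_nat k * ?p k) * (\<integral>\<^sup>+y. ennreal (erlang_density k 1 y / y) * indicator A y * \<S> h y \<partial>lborel)"
      by (simp add: J_def mult.assoc)
    also have "\<dots> = (\<integral>\<^sup>+y. (of_nat k * ?p k) * (ennreal (erlang_density k 1 y / y) * indicator A y * \<S> h y) \<partial>lborel)"
      by (rule nn_integral_cmult[symmetric]) measurable
    finally show ?case by (simp add: mult_ac)
  qed
  also have "\<dots> = (\<integral>\<^sup>+y. (\<integral>\<^sup>+k. ?p k * (of_nat k * ennreal (erlang_density k 1 y / y)) * (indicator A y * \<S> h y)
      \<partial>count_space UNIV) \<partial>lborel)"
    by (rule nn_integral_count_space_nn_integral[symmetric]) auto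
  also have "\<dots> = (\<integral>\<^sup>+y. indicator A y * Q i y * \<S> h y \<partial>lborel)"
    unfolding Q_def by (intro nn_integral_cong) (subst nn_integral_multc; simp add: mult_ac)
  finally show ?thesis .
qed

section \<open>Independence of a vertex from its history\<close>

abbreviation alive :: "nat list \<Rightarrow> 'w \<Rightarrow> bool" where
  "alive u \<omega> \<equiv> kept (\<lambda>i. n i \<omega>) (\<lambda>i. v i \<omega>) (\<lambda>i. \<zeta> i \<omega>) u"

text \<open>With \<open>cost\<close> in place of \<open>\<zeta>\<close>, the event is read off from
  the marks \<open>X\<close> of the prefixes of \<open>w\<close>, which makes it measurable.\<close>

lemma alive_cost:
  "alive w \<omega> \<longleftrightarrow> (\<forall>k<length w. 1 \<le> w ! k \<and> w ! k \<le> n (take k w) \<omega> \<and>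
     cost (take k w) (w ! k) \<omega> < v (take (Suc k) w) \<omega>)"
  unfolding kept_def using cost_eq[of "w ! k" "take k w" \<omega> for k]
  by (auto simp: take_Suc_conv_app_nth)

lemma alive_measurable:
  assumes "w \<in> lists {1..}"
  shows "Measurable.pred M (alive w)"
proof -
  have t: "take k w \<in> lists {1..}" for k using assms set_take_subset[of k w] by auto
  note [measurable] = n_measurable[OF t] v_measurable[OF t] cost_measurable[OF t]
  show ?thesis unfolding alive_cost by measurable
qed

text \<open>The cost of an edge is a mark of its parent, so the event and \<open>cost w j\<close>
  depend only on the marks at prefixes of \<open>w\<close>. The child \<open>w @ [j]\<close> is not
  such a prefix, and its mark can be integrated separately.\<close>

lemma history_indep:
  assumes w: "w \<in> lists {1..}" and j: "1 \<le> j"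
    and \<Psi> [measurable]: "\<Psi> \<in> borel_measurable (borel \<Otimes>\<^sub>M mark_space)"
  shows "(\<integral>\<^sup>+\<omega>. indicator {\<omega>. alive w \<omega> \<and> j \<le> n w \<omega>} \<omega> * \<Psi> (cost w j \<omega>, X (w @ [j]) \<omega>) \<partial>M) =
    (\<integral>\<^sup>+\<omega>. indicator {\<omega>. alive w \<omega> \<and> j \<le> n w \<omega>} \<omega> * (\<integral>\<^sup>+\<omega>'. \<Psi> (cost w j \<omega>, X (w @ [j]) \<omega>') \<partial>M) \<partial>M)"
proof -
  define A where "A = (\<lambda>k. take k w) ` {..length w}"
  let ?u = "w @ [j]"
  let ?PA = "Pi\<^sub>M A (\<lambda>_. mark_space)"
  let ?Y = "\<lambda>\<omega>. restrict (\<lambda>i. X i \<omega>) A"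
  have Asub: "A \<subseteq> lists {1..}" using w by (auto simp: A_def dest: in_set_takeD)
  have u: "?u \<in> lists {1..}" using w j by auto
  have uA: "?u \<notin> A"
  proof
    assume "?u \<in> A"
    then obtain k where "?u = take k w" by (auto simp: A_def)
    then have "length ?u = length (take k w)" by simp
    then show False by simp
  qed
  have tA: "take k w \<in> A" for k
    by (cases "k \<le> length w") (auto simp: A_def intro: image_eqI[of _ _ "length w"])
  have wA: "w \<in> A" using tA[of "length w"] by simp
  \<comment> \<open>Independence of blocks concerns restrictions to index sets, hence a one-element
    family for the child.\<close>
  let ?PB = "Pi\<^sub>M {?u} (\<lambda>_. mark_space)"
  let ?V = "\<lambda>\<omega>. restrict (\<lambda>i. X i \<omega>) {?u}"
  have ind: "indep_var ?PA ?Y ?PB ?V"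
    by (rule indep_var_restrict[OF X_indep _ Asub]) (use uA u in auto)
  then have rv[measurable]: "?Y \<in> M \<rightarrow>\<^sub>M ?PA" "?V \<in> M \<rightarrow>\<^sub>M ?PB"
    and joint: "distr M ?PA ?Y \<Otimes>\<^sub>M distr M ?PB ?V = distr M (?PA \<Otimes>\<^sub>M ?PB) (\<lambda>\<omega>. (?Y \<omega>, ?V \<omega>))"
    unfolding indep_var_distribution_eq by auto
  have last[measurable]: "(\<lambda>f. f ?u) \<in> ?PB \<rightarrow>\<^sub>M mark_space"
    using measurable_component_singleton[of ?u "{?u}" "\<lambda>_. mark_space"] by simp
  interpret D2: prob_space "distr M ?PB ?V" by (rule prob_space_distr) measurable
  \<comment> \<open>The history event as a predicate on families of marks indexed by
    \<open>A\<close>.\<close>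
  define hst where "hst = (\<lambda>Y :: nat list \<Rightarrow> nat \<times> real \<times> (nat \<Rightarrow> real). (\<forall>k\<in>{..<length w}. 1 \<le> w ! k \<and> w ! k \<le> fst (Y (take k w)) \<and>
     snd (snd (Y (take k w))) (w ! k) < fst (snd (Y (take (Suc k) w)))) \<and> j \<le> fst (Y w) :: bool)"
  have comp[measurable]: "(\<lambda>Y. Y i) \<in> ?PA \<rightarrow>\<^sub>M mark_space" if "i \<in> A" for i
    using measurable_component_singleton[OF that, of "\<lambda>_. mark_space"] by simp
  have n_comp: "(\<lambda>Y. fst (Y i)) \<in> ?PA \<rightarrow>\<^sub>M count_space UNIV" if "i \<in> A" for i
    by (rule measurable_compose[OF comp[OF that] measurable_fst])
  have v_comp: "(\<lambda>Y. fst (snd (Y i))) \<in> ?PA \<rightarrow>\<^sub>M borel" if "i \<in> A" for i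
    by (rule measurable_compose[OF comp[OF that] measurable_compose[OF measurable_snd measurable_fst]])
  have c_comp: "(\<lambda>Y. snd (snd (Y i)) l) \<in> ?PA \<rightarrow>\<^sub>M borel" if "i \<in> A" for i l
    by (rule measurable_compose[OF comp[OF that] measurable_compose[OF measurable_snd
          measurable_compose[OF measurable_snd measurable_component_singleton]]]) auto
  note [measurable] = n_comp[OF tA] v_comp[OF tA] c_comp[OF tA] n_comp[OF wA] c_comp[OF wA]
  have [measurable]: "Measurable.pred ?PA hst" unfolding hst_def by measurable
  have hst_iff: "hst (?Y \<omega>) \<longleftrightarrow> alive w \<omega> \<and> j \<le> n w \<omega>" for \<omega>
    unfolding hst_def alive_cost using tA wA by (auto simp: cost_def X_def)
  define \<Phi> where "\<Phi> = (\<lambda>p. (if hst (fst p) then 1 else 0) * \<Psi> (snd (snd (fst p w)) j, snd p ?u))"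
  have \<Phi>[measurable]: "\<Phi> \<in> borel_measurable (?PA \<Otimes>\<^sub>M ?PB)"
    unfolding \<Phi>_def by measurable
  have \<Phi>_eq: "\<Phi> (?Y \<omega>, ?V \<omega>') = indicator {\<omega>. alive w \<omega> \<and> j \<le> n w \<omega>} \<omega> * \<Psi> (cost w j \<omega>, X ?u \<omega>')" for \<omega> \<omega>'
    unfolding \<Phi>_def fst_conv snd_conv hst_iff using wA by (auto simp: cost_def)
  have "(\<integral>\<^sup>+\<omega>. \<Phi> (?Y \<omega>, ?V \<omega>) \<partial>M) = (\<integral>\<^sup>+p. \<Phi> p \<partial>distr M (?PA \<Otimes>\<^sub>M ?PB) (\<lambda>\<omega>. (?Y \<omega>, ?V \<omega>)))"
    by (subst nn_integral_distr) auto
  also have "\<dots> = (\<integral>\<^sup>+Y. (\<integral>\<^sup>+x. \<Phi> (Y, x) \<partial>distr M ?PB ?V) \<partial>distr M ?PA ?Y)"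
    unfolding joint[symmetric] by (rule D2.nn_integral_fst[symmetric]) auto
  also have "\<dots> = (\<integral>\<^sup>+\<omega>. (\<integral>\<^sup>+x. \<Phi> (?Y \<omega>, x) \<partial>distr M ?PB ?V) \<partial>M)"
    by (subst nn_integral_distr) (auto intro!: D2.borel_measurable_nn_integral)
  also have "\<dots> = (\<integral>\<^sup>+\<omega>. (\<integral>\<^sup>+\<omega>'. \<Phi> (?Y \<omega>, ?V \<omega>') \<partial>M) \<partial>M)"
  proof (intro nn_integral_cong, goal_cases)
    case (1 \<omega>)
    have "(\<lambda>x. \<Phi> (?Y \<omega>, x)) \<in> borel_measurable ?PB"
      by (rule measurable_compose[OF measurable_Pair1' \<Phi>]) (use measurable_space[OF rv(1) 1] in auto)
    then show ?case by (subst nn_integral_distr) auto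
  qed
  also have "\<dots> = (\<integral>\<^sup>+\<omega>. indicator {\<omega>. alive w \<omega> \<and> j \<le> n w \<omega>} \<omega> * (\<integral>\<^sup>+\<omega>'. \<Psi> (cost w j \<omega>, X ?u \<omega>') \<partial>M) \<partial>M)"
    unfolding \<Phi>_eq by (intro nn_integral_cong) (auto split: split_indicator)
  finally show ?thesis unfolding \<Phi>_eq .
qed

section \<open>Recursion over the generations\<close>

definition Q\<^sub>r :: "real \<Rightarrow> ennreal" where
  "Q\<^sub>r y = (\<integral>\<^sup>+k. ennreal (pmf P k) * (of_nat k * ennreal (erlang_density k 1 y / y)) \<partial>count_space UNIV)"

definition Q\<^sub>c :: "real \<Rightarrow> ennreal" where
  "Q\<^sub>c y = (\<integral>\<^sup>+k. ennreal (pmf P (k + 1)) * (of_nat k * ennreal (erlang_density k 1 y / y)) \<partial>count_space UNIV)"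

text \<open>The density of \<open>v\<close> itself at a non-root vertex, whereas
  \<open>Q\<^sub>c\<close> weights it by the number of children over y.\<close>

definition Q\<^sub>0 :: "real \<Rightarrow> ennreal" where
  "Q\<^sub>0 y = (\<integral>\<^sup>+k. ennreal (pmf P (k + 1)) * ennreal (erlang_density k 1 y) \<partial>count_space UNIV)"

lemma Q_root: "Q [] = Q\<^sub>r"
  by (simp add: fun_eq_iff Q_def Q\<^sub>r_def potential_degree_prob_def)

lemma Q_child: "i \<noteq> [] \<Longrightarrow> Q i = Q\<^sub>c"
  by (simp add: fun_eq_iff Q_def Q\<^sub>c_def potential_degree_prob_def)

lemma Q_rc_measurable [measurable]:
  "Q\<^sub>r \<in> borel_measurable borel" "Q\<^sub>c \<in> borel_measurable borel" "Q\<^sub>0 \<in> borel_measurable borel"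
  unfolding Q\<^sub>r_def[abs_def] Q\<^sub>c_def[abs_def] Q\<^sub>0_def[abs_def] nn_integral_count_space_nat by measurable

text \<open>Expected sum of \<open>h\<close> over the costs of the potential children of a non-root
  vertex with cost x, on the event that the edge to it is kept.\<close>

definition step :: "(real \<Rightarrow> ennreal) \<Rightarrow> real \<Rightarrow> ennreal" where
  "step h x = (\<integral>\<^sup>+y. indicator {x<..} y * Q\<^sub>c y * \<S> h y \<partial>lborel)"

definition survival :: "real \<Rightarrow> ennreal" where
  "survival x = (\<integral>\<^sup>+y. indicator {x<..} y * Q\<^sub>0 y \<partial>lborel)"

lemma step_measurable [measurable]:
  assumes [measurable]: "h \<in> borel_measurable borel"
  shows "step h \<in> borel_measurable borel"
proof -
  have "(\<lambda>x. \<integral>\<^sup>+y. (if x < y then 1 else 0) * Q\<^sub>c y * \<S> h y \<partial>lborel) \<in> borel_measurable borel" by measurable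
  then show ?thesis by (simp add: step_def[abs_def] indicator_def)
qed

lemma survival_measurable [measurable]: "survival \<in> borel_measurable borel"
proof -
  have "(\<lambda>x. \<integral>\<^sup>+y. (if x < y then 1 else 0) * Q\<^sub>0 y \<partial>lborel) \<in> borel_measurable borel" by measurable
  then show ?thesis by (simp add: survival_def[abs_def] indicator_def)
qed

lemma survival_eq:
  assumes i: "i \<in> lists {1..}" "i \<noteq> []"
  shows "(\<integral>\<^sup>+\<omega>. indicator {\<omega>. x < v i \<omega>} \<omega> \<partial>M) = survival x"
proof -
  note [measurable] = n_measurable[OF i(1)] v_measurable[OF i(1)]
  let ?p = "\<lambda>k. ennreal (pmf P (k + 1))"
  have law: "emeasure M {\<omega> \<in> space M. n i \<omega> = k \<and> v i \<omega> \<in> {x<..}} =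
      ?p k * (\<integral>\<^sup>+y. indicator {x<..} y * ennreal (erlang_density k 1 y) \<partial>lborel)" for k
  proof -
    have "emeasure M {\<omega> \<in> space M. n i \<omega> = k \<and> v i \<omega> \<in> {x<..}} =
        emeasure M {\<omega> \<in> space M. n i \<omega> = k \<and> v i \<omega> \<in> {x<..} \<and> (\<forall>j\<in>{1..k}. \<zeta> (i @ [j]) \<omega> \<in> UNIV)}"
      by simp
    also have "\<dots> = ?p k * (\<integral>\<^sup>+y\<in>{x<..}. ennreal (erlang_density k 1 y) *
        (\<Prod>j=1..k. emeasure (uniform_measure lborel {0..y}) UNIV) \<partial>lborel)"
      using marks_law[OF i(1), of "{x<..}" "\<lambda>_. UNIV" k] i(2) by (simp add: potential_degree_prob_def)
    also have "(\<integral>\<^sup>+y\<in>{x<..}. ennreal (erlang_density k 1 y) *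
        (\<Prod>j=1..k. emeasure (uniform_measure lborel {0..y}) UNIV) \<partial>lborel) =
        (\<integral>\<^sup>+y. indicator {x<..} y * ennreal (erlang_density k 1 y) \<partial>lborel)"
    proof (rule nn_integral_cong_AE)
      show "AE y in lborel. ennreal (erlang_density k 1 y) *
          (\<Prod>j=1..k. emeasure (uniform_measure lborel {0..y}) UNIV) * indicator {x<..} y =
          indicator {x<..} y * ennreal (erlang_density k 1 y)"
        using AE_lborel_singleton[of "0::real"]
      proof eventually_elim
        case (elim y)
        show ?case
        proof (cases "0 < y")
          case True
          have "emeasure (uniform_measure lborel {0..y}) UNIV = 1"
            using True by (simp add: divide_ennreal)
          then show ?thesis by (simp add: mult.commute del: emeasure_uniform_measure)
        next
          case False
          with elim have "erlang_density k 1 y = 0" by (simp add: erlang_density_def)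
          then show ?thesis by simp
        qed
      qed
    qed
    finally show ?thesis .
  qed
  have "(\<integral>\<^sup>+\<omega>. indicator {\<omega>. x < v i \<omega>} \<omega> \<partial>M) =
      (\<integral>\<^sup>+\<omega>. (\<integral>\<^sup>+k. indicator {\<omega> \<in> space M. n i \<omega> = k \<and> v i \<omega> \<in> {x<..}} \<omega> \<partial>count_space UNIV) \<partial>M)"
  proof (intro nn_integral_cong, goal_cases)
    case (1 \<omega>)
    have "(\<integral>\<^sup>+k. indicator {\<omega> \<in> space M. n i \<omega> = k \<and> v i \<omega> \<in> {x<..}} \<omega> \<partial>count_space UNIV) =
        (\<integral>\<^sup>+k. indicator {\<omega>. x < v i \<omega>} \<omega> * indicator {n i \<omega>} k \<partial>count_space UNIV)"
      using 1 by (intro nn_integral_cong) (auto split: split_indicator)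
    then show ?case by simp
  qed
  also have "\<dots> = (\<integral>\<^sup>+k. (\<integral>\<^sup>+\<omega>. indicator {\<omega> \<in> space M. n i \<omega> = k \<and> v i \<omega> \<in> {x<..}} \<omega> \<partial>M) \<partial>count_space UNIV)"
    by (rule nn_integral_count_space_nn_integral) auto
  also have "\<dots> = (\<integral>\<^sup>+k. ?p k * (\<integral>\<^sup>+y. indicator {x<..} y * ennreal (erlang_density k 1 y) \<partial>lborel) \<partial>count_space UNIV)"
  proof (intro nn_integral_cong, goal_cases)
    case (1 k)
    have "(\<integral>\<^sup>+\<omega>. indicator {\<omega> \<in> space M. n i \<omega> = k \<and> v i \<omega> \<in> {x<..}} \<omega> \<partial>M) =
        emeasure M {\<omega> \<in> space M. n i \<omega> = k \<and> v i \<omega> \<in> {x<..}}"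
      by (rule nn_integral_indicator) measurable
    then show ?case by (simp only: law)
  qed
  also have "\<dots> = (\<integral>\<^sup>+k. (\<integral>\<^sup>+y. ?p k * (indicator {x<..} y * ennreal (erlang_density k 1 y)) \<partial>lborel) \<partial>count_space UNIV)"
    by (intro nn_integral_cong nn_integral_cmult[symmetric]) measurable
  also have "\<dots> = (\<integral>\<^sup>+y. (\<integral>\<^sup>+k. ?p k * (indicator {x<..} y * ennreal (erlang_density k 1 y)) \<partial>count_space UNIV) \<partial>lborel)"
    by (rule nn_integral_count_space_nn_integral[symmetric]) auto
  also have "\<dots> = survival x"
    unfolding survival_def Q\<^sub>0_def
    by (intro nn_integral_cong) (subst nn_integral_cmult[symmetric]; simp add: mult_ac)
  finally show ?thesis .
qed

text \<open>The event asks that \<open>w\<close> lie in the tree and have a potential child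
  \<open>j\<close>; the edge to \<open>j\<close> need not be kept yet. This delay lets the next
  comparison use an independent mark.\<close>

definition R :: "nat list \<Rightarrow> nat \<Rightarrow> (real \<Rightarrow> ennreal) \<Rightarrow> ennreal" where
  "R w j h = (\<integral>\<^sup>+\<omega>. indicator {\<omega>. alive w \<omega> \<and> j \<le> n w \<omega>} \<omega> * h (cost w j \<omega>) \<partial>M)"

lemma history_indicator_measurable:
  assumes "w \<in> lists {1..}" and [measurable]: "g \<in> borel_measurable M"
  shows "(\<lambda>\<omega>. indicator {\<omega>. alive w \<omega> \<and> j \<le> n w \<omega>} \<omega> * g \<omega> :: ennreal) \<in> borel_measurable M"
proof -
  note [measurable] = n_measurable[OF assms(1)] alive_measurable[OF assms(1)]
  have "(\<lambda>\<omega>. (if alive w \<omega> \<and> j \<le> n w \<omega> then 1 else 0) * g \<omega> :: ennreal) \<in> borel_measurable M"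
    by measurable
  then show ?thesis by (simp add: indicator_def)
qed

text \<open>Whether \<open>w @ [i]\<close> is kept depends on its own \<open>v\<close>, compared
  with a cost known from the history of \<open>w\<close>. Given that cost x, the sum over its
  children is \<open>step h x\<close>.\<close>

lemma R_step:
  assumes w: "w \<in> lists {1..}" and i: "1 \<le> i" and h[measurable]: "h \<in> borel_measurable borel"
  shows "(\<integral>\<^sup>+j. R (w @ [i]) j h \<partial>count_space {1..}) = R w i (step h)"
proof -
  let ?u = "w @ [i]"
  have u: "?u \<in> lists {1..}" using w i by auto
  note [measurable] = n_measurable[OF u] v_measurable[OF u] cost_measurable[OF u] cost_measurable[OF w]
  \<comment> \<open>The contribution of child \<open>j\<close> of \<open>?u\<close>, as a function
    of the cost x of \<open>?u\<close>.\<close>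
  define \<psi> where "\<psi> = (\<lambda>j x. \<integral>\<^sup>+\<omega>. (if x < v ?u \<omega> \<and> j \<le> n ?u \<omega> then 1 else 0) * h (cost ?u j \<omega>) \<partial>M)"
  have \<psi>_meas[measurable]: "\<psi> j \<in> borel_measurable borel" for j
    unfolding \<psi>_def by measurable
  have one: "R ?u j h = R w i (\<psi> j)" if "1 \<le> j" for j
  proof -
    define \<Psi> where "\<Psi> = (\<lambda>p :: real \<times> nat \<times> real \<times> (nat \<Rightarrow> real).
      (if fst p < fst (snd (snd p)) \<and> j \<le> fst (snd p) then 1 else 0) * h (snd (snd (snd p)) j))"
    have [measurable]: "\<Psi> \<in> borel_measurable (borel \<Otimes>\<^sub>M mark_space)"
      unfolding \<Psi>_def by measurable
    have "R ?u j h = (\<integral>\<^sup>+\<omega>. indicator {\<omega>. alive w \<omega> \<and> i \<le> n w \<omega>} \<omega> * \<Psi> (cost w i \<omega>, X ?u \<omega>) \<partial>M)"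
      unfolding R_def
    proof (intro nn_integral_cong, goal_cases)
      case (1 \<omega>)
      have "\<Psi> (cost w i \<omega>, X ?u \<omega>) = (if cost w i \<omega> < v ?u \<omega> \<and> j \<le> n ?u \<omega> then 1 else 0) * h (cost ?u j \<omega>)"
        by (simp add: \<Psi>_def X_def cost_def)
      then show ?case using i cost_eq[of i w \<omega>] by (auto simp: indicator_def)
    qed
    also have "\<dots> = (\<integral>\<^sup>+\<omega>. indicator {\<omega>. alive w \<omega> \<and> i \<le> n w \<omega>} \<omega> * (\<integral>\<^sup>+\<omega>'. \<Psi> (cost w i \<omega>, X ?u \<omega>') \<partial>M) \<partial>M)"
      by (rule history_indep[OF w i]) measurable
    also have "(\<lambda>\<omega>. \<integral>\<^sup>+\<omega>'. \<Psi> (cost w i \<omega>, X ?u \<omega>') \<partial>M) = (\<lambda>\<omega>. \<psi> j (cost w i \<omega>))"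
      unfolding \<psi>_def by (intro ext nn_integral_cong) (simp add: \<Psi>_def X_def cost_def)
    finally show ?thesis by (simp add: R_def)
  qed
  have sum: "(\<integral>\<^sup>+j. \<psi> j x \<partial>count_space {1..}) = step h x" for x
  proof -
    have "(\<integral>\<^sup>+j. \<psi> j x \<partial>count_space {1..}) =
        (\<integral>\<^sup>+j. (\<integral>\<^sup>+\<omega>. indicator {\<omega>. v ?u \<omega> \<in> {x<..} \<and> j \<le> n ?u \<omega>} \<omega> * h (cost ?u j \<omega>) \<partial>M) \<partial>count_space {1..})"
      unfolding \<psi>_def by (intro nn_integral_cong) (simp add: indicator_def)
    also have "\<dots> = (\<integral>\<^sup>+y. indicator {x<..} y * Q ?u y * \<S> h y \<partial>lborel)"
      by (rule child_sum[OF u]) measurable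
    finally show ?thesis by (simp add: step_def Q_child)
  qed
  have "(\<integral>\<^sup>+j. R ?u j h \<partial>count_space {1..}) = (\<integral>\<^sup>+j. R w i (\<psi> j) \<partial>count_space {1..})"
    by (intro nn_integral_cong) (simp add: one)
  also have "\<dots> = (\<integral>\<^sup>+\<omega>. (\<integral>\<^sup>+j. indicator {\<omega>. alive w \<omega> \<and> i \<le> n w \<omega>} \<omega> * \<psi> j (cost w i \<omega>) \<partial>count_space {1..}) \<partial>M)"
    unfolding R_def
    by (rule nn_integral_count_space_nn_integral[symmetric])
       (auto intro!: history_indicator_measurable[OF w] measurable_compose[OF cost_measurable[OF w]] \<psi>_meas)
  also have "\<dots> = (\<integral>\<^sup>+\<omega>. indicator {\<omega>. alive w \<omega> \<and> i \<le> n w \<omega>} \<omega> * (\<integral>\<^sup>+j. \<psi> j (cost w i \<omega>) \<partial>count_space {1..}) \<partial>M)"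
    by (intro nn_integral_cong nn_integral_cmult) auto
  finally show ?thesis by (simp only: sum R_def[of w i "step h", symmetric])
qed

text \<open>\<open>R_step\<close> trades the last letter of each word for one \<open>step\<close>,
  so the induction generalises \<open>h\<close>. No edge leads to the root, hence the unrestricted
  integral and \<open>Q\<^sub>r\<close> in the base case.\<close>

lemma generation_sum:
  assumes "h \<in> borel_measurable borel"
  shows "(\<integral>\<^sup>+w. (\<integral>\<^sup>+j. R w j h \<partial>count_space {1..}) \<partial>count_space (words l)) =
    (\<integral>\<^sup>+y. Q\<^sub>r y * \<S> ((step ^^ l) h) y \<partial>lborel)"
  using assms
proof (induction l arbitrary: h)
  case 0
  have "(\<integral>\<^sup>+w. (\<integral>\<^sup>+j. R w j h \<partial>count_space {1..}) \<partial>count_space (words 0)) = (\<integral>\<^sup>+j. R [] j h \<partial>count_space {1..})"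
    unfolding words_0 by (subst nn_integral_count_space_finite) auto
  also have "\<dots> = (\<integral>\<^sup>+y. indicator UNIV y * Q [] y * \<S> h y \<partial>lborel)"
    using child_sum[of "[]" UNIV h] 0 by (simp add: R_def)
  finally show ?case by (simp add: Q_root)
next
  case (Suc l)
  have "(\<integral>\<^sup>+w. (\<integral>\<^sup>+j. R w j h \<partial>count_space {1..}) \<partial>count_space (words (Suc l))) =
      (\<integral>\<^sup>+w. (\<integral>\<^sup>+i. (\<integral>\<^sup>+j. R (w @ [i]) j h \<partial>count_space {1..}) \<partial>count_space {1..}) \<partial>count_space (words l))"
    by (rule nn_integral_words_Suc)
  also have "\<dots> = (\<integral>\<^sup>+w. (\<integral>\<^sup>+i. R w i (step h) \<partial>count_space {1..}) \<partial>count_space (words l))"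
    by (intro nn_integral_cong R_step Suc.prems) (auto simp: words_def)
  also have "\<dots> = (\<integral>\<^sup>+y. Q\<^sub>r y * \<S> ((step ^^ l) (step h)) y \<partial>lborel)"
    by (rule Suc.IH[OF step_measurable[OF Suc.prems]])
  finally show ?case by (simp add: funpow_swap1)
qed

text \<open>Beyond the history of \<open>w\<close>, being kept requires only that
  \<open>cost w j\<close> lie below the independent \<open>v (w @ [j])\<close>, which averages to
  \<open>survival\<close>.\<close>

lemma alive_prob:
  assumes w: "w \<in> lists {1..}" and j: "1 \<le> j"
  shows "(\<integral>\<^sup>+\<omega>. indicator {u. alive u \<omega>} (w @ [j]) \<partial>M) = R w j survival"
proof -
  let ?u = "w @ [j]"
  have u: "?u \<in> lists {1..}" using w j by auto
  define \<Psi> where "\<Psi> = (\<lambda>p :: real \<times> nat \<times> real \<times> (nat \<Rightarrow> real).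
    (if fst p < fst (snd (snd p)) then 1 else 0) :: ennreal)"
  have [measurable]: "\<Psi> \<in> borel_measurable (borel \<Otimes>\<^sub>M mark_space)"
    unfolding \<Psi>_def by measurable
  have "(\<integral>\<^sup>+\<omega>. indicator {u. alive u \<omega>} ?u \<partial>M) =
      (\<integral>\<^sup>+\<omega>. indicator {\<omega>. alive w \<omega> \<and> j \<le> n w \<omega>} \<omega> * \<Psi> (cost w j \<omega>, X ?u \<omega>) \<partial>M)"
  proof (intro nn_integral_cong, goal_cases)
    case (1 \<omega>)
    show ?case using j cost_eq[of j w \<omega>] by (auto simp: indicator_def \<Psi>_def X_def)
  qed
  also have "\<dots> = (\<integral>\<^sup>+\<omega>. indicator {\<omega>. alive w \<omega> \<and> j \<le> n w \<omega>} \<omega> * (\<integral>\<^sup>+\<omega>'. \<Psi> (cost w j \<omega>, X ?u \<omega>') \<partial>M) \<partial>M)"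
    by (rule history_indep[OF w j]) measurable
  also have "(\<lambda>\<omega>. \<integral>\<^sup>+\<omega>'. \<Psi> (cost w j \<omega>, X ?u \<omega>') \<partial>M) = (\<lambda>\<omega>. survival (cost w j \<omega>))"
    by (rule ext, subst survival_eq[OF u, symmetric])
       (auto intro!: nn_integral_cong simp: \<Psi>_def X_def indicator_def)
  finally show ?thesis by (simp add: R_def)
qed

lemma alive_indicator_measurable:
  assumes "u \<in> lists {1..}"
  shows "(\<lambda>\<omega>. indicator {u. alive u \<omega>} u :: ennreal) \<in> borel_measurable M"
proof -
  note [measurable] = alive_measurable[OF assms]
  have "(\<lambda>\<omega>. (if alive u \<omega> then 1 else 0) :: ennreal) \<in> borel_measurable M" by measurable
  then show ?thesis by (simp add: indicator_def of_bool_def)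
qed

text \<open>A vertex of generation l + 1 is split into its parent and its last letter; the final
  comparison with \<open>v\<close> supplies the starting function \<open>survival\<close>.\<close>

theorem expected_generation:
  "(\<integral>\<^sup>+\<omega>. of_nat (card (ewt_generation (\<lambda>i. n i \<omega>) (\<lambda>i. v i \<omega>) (\<lambda>i. \<zeta> i \<omega>) (Suc l))) \<partial>M) =
    (\<integral>\<^sup>+y. Q\<^sub>r y * \<S> ((step ^^ l) survival) y \<partial>lborel)"
proof -
  have "(\<integral>\<^sup>+\<omega>. of_nat (card (ewt_generation (\<lambda>i. n i \<omega>) (\<lambda>i. v i \<omega>) (\<lambda>i. \<zeta> i \<omega>) (Suc l))) \<partial>M) =
      (\<integral>\<^sup>+u. (\<integral>\<^sup>+\<omega>. indicator {u. alive u \<omega>} u \<partial>M) \<partial>count_space (words (Suc l)))"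
    unfolding card_generation 
    by (rule nn_integral_count_space_nn_integral) (auto intro: alive_indicator_measurable simp: words_def)
  also have "\<dots> = (\<integral>\<^sup>+w. (\<integral>\<^sup>+j. R w j survival \<partial>count_space {1..}) \<partial>count_space (words l))"
    unfolding nn_integral_words_Suc
    by (intro nn_integral_cong alive_prob) (auto simp: words_def)
  finally show ?thesis by (simp only: generation_sum[OF survival_measurable])
qed

end

section \<open>Exponentially bounded densities\<close>

text \<open>The shift z = x + u leaves exp (- a x) / a times the mean 1 / a of an exponential
  variable of rate a.\<close>

lemma nn_integral_exp_tail:
  fixes a x :: real
  assumes a: "0 < a"
  shows "(\<integral>\<^sup>+z. ennreal (max 0 (z - x) * exp (- (a * z))) \<partial>lborel) = ennreal (exp (- (a * x)) / a\<^sup>2)"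
proof -
  have 1: "(\<integral>\<^sup>+u. ennreal (erlang_density 0 a u * u ^ 1) \<partial>lborel) = ennreal (1 / a)"
    using nn_integral_erlang_ith_moment[OF a, of 0 1] by simp
  have "(\<integral>\<^sup>+z. ennreal (max 0 (z - x) * exp (- (a * z))) \<partial>lborel) =
      (\<integral>\<^sup>+u. ennreal (max 0 u * exp (- (a * (x + u)))) \<partial>lborel)"
    by (subst nn_integral_real_affine[where c = 1 and t = x]) auto
  also have "\<dots> = (\<integral>\<^sup>+u. ennreal (exp (- (a * x)) / a) * ennreal (erlang_density 0 a u * u ^ 1) \<partial>lborel)"
    using a by (intro nn_integral_cong)
      (auto simp: ennreal_mult'[symmetric] erlang_density_def max_def field_simps exp_add[symmetric])
  also have "\<dots> = ennreal (exp (- (a * x)) / a) * ennreal (1 / a)"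
    unfolding 1[symmetric] by (rule nn_integral_cmult) measurable
  finally show ?thesis using a by (simp add: ennreal_mult'[symmetric] power2_eq_square)
qed

lemma nn_integral_exp_Ici:
  fixes a :: real
  assumes a: "0 < a"
  shows "(\<integral>\<^sup>+z. ennreal (indicator {0..} z * exp (- (a * z))) \<partial>lborel) = ennreal (1 / a)"
proof -
  have 1: "(\<integral>\<^sup>+u. ennreal (erlang_density 0 a u * u ^ 0) \<partial>lborel) = ennreal 1"
    using nn_integral_erlang_ith_moment[OF a, of 0 0] by simp
  have "(\<integral>\<^sup>+z. ennreal (indicator {0..} z * exp (- (a * z))) \<partial>lborel) =
      (\<integral>\<^sup>+u. ennreal (1 / a) * ennreal (erlang_density 0 a u * u ^ 0) \<partial>lborel)"
    using a by (intro nn_integral_cong)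
      (auto simp: ennreal_mult'[symmetric] erlang_density_def indicator_def field_simps)
  also have "\<dots> = ennreal (1 / a) * ennreal 1"
    unfolding 1[symmetric] by (rule nn_integral_cmult) measurable
  finally show ?thesis by simp
qed

locale exp_bounded_density =
  fixes g :: "real \<Rightarrow> real" and E c :: real
  assumes g_measurable [measurable]: "g \<in> borel_measurable borel"
    and g_nonneg: "\<And>x. 0 \<le> x \<Longrightarrow> 0 \<le> g x"
    and g_le: "\<And>x. 0 \<le> x \<Longrightarrow> g x \<le> E * exp (- (c * x))"
    and c_pos: "0 < c"
begin

lemma E_nonneg: "0 \<le> E"
  using g_nonneg[of 0] g_le[of 0] by simp

definition dens :: "real measure" where
  "dens = density lborel (\<lambda>x. ennreal (indicator {0..} x * g x))"

lemma sets_dens [measurable_cong, simp]: "sets dens = sets borel"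
  by (simp add: dens_def)

lemma space_dens [simp]: "space dens = UNIV"
  by (simp add: dens_def)

lemma nn_integral_dens:
  assumes [measurable]: "q \<in> borel_measurable borel"
  shows "(\<integral>\<^sup>+x. q x \<partial>dens) = (\<integral>\<^sup>+x. ennreal (indicator {0..} x * g x) * q x \<partial>lborel)"
  unfolding dens_def by (rule nn_integral_density) auto

lemma integral_dens:
  fixes q :: "real \<Rightarrow> real"
  assumes [measurable]: "q \<in> borel_measurable borel"
  shows "(\<integral>x. q x \<partial>dens) = (\<integral>x. indicator {0..} x * g x * q x \<partial>lborel)"
  unfolding dens_def by (rule integral_real_density) (auto simp: g_nonneg indicator_def)

lemma integrable_dens:
  fixes q :: "real \<Rightarrow> real"
  assumes [measurable]: "q \<in> borel_measurable borel"
  shows "integrable dens q \<longleftrightarrow> integrable lborel (\<lambda>x. indicator {0..} x * g x * q x)"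
  unfolding dens_def by (rule integrable_real_density) (auto simp: g_nonneg indicator_def)

lemma AE_dens_pos: "AE x in dens. 0 < x"
  unfolding dens_def
  by (subst AE_density) (use AE_lborel_singleton[of "0::real"] in \<open>auto elim!: eventually_mono simp: indicator_def\<close>)

text \<open>The bound on \<open>g\<close> raises the rate from b to b + c; with b = i c this is the
  source of \<open>decay\<close>.\<close>

lemma dens_exp_bound:
  assumes "0 \<le> x" "0 \<le> b"
  shows "(\<integral>\<^sup>+z. ennreal (max 0 (z - x) * exp (- (b * z))) \<partial>dens) \<le>
    ennreal (E * exp (- ((b + c) * x)) / (b + c)\<^sup>2)"
proof -
  have "(\<integral>\<^sup>+z. ennreal (max 0 (z - x) * exp (- (b * z))) \<partial>dens) =
      (\<integral>\<^sup>+z. ennreal (indicator {0..} z * g z) * ennreal (max 0 (z - x) * exp (- (b * z))) \<partial>lborel)"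
    by (rule nn_integral_dens) measurable
  also have "\<dots> \<le> (\<integral>\<^sup>+z. ennreal E * ennreal (max 0 (z - x) * exp (- ((b + c) * z))) \<partial>lborel)"
  proof (rule nn_integral_mono)
    fix z :: real
    show "ennreal (indicator {0..} z * g z) * ennreal (max 0 (z - x) * exp (- (b * z))) \<le>
      ennreal E * ennreal (max 0 (z - x) * exp (- ((b + c) * z)))"
    proof (cases "x \<le> z")
      case True
      have "g z * (max 0 (z - x) * exp (- (b * z))) \<le> E * exp (- (c * z)) * (max 0 (z - x) * exp (- (b * z)))"
        using True assms by (intro mult_right_mono g_le) auto
      also have "\<dots> = E * (max 0 (z - x) * exp (- ((b + c) * z)))"
        by (simp add: mult_exp_exp algebra_simps)
      finally show ?thesis
        using True assms E_nonneg g_nonneg[of z] by (simp add: ennreal_mult'[symmetric] ennreal_leI)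
    qed simp
  qed
  also have "\<dots> = ennreal E * (\<integral>\<^sup>+z. ennreal (max 0 (z - x) * exp (- ((b + c) * z))) \<partial>lborel)"
    by (rule nn_integral_cmult) measurable
  also have "\<dots> = ennreal (E * exp (- ((b + c) * x)) / (b + c)\<^sup>2)"
    using assms c_pos E_nonneg by (subst nn_integral_exp_tail) (auto simp: ennreal_mult'[symmetric])
  finally show ?thesis .
qed

lemma finite_measure_dens: "finite_measure dens"
proof
  have "emeasure dens (space dens) = (\<integral>\<^sup>+x. 1 \<partial>dens)" by simp
  also have "\<dots> = (\<integral>\<^sup>+x. ennreal (indicator {0..} x * g x) * 1 \<partial>lborel)"
    by (rule nn_integral_dens) simp
  also have "\<dots> \<le> (\<integral>\<^sup>+x. ennreal E * ennreal (indicator {0..} x * exp (- (c * x))) \<partial>lborel)"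
    using E_nonneg g_le by (intro nn_integral_mono) (auto simp: indicator_def ennreal_mult'[symmetric] ennreal_leI)
  also have "\<dots> = ennreal E * (\<integral>\<^sup>+x. ennreal (indicator {0..} x * exp (- (c * x))) \<partial>lborel)"
    by (rule nn_integral_cmult) measurable
  also have "\<dots> < \<infinity>"
    unfolding nn_integral_exp_Ici[OF c_pos] by (simp add: ennreal_mult_less_top)
  finally show "emeasure dens (space dens) \<noteq> \<infinity>" by simp
qed

lemma integrable_dens_id: "integrable dens (\<lambda>x. x)"
proof (rule integrableI_bounded)
  have "(\<integral>\<^sup>+x. ennreal (norm x) \<partial>dens) = (\<integral>\<^sup>+x. ennreal (max 0 (x - 0) * exp (- (0 * x))) \<partial>dens)"
    by (rule nn_integral_cong_AE) (use AE_dens_pos in \<open>auto elim!: eventually_mono\<close>)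
  also have "\<dots> < \<infinity>"
    using dens_exp_bound[of 0 0] by (auto simp: less_top[symmetric] top_unique)
  finally show "(\<integral>\<^sup>+x. ennreal (norm x) \<partial>dens) < \<infinity>" .
qed simp

lemma dens_nonzero:
  assumes pos: "\<And>x. 0 < x \<Longrightarrow> 0 < g x"
  shows "emeasure dens (space dens) \<noteq> 0"
proof
  assume "emeasure dens (space dens) = 0"
  then have "(\<integral>\<^sup>+x. 1 \<partial>dens) = 0" by simp
  then have "(\<integral>\<^sup>+x. ennreal (indicator {0..} x * g x) * 1 \<partial>lborel) = 0"
    by (subst (asm) nn_integral_dens) auto
  then have "AE x in lborel. ennreal (indicator {0..} x * g x) * 1 = 0"
    by (subst (asm) nn_integral_0_iff_AE) auto
  then have "AE x::real in lborel. \<not> x \<in> {0<..<1}"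
  proof eventually_elim
    case (elim x)
    then show ?case using pos[of x] by (auto simp: indicator_def ennreal_eq_0_iff not_le split: if_splits)
  qed
  then have "emeasure lborel {0<..<1::real} = 0"
    by (subst (asm) AE_iff_measurable[of "{0<..<1}"]) auto
  then show False by simp
qed

lemma dens_kernel:
  assumes pos: "\<And>x. 0 < x \<Longrightarrow> 0 < g x"
  shows "min_kernel dens (E / c\<^sup>2) c"
proof -
  interpret finite_measure dens by (rule finite_measure_dens)
  show ?thesis
  proof
    fix i :: nat and x :: real assume x: "0 \<le> x"
    let ?a = "real (Suc i) * c"
    have a: "real i * c + c = ?a" by (simp add: algebra_simps)
    have "(\<integral>z. max 0 (z - x) * exp (- (real i * c * z)) \<partial>dens) =
        enn2real (\<integral>\<^sup>+z. ennreal (max 0 (z - x) * exp (- (real i * c * z))) \<partial>dens)"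
      by (rule integral_eq_nn_integral) auto
    also have "\<dots> \<le> E * exp (- (?a * x)) / ?a\<^sup>2"
      using dens_exp_bound[OF x, of "real i * c"] c_pos E_nonneg unfolding a by (intro enn2real_leI) auto
    also have "\<dots> = E / c\<^sup>2 * exp (- (?a * x)) / (real (Suc i))\<^sup>2"
      by (simp add: power_mult_distrib)
    \<comment> \<open>One of the two factors i + 1 is given up; the other suffices to build the
      factorials.\<close>
    also have "\<dots> \<le> E / c\<^sup>2 * exp (- (?a * x)) / real (Suc i)"
      using c_pos E_nonneg by (intro divide_left_mono) (auto simp: power2_eq_square)
    finally show "(\<integral>z. max 0 (z - x) * exp (- (real i * c * z)) \<partial>dens)
        \<le> E / c\<^sup>2 / real (Suc i) * exp (- (real (Suc i) * c * x))"
      by simp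
  qed (use AE_dens_pos integrable_dens_id dens_nonzero[OF pos] E_nonneg c_pos in auto)
qed

end

section \<open>Interchange of sums and integrals\<close>

lemma infsum_shift:
  fixes h :: "nat \<Rightarrow> real"
  assumes "summable (\<lambda>k. \<bar>h (k + d)\<bar>)"
  shows "(\<Sum>\<^sub>\<infinity>k\<in>{d..}. h k) = (\<Sum>k. h (k + d))"
proof -
  have img: "{d..} = (\<lambda>k. k + d) ` UNIV"
    by (auto simp: image_iff) (metis le_add_diff_inverse2)
  have s: "((\<lambda>k. h (k + d)) has_sum (\<Sum>k. h (k + d))) UNIV"
    using norm_summable_imp_has_sum[of "\<lambda>k. h (k + d)"] assms summable_rabs_cancel[OF assms]
    by (simp add: summable_sums)
  have "(\<Sum>\<^sub>\<infinity>k\<in>{d..}. h k) = (\<Sum>\<^sub>\<infinity>k. h (k + d))"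
    unfolding img by (subst infsum_reindex) (auto simp: comp_def)
  then show ?thesis using infsumI[OF s] by simp
qed

text \<open>For the measurability of the size of a generation, a sum over words; enumeration by
  \<open>to_nat\<close> reduces it to a series over the naturals.\<close>

lemma nn_integral_count_space_measurable:
  fixes f :: "'i :: countable \<Rightarrow> 'a \<Rightarrow> ennreal"
  assumes "\<And>i. i \<in> A \<Longrightarrow> f i \<in> borel_measurable M"
  shows "(\<lambda>x. \<integral>\<^sup>+i. f i x \<partial>count_space A) \<in> borel_measurable M"
proof -
  have bij: "bij_betw (inv_into A to_nat) (to_nat ` A) A"
    by (rule bij_betw_inv_into) (simp add: bij_betw_def inj_on_def)
  have "(\<integral>\<^sup>+i. f i x \<partial>count_space A) =
      (\<Sum>k. f (inv_into A to_nat k) x * indicator (to_nat ` A) k)" for x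
    unfolding nn_integral_bij_count_space[OF bij, symmetric]
    by (subst nn_integral_count_space_indicator) (simp_all add: nn_integral_count_space_nat)
  moreover have "(\<lambda>x. f (inv_into A to_nat k) x * indicator (to_nat ` A) k) \<in> borel_measurable M" for k
    by (cases "k \<in> to_nat ` A") (auto intro: assms inv_into_into)
  ultimately show ?thesis by simp
qed

lemma integral_suminf_nonneg:
  fixes s :: "nat \<Rightarrow> 'a \<Rightarrow> real"
  assumes m: "\<And>k. s k \<in> borel_measurable M" and nn: "\<And>k x. 0 \<le> s k x"
    and su: "\<And>x. summable (\<lambda>k. s k x)" and int: "integrable M (\<lambda>x. \<Sum>k. s k x)"
  shows "summable (\<lambda>k. \<integral>x. s k x \<partial>M) \<and> (\<Sum>k. \<integral>x. s k x \<partial>M) = (\<integral>x. (\<Sum>k. s k x) \<partial>M)"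
proof -
  have partial: "(\<Sum>k<N. s k x) \<le> (\<Sum>k. s k x)" for N x
    by (rule sum_le_suminf[OF su]) (use nn in auto)
  have i: "integrable M (s k)" for k
  proof (rule Bochner_Integration.integrable_bound[OF int m])
    have "s k x \<le> (\<Sum>k. s k x)" for x
      using sum_le_suminf[OF su, of "{k}"] nn by simp
    then show "AE x in M. norm (s k x) \<le> norm (\<Sum>k. s k x)"
      using nn suminf_nonneg[OF su nn] by simp
  qed
  have s: "summable (\<lambda>k. \<integral>x. s k x \<partial>M)"
  proof (rule summableI_nonneg_bounded)
    show "0 \<le> (\<integral>x. s k x \<partial>M)" for k using nn by simp
    show "(\<Sum>k<N. \<integral>x. s k x \<partial>M) \<le> (\<integral>x. (\<Sum>k. s k x) \<partial>M)" for N
    proof -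
      have "(\<integral>x. (\<Sum>k<N. s k x) \<partial>M) \<le> (\<integral>x. (\<Sum>k. s k x) \<partial>M)"
        by (rule integral_mono) (use i int partial in auto)
      then show ?thesis using i by simp
    qed
  qed
  moreover have "(\<integral>x. (\<Sum>k. s k x) \<partial>M) = (\<Sum>k. \<integral>x. s k x \<partial>M)"
    by (rule integral_suminf[OF i]) (use su nn s in auto)
  ultimately show ?thesis by simp
qed

section \<open>The spectral quantities of the potential degree distribution\<close>

text \<open>The reason why the factor m / x in the theorem, and k / y in \<open>Q\<close>, merely
  shift the index of a power series.\<close>

lemma power_fact_cancel:
  fixes x :: real
  assumes "x \<noteq> 0"
  shows "real (Suc k) * (x ^ Suc k / fact (Suc k) / x) = x ^ k / fact k"
  using assms by (simp add: divide_simps del: of_nat_Suc)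

lemma egf_summable:
  fixes p :: "nat \<Rightarrow> real"
  assumes "\<And>k. \<bar>p k\<bar> \<le> 1"
  shows "summable (\<lambda>k. \<bar>p k * (x ^ k / fact k)\<bar>)"
proof (rule summable_comparison_test'[where N = 0])
  show "summable (\<lambda>k. \<bar>x\<bar> ^ k / fact k)"
    using summable_exp_generic[of "\<bar>x\<bar>"] by (simp add: divide_inverse mult.commute)
  show "norm \<bar>p k * (x ^ k / fact k)\<bar> \<le> \<bar>x\<bar> ^ k / fact k" for k
    using mult_right_mono[OF assms[of k], of "\<bar>x\<bar> ^ k / fact k"] by (simp add: abs_mult power_abs)
qed

text \<open>For x \<ge> 0, the mean of P(N + d) for a Poisson variable N of mean x. Shift 2 gives
  \<open>g2\<close>, shift 1 the density of \<nu>.\<close>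

definition egf :: "nat pmf \<Rightarrow> nat \<Rightarrow> real \<Rightarrow> real" where
  "egf P d x = exp (- x) * (\<Sum>k. pmf P (k + d) * (x ^ k / fact k))"

lemma egf_summable_abs: "summable (\<lambda>k. \<bar>pmf P (k + d) * (x ^ k / fact k)\<bar>)"
  by (rule egf_summable) (simp add: pmf_le_1)

lemma egf_term_summable: "summable (\<lambda>k. pmf P (k + d) * (x ^ k / fact k))"
  by (rule summable_rabs_cancel[OF egf_summable_abs])

lemma egf_measurable [measurable]: "egf P d \<in> borel_measurable borel"
  unfolding egf_def[abs_def] by measurable

lemma egf_nonneg: "0 \<le> x \<Longrightarrow> 0 \<le> egf P d x"
  unfolding egf_def by (intro mult_nonneg_nonneg suminf_nonneg egf_term_summable) auto

lemma g2_eq_egf: "g2 P x = egf P 2 x"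
proof -
  have "(\<Sum>\<^sub>\<infinity>k\<in>{2..}. pmf P k * (x ^ (k - 2) / fact (k - 2))) = (\<Sum>k. pmf P (k + 2) * (x ^ (k + 2 - 2) / fact (k + 2 - 2)))"
    by (rule infsum_shift) (use egf_summable_abs[of P 2 x] in simp)
  then show ?thesis by (simp add: g2_def egf_def)
qed

locale exp_tail =
  fixes P :: "nat pmf" and E r :: real
  assumes r: "0 < r" "r < 1" and tail: "\<And>k. pmf P k \<le> E * r ^ k"
    and nontrivial: "\<exists>k\<ge>2. 0 < pmf P k"
begin

text \<open>A geometric tail sums to exp (r x), which exp (- x) outweighs because r < 1.\<close>

lemma egf_le: assumes x: "0 \<le> x" shows "egf P d x \<le> E * r ^ d * exp (- ((1 - r) * x))"
proof -
  have sr: "(\<lambda>k. (r * x) ^ k / fact k) sums exp (r * x)"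
    using exp_converges[of "r * x"] by (simp add: divide_inverse mult.commute)
  have "(\<Sum>k. pmf P (k + d) * (x ^ k / fact k)) \<le> (\<Sum>k. E * r ^ d * ((r * x) ^ k / fact k))"
  proof (rule suminf_le[OF _ egf_term_summable])
    show "pmf P (k + d) * (x ^ k / fact k) \<le> E * r ^ d * ((r * x) ^ k / fact k)" for k
      using mult_right_mono[OF tail[of "k + d"], of "x ^ k / fact k"] x
      by (simp add: power_add power_mult_distrib mult_ac)
    show "summable (\<lambda>k. E * r ^ d * ((r * x) ^ k / fact k))"
      by (rule summable_mult[OF sums_summable[OF sr]])
  qed
  also have "\<dots> = E * r ^ d * exp (r * x)"
    by (subst suminf_mult[OF sums_summable[OF sr]]) (simp add: sums_unique[OF sr, symmetric])
  finally have "egf P d x \<le> exp (- x) * (E * r ^ d * exp (r * x))"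
    unfolding egf_def by (intro mult_left_mono) auto
  also have "\<dots> = E * r ^ d * exp (- ((1 - r) * x))"
    by (simp add: mult_exp_exp algebra_simps)
  finally show ?thesis .
qed

lemma egf_dens: "exp_bounded_density (egf P d) (E * r ^ d) (1 - r)"
  by unfold_locales (use egf_nonneg egf_le r in auto)

sublocale nu: exp_bounded_density "egf P (Suc 0)" "E * r ^ Suc 0" "1 - r"
  by (rule egf_dens)

sublocale mu: exp_bounded_density "egf P 2" "E * r ^ 2" "1 - r"
  by (rule egf_dens)

lemma egf_2_pos: assumes x: "0 < x" shows "0 < egf P 2 x"
proof -
  obtain k where k: "0 < pmf P (k + 2)" using nontrivial by (metis le_add_diff_inverse2)
  have "0 < (\<Sum>k. pmf P (k + 2) * (x ^ k / fact k))"
    by (rule suminf_pos2[OF egf_term_summable, of _ _ _ k]) (use k x in auto)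
  then show ?thesis by (simp add: egf_def)
qed

sublocale ker: min_kernel mu.dens "E * r ^ 2 / (1 - r)\<^sup>2" "1 - r"
  by (rule mu.dens_kernel[OF egf_2_pos])

text \<open>Exchanging the order on x \<le> y \<le> z collapses the two tail integrals: the
  y-integral is the length \<open>max 0 (z - x)\<close>.\<close>

lemma G_eq_H: "0 \<le> x \<Longrightarrow> G P i x = ker.H i x"
proof (induction i arbitrary: x)
  case (Suc i)
  define q where "q = (\<lambda>z. indicator {0..} z * egf P 2 z * ker.H i z)"
  have q_nonneg: "0 \<le> q z" for z
    by (simp add: q_def indicator_def egf_nonneg ker.H_nonneg)
  have q_meas[measurable]: "q \<in> borel_measurable borel" unfolding q_def by measurable
  have q_int: "integrable lborel q"
  proof -
    have "integrable mu.dens (ker.H i)"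
    proof (rule ker.integrable_const_bound)
      show "AE z in mu.dens. norm (ker.H i z) \<le> (E * r ^ 2 / (1 - r)\<^sup>2) ^ i / fact i"
        using mu.AE_dens_pos by eventually_elim (use ker.H_bound ker.H_nonneg in simp)
    qed simp
    then show ?thesis unfolding q_def by (subst (asm) mu.integrable_dens) simp_all
  qed
  define I where "I = (\<lambda>y. \<integral>z. indicator {y..} z * q z \<partial>lborel)"
  \<comment> \<open>The real integral is 0 by default on nonintegrable functions, so integrability
    of \<open>q\<close> is needed before passing to nonnegative integrals.\<close>
  have I_nn: "ennreal (I y) = (\<integral>\<^sup>+z. ennreal (indicator {y..} z * q z) \<partial>lborel)" for y
    unfolding I_def
  proof (rule nn_integral_eq_integral[symmetric])
    show "integrable lborel (\<lambda>z. indicator {y..} z * q z)"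
      using integrable_mult_indicator[of "{y..}" lborel q] q_int by simp
  qed (use q_nonneg in auto)
  have I_nonneg: "0 \<le> I y" for y unfolding I_def by (intro Bochner_Integration.integral_nonneg) (use q_nonneg in auto)
  have I_alt: "I = (\<lambda>y. \<integral>z. (if y \<le> z then 1 else 0) * q z \<partial>lborel)"
    by (simp add: I_def indicator_def of_bool_def)
  have I_meas[measurable]: "I \<in> borel_measurable borel" unfolding I_alt by measurable
  have inner: "(LBINT z:{y..}. g2 P z * G P i z) = I y" if "0 \<le> y" for y
    unfolding I_def set_lebesgue_integral_def
    using that Suc.IH by (intro Bochner_Integration.integral_cong) (auto simp: q_def indicator_def g2_eq_egf)
  have "G P (Suc i) x = (\<integral>y. indicator {x..} y * I y \<partial>lborel)"
    unfolding G.simps set_lebesgue_integral_def[of lborel "{x..}"]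
    using Suc.prems by (intro Bochner_Integration.integral_cong) (auto simp: inner indicator_def)
  also have "\<dots> = enn2real (\<integral>\<^sup>+y. ennreal (indicator {x..} y * I y) \<partial>lborel)"
    by (rule integral_eq_nn_integral) (use I_nonneg in auto)
  also have "(\<integral>\<^sup>+y. ennreal (indicator {x..} y * I y) \<partial>lborel) =
      (\<integral>\<^sup>+y. (\<integral>\<^sup>+z. ennreal (if x \<le> y \<and> y \<le> z then q z else 0) \<partial>lborel) \<partial>lborel)"
  proof (intro nn_integral_cong, goal_cases)
    case (1 y)
    show ?case
    proof (cases "x \<le> y")
      case True
      then show ?thesis by (simp add: I_nn) (auto intro!: nn_integral_cong simp: indicator_def)
    qed simp
  qed
  also have "\<dots> = (\<integral>\<^sup>+z. (\<integral>\<^sup>+y. ennreal (if x \<le> y \<and> y \<le> z then q z else 0) \<partial>lborel) \<partial>lborel)"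
    by (rule lborel_pair.Fubini') measurable
  also have "\<dots> = (\<integral>\<^sup>+z. ennreal (max 0 (z - x) * q z) \<partial>lborel)"
  proof (intro nn_integral_cong, goal_cases)
    case (1 z)
    have "(\<integral>\<^sup>+y. ennreal (if x \<le> y \<and> y \<le> z then q z else 0) \<partial>lborel) = (\<integral>\<^sup>+y. ennreal (q z) * indicator {x..z} y \<partial>lborel)"
      by (intro nn_integral_cong) (auto simp: indicator_def)
    also have "\<dots> = ennreal (q z) * ennreal (max 0 (z - x))"
      by (subst nn_integral_cmult_indicator) (auto simp: max_def emeasure_lborel_Icc_eq)
    finally show ?case
      by (simp only: mult.commute[of "max 0 (z - x)"] ennreal_mult'[OF q_nonneg])
  qed
  also have "enn2real \<dots> = (\<integral>z. max 0 (z - x) * q z \<partial>lborel)"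
    by (rule integral_eq_nn_integral[symmetric]) (use q_nonneg in auto)
  also have "\<dots> = ker.H (Suc i) x"
    unfolding ker.H.simps
    by (subst mu.integral_dens) (auto simp: q_def mult_ac intro!: Bochner_Integration.integral_cong)
  finally show ?case .
qed simp

lemma L_eq_\<phi>: "0 \<le> x \<Longrightarrow> L P \<beta> x = ker.\<phi> (1 / \<beta>) x"
  by (simp add: L_def ker.\<phi>_def G_eq_H)

text \<open>Reciprocals turn the largest \<beta> into the smallest l: attainment is
  \<open>f_0\<close>, maximality is \<open>eigenvalue_minimal\<close>.\<close>

lemma beta0_eq: "beta0 P = 1 / ker.l0"
  unfolding beta0_def
proof (rule Greatest_equality)
  show "0 < 1 / ker.l0 \<and> L P (1 / ker.l0) 0 = 0"
    using ker.l0_pos ker.f_0 by (simp add: L_eq_\<phi> ker.f_def)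
  fix \<beta> assume \<beta>: "0 < \<beta> \<and> L P \<beta> 0 = 0"
  then have "ker.l0 \<le> 1 / \<beta>" by (intro ker.eigenvalue_minimal) (auto simp: L_eq_\<phi>)
  then show "\<beta> \<le> 1 / ker.l0" using \<beta> ker.l0_pos by (simp add: field_simps)
qed

lemma L_beta0: "0 \<le> x \<Longrightarrow> L P (beta0 P) x = ker.f x"
  by (simp add: L_eq_\<phi> beta0_eq ker.f_def)

lemma f0_eq: assumes x: "0 \<le> x" shows "f0 P x = ker.f x / sqrt ker.D"
proof -
  have "(LBINT y:{0..}. g2 P y * (L P (beta0 P) y)\<^sup>2) = ker.D"
    unfolding ker.D_def set_lebesgue_integral_def
    by (subst mu.integral_dens)
       (auto intro!: Bochner_Integration.integral_cong simp: indicator_def g2_eq_egf L_beta0 power2_eq_square)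
  then show ?thesis using x by (simp add: f0_def L_beta0)
qed

text \<open>The common value \<integral> f0 d\<nu> of the two factors in the limit.\<close>

definition f0_mass :: real where "f0_mass = (\<integral>x. ker.f x \<partial>nu.dens) / sqrt ker.D"

lemma f0_mass_eq: "f0_mass = (\<integral>x. indicator {0..} x * egf P (Suc 0) x * f0 P x \<partial>lborel)"
proof -
  have "f0_mass = (\<integral>x. ker.f x / sqrt ker.D \<partial>nu.dens)" by (simp add: f0_mass_def)
  also have "\<dots> = (\<integral>x. indicator {0..} x * egf P (Suc 0) x * (ker.f x / sqrt ker.D) \<partial>lborel)"
    by (rule nu.integral_dens) simp
  also have "\<dots> = (\<integral>x. indicator {0..} x * egf P (Suc 0) x * f0 P x \<partial>lborel)"
    by (intro Bochner_Integration.integral_cong) (auto simp: indicator_def f0_eq)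
  finally show ?thesis .
qed

lemma second_factor:
  "(LBINT z:{0..}. (\<Sum>\<^sub>\<infinity>k\<in>{1..}. pmf P k * (exp (- z) * z ^ (k - 1) / fact (k - 1)) * f0 P z)) = f0_mass"
proof -
  have inner: "(\<Sum>\<^sub>\<infinity>k\<in>{1..}. pmf P k * (exp (- z) * z ^ (k - 1) / fact (k - 1)) * f0 P z) = egf P (Suc 0) z * f0 P z" for z
  proof -
    have t: "pmf P (k + 1) * (exp (- z) * z ^ (k + 1 - 1) / fact (k + 1 - 1)) * f0 P z =
        (exp (- z) * f0 P z) * (pmf P (k + 1) * (z ^ k / fact k))" for k
      by simp
    have "(\<Sum>\<^sub>\<infinity>k\<in>{1..}. pmf P k * (exp (- z) * z ^ (k - 1) / fact (k - 1)) * f0 P z) =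
        (\<Sum>k. pmf P (k + 1) * (exp (- z) * z ^ (k + 1 - 1) / fact (k + 1 - 1)) * f0 P z)"
      by (rule infsum_shift, simp only: t abs_mult[of "exp (- z) * f0 P z"], rule summable_mult[OF egf_summable_abs])
    also have "\<dots> = egf P (Suc 0) z * f0 P z"
      by (simp only: t suminf_mult[OF egf_term_summable] egf_def) simp
    finally show ?thesis .
  qed
  show ?thesis unfolding inner f0_mass_eq set_lebesgue_integral_def by (simp add: mult.assoc)
qed

text \<open>For each m the factor m / x cancels against x^m / m!, leaving one term of the density of
  \<nu>. As \<open>ker.f\<close> is nonnegative on the half-line, sum and integral can be
  exchanged.\<close>

lemma first_factor:
  "(\<Sum>\<^sub>\<infinity>k\<in>{1..}. pmf P k * (LBINT x:{0..}. exp (- x) * x ^ k / fact k * (real k / x) * f0 P x)) = f0_mass"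
proof -
  define s where "s = (\<lambda>k x. indicator {0..} x * (exp (- x) * (ker.f x / sqrt ker.D)) * (pmf P (k + 1) * (x ^ k / fact k)))"
  have f0n: "0 \<le> ker.f x / sqrt ker.D" if "0 \<le> x" for x
    using ker.f_nonneg[OF that] ker.D_pos by simp
  have s_meas: "s k \<in> borel_measurable lborel" for k unfolding s_def by measurable
  have s_nonneg: "0 \<le> s k x" for k x
  proof (cases "0 \<le> x")
    case True
    then show ?thesis unfolding s_def by (intro mult_nonneg_nonneg f0n) auto
  qed (simp add: s_def)
  have s_summable: "summable (\<lambda>k. s k x)" for x
    unfolding s_def by (rule summable_mult[OF egf_term_summable])
  have s_sum: "(\<Sum>k. s k x) = indicator {0..} x * egf P (Suc 0) x * (ker.f x / sqrt ker.D)" for x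
    unfolding s_def suminf_mult[OF egf_term_summable] by (simp add: egf_def)
  have int: "integrable lborel (\<lambda>x. \<Sum>k. s k x)"
  proof -
    have "integrable nu.dens (\<lambda>x. ker.f x / sqrt ker.D)"
    proof -
      interpret fin: finite_measure nu.dens by (rule nu.finite_measure_dens)
      have "integrable nu.dens ker.f"
      proof (rule fin.integrable_const_bound)
        show "AE x in nu.dens. norm (ker.f x) \<le> exp (E * r ^ 2 / (1 - r)\<^sup>2 * ker.l0)"
          using nu.AE_dens_pos by eventually_elim (use ker.f_abs_bound in simp)
      qed simp
      then show ?thesis by simp
    qed
    then show ?thesis unfolding s_sum by (subst (asm) nu.integrable_dens) simp_all
  qed
  have term_eq: "pmf P (k + 1) * (LBINT x:{0..}. exp (- x) * x ^ (k + 1) / fact (k + 1) * (real (k + 1) / x) * f0 P x) =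
      (\<integral>x. s k x \<partial>lborel)" for k
  proof -
    have eq: "(LBINT x:{0..}. exp (- x) * x ^ (k + 1) / fact (k + 1) * (real (k + 1) / x) * f0 P x) =
        (\<integral>x. indicator {0..} x * (exp (- x) * (ker.f x / sqrt ker.D)) * (x ^ k / fact k) \<partial>lborel)"
      unfolding set_lebesgue_integral_def
    proof (rule integral_cong_AE)
      show "AE x in lborel. indicator {0..} x *\<^sub>R (exp (- x) * x ^ (k + 1) / fact (k + 1) * (real (k + 1) / x) * f0 P x) =
          indicator {0..} x * (exp (- x) * (ker.f x / sqrt ker.D)) * (x ^ k / fact k)"
        \<comment> \<open>The cancellation of x is valid away from 0.\<close>
        using AE_lborel_singleton[of "0::real"]
      proof eventually_elim
        case (elim x)
        have "x ^ (k + 1) / fact (k + 1) * (real (k + 1) / x) = x ^ k / fact k"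
          using power_fact_cancel[OF elim, of k] by (simp only: Suc_eq_plus1 times_divide_eq_right times_divide_eq_left divide_divide_eq_left mult.commute)
        then have "exp (- x) * x ^ (k + 1) / fact (k + 1) * (real (k + 1) / x) = exp (- x) * (x ^ k / fact k)"
          by (metis (no_types, lifting) mult.assoc times_divide_eq_right)
        then show ?case by (auto simp: indicator_def f0_eq simp del: power_Suc fact_Suc)
      qed
      \<comment> \<open>\<open>f0\<close> is identified with the measurable
        \<open>ker.f / sqrt ker.D\<close> on the half-line, so measurability is transferred under
        the indicator.\<close>
      have "(\<lambda>x. indicator {0..} x *\<^sub>R (exp (- x) * x ^ (k + 1) / fact (k + 1) * (real (k + 1) / x) * f0 P x)) =
          (\<lambda>x. indicator {0..} x *\<^sub>R (exp (- x) * x ^ (k + 1) / fact (k + 1) * (real (k + 1) / x) * (ker.f x / sqrt ker.D)))"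
        by (auto simp: indicator_def f0_eq fun_eq_iff)
      then show "(\<lambda>x. indicator {0..} x *\<^sub>R (exp (- x) * x ^ (k + 1) / fact (k + 1) * (real (k + 1) / x) * f0 P x))
          \<in> borel_measurable lborel" by simp
    qed measurable
    show ?thesis
      unfolding eq s_def integral_mult_right_zero[symmetric] by (simp only: mult_ac)
  qed
  note S = integral_suminf_nonneg[OF s_meas s_nonneg s_summable int]
  have "(\<Sum>\<^sub>\<infinity>k\<in>{1..}. pmf P k * (LBINT x:{0..}. exp (- x) * x ^ k / fact k * (real k / x) * f0 P x)) =
      (\<Sum>k. pmf P (k + 1) * (LBINT x:{0..}. exp (- x) * x ^ (k + 1) / fact (k + 1) * (real (k + 1) / x) * f0 P x))"
  proof (rule infsum_shift)
    have "0 \<le> (\<integral>x. s k x \<partial>lborel)" for k using s_nonneg by simp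
    then show "summable (\<lambda>k. \<bar>pmf P (k + 1) * (LBINT x:{0..}. exp (- x) * x ^ (k + 1) / fact (k + 1) * (real (k + 1) / x) * f0 P x)\<bar>)"
      unfolding term_eq using S by simp
  qed
  also have "\<dots> = (\<integral>x. (\<Sum>k. s k x) \<partial>lborel)" unfolding term_eq using S by simp
  also have "\<dots> = f0_mass"
    unfolding s_sum f0_mass_eq by (intro Bochner_Integration.integral_cong) (auto simp: indicator_def f0_eq)
  finally show ?thesis .
qed

end

section \<open>Growth of the generations\<close>

locale ewt_exp_tail = erlang_weighted_tree M P n v \<zeta> + exp_tail P E r
  for M :: "'w measure" and P n v \<zeta> E r
begin

primrec F :: "nat \<Rightarrow> real \<Rightarrow> real" where
  "F 0 = (\<lambda>x. \<integral>y. min x y \<partial>nu.dens)"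
| "F (Suc l) = ker.T (F l)"

lemma F_measurable [measurable]: "F l \<in> borel_measurable borel"
proof (induction l)
  case 0
  interpret fin: finite_measure nu.dens by (rule nu.finite_measure_dens)
  show ?case by simp
qed simp

text \<open>Gives the integrability with which the nonnegative integrals of the recursion become the
  real integrals in \<open>T\<close>. The bound depends on l.\<close>

lemma F_nonneg_bounded: "\<exists>W. \<forall>x\<ge>0. 0 \<le> F l x \<and> F l x \<le> W"
proof (induction l)
  case 0
  have "0 \<le> F 0 x \<and> F 0 x \<le> (\<integral>y. y \<partial>nu.dens)" if x: "0 \<le> x" for x
  proof
    show "0 \<le> F 0 x"
      unfolding F.simps using nu.AE_dens_pos x by (intro integral_nonneg_AE) (auto elim!: eventually_mono)
    interpret fin: finite_measure nu.dens by (rule nu.finite_measure_dens)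
    have "integrable nu.dens (\<lambda>y. min x y)"
      using nu.integrable_dens_id by (intro Bochner_Integration.integrable_min) auto
    then show "F 0 x \<le> (\<integral>y. y \<partial>nu.dens)"
      unfolding F.simps by (intro integral_mono nu.integrable_dens_id) auto
  qed
  then show ?case by blast
next
  case (Suc l)
  then obtain W where W: "\<And>x. 0 \<le> x \<Longrightarrow> 0 \<le> F l x \<and> F l x \<le> W" by blast
  have "0 \<le> F (Suc l) x \<and> F (Suc l) x \<le> W * ker.K" if x: "0 \<le> x" for x
  proof
    show "0 \<le> F (Suc l) x"
      unfolding F.simps ker.T_def using x W by (intro ker.integral_nonneg_pos mult_nonneg_nonneg) auto
    have "0 \<le> W" using W[of 0] by auto
    have "\<bar>ker.T (F l) x\<bar> \<le> W * ker.K * min x 1"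
      by (rule ker.T_upper) (use W x in auto)
    also have "\<dots> \<le> W * ker.K * 1"
      using \<open>0 \<le> W\<close> ker.K_nonneg by (intro mult_left_mono) auto
    finally show "F (Suc l) x \<le> W * ker.K" by simp
  qed
  then show ?case by blast
qed

lemma F_nonneg: "0 \<le> x \<Longrightarrow> 0 \<le> F l x"
  using F_nonneg_bounded[of l] by blast

text \<open>The term k = 0 vanishes and k / x lowers the power by one, so the shift of P rises by
  one: the root (d = 0) yields \<nu>, the other vertices (d = 1) yield \<mu>.\<close>

lemma erlang_sum:
  assumes "0 < x"
  shows "(\<integral>\<^sup>+k. ennreal (pmf P (k + d)) * (of_nat k * ennreal (erlang_density k 1 x / x)) \<partial>count_space UNIV) =
    ennreal (egf P (Suc d) x)"
proof -
  define t where "t = (\<lambda>k. exp (- x) * (pmf P (k + d) * (real k * (x ^ k / fact k / x))))"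
  have t0: "0 \<le> t k" for k using assms by (simp add: t_def)
  have tS: "t (Suc k) = exp (- x) * (pmf P (k + Suc d) * (x ^ k / fact k))" for k
  proof -
    have "real (Suc k) * (x ^ Suc k / fact (Suc k) / x) = x ^ k / fact k"
      by (rule power_fact_cancel) (use assms in simp)
    then show ?thesis by (simp only: t_def add_Suc add_Suc_right)
  qed
  have "summable (\<lambda>k. t (Suc k))"
    unfolding tS by (rule summable_mult[OF egf_term_summable])
  then have ts: "summable t" by (simp only: summable_Suc_iff)
  have "(\<integral>\<^sup>+k. ennreal (pmf P (k + d)) * (of_nat k * ennreal (erlang_density k 1 x / x)) \<partial>count_space UNIV) =
      (\<Sum>k. ennreal (t k))"
    unfolding nn_integral_count_space_nat
  proof (rule suminf_cong)
    fix k
    show "ennreal (pmf P (k + d)) * (of_nat k * ennreal (erlang_density k 1 x / x)) = ennreal (t k)"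
      using assms by (simp add: t_def erlang_density_def ennreal_mult'[symmetric] ennreal_of_nat_eq_real_of_nat mult_ac)
  qed
  also have "\<dots> = ennreal (\<Sum>k. t k)" by (rule suminf_ennreal2[OF t0 ts])
  also have "(\<Sum>k. t k) = (\<Sum>k. t (Suc k))"
    using suminf_split_head[OF ts] by (simp add: t_def)
  also have "\<dots> = egf P (Suc d) x"
    unfolding tS egf_def by (rule suminf_mult[OF egf_term_summable])
  finally show ?thesis .
qed

lemma Q\<^sub>r_AE: "AE x in lborel. Q\<^sub>r x = ennreal (indicator {0..} x * egf P (Suc 0) x)"
  using AE_lborel_singleton[of "0::real"]
proof eventually_elim
  case (elim x)
  show ?case
  proof (cases "0 < x")
    case True
    then show ?thesis using erlang_sum[of x 0] by (simp add: Q\<^sub>r_def)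
  next
    case False
    with elim show ?thesis by (simp add: Q\<^sub>r_def erlang_density_def)
  qed
qed

lemma Q\<^sub>c_AE: "AE x in lborel. Q\<^sub>c x = ennreal (indicator {0..} x * egf P 2 x)"
  using AE_lborel_singleton[of "0::real"]
proof eventually_elim
  case (elim x)
  show ?case
  proof (cases "0 < x")
    case True
    then show ?thesis using erlang_sum[of x 1] by (simp add: Q\<^sub>c_def numeral_2_eq_2)
  next
    case False
    with elim show ?thesis by (simp add: Q\<^sub>c_def erlang_density_def)
  qed
qed

text \<open>The same density as at the root, so \<nu> appears at both ends. Without a division by x
  the identity holds at every point.\<close>

lemma Q\<^sub>0_eq: "Q\<^sub>0 x = ennreal (indicator {0..} x * egf P (Suc 0) x)"
proof (cases "0 \<le> x")
  case True
  have "Q\<^sub>0 x = (\<Sum>k. ennreal (exp (- x) * (pmf P (k + 1) * (x ^ k / fact k))))"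
    unfolding Q\<^sub>0_def nn_integral_count_space_nat
    using True by (intro suminf_cong) (simp add: erlang_density_def ennreal_mult'[symmetric] mult_ac)
  also have "\<dots> = ennreal (\<Sum>k. exp (- x) * (pmf P (k + 1) * (x ^ k / fact k)))"
  proof (rule suminf_ennreal2)
    show "summable (\<lambda>k. exp (- x) * (pmf P (k + 1) * (x ^ k / fact k)))"
      by (rule summable_mult[OF egf_term_summable])
  qed (use True in simp)
  also have "(\<Sum>k. exp (- x) * (pmf P (k + 1) * (x ^ k / fact k))) = egf P (Suc 0) x"
    unfolding egf_def One_nat_def by (rule suminf_mult[OF egf_term_summable])
  finally show ?thesis using True by simp
next
  case False
  then show ?thesis by (simp add: Q\<^sub>0_def erlang_density_def)
qed

text \<open>The origin of the kernel: for fixed y the z in [0, x] below y form a set of length min x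
  y, and \<open>ennreal\<close> sends a negative minimum to 0.\<close>

lemma \<S>_tail:
  assumes [measurable]: "a \<in> borel_measurable borel"
  shows "\<S> (\<lambda>z. \<integral>\<^sup>+y. indicator {z<..} y * a y \<partial>lborel) x = (\<integral>\<^sup>+y. ennreal (min x y) * a y \<partial>lborel)"
proof -
  have "\<S> (\<lambda>z. \<integral>\<^sup>+y. indicator {z<..} y * a y \<partial>lborel) x =
      (\<integral>\<^sup>+z. (\<integral>\<^sup>+y. (if 0 \<le> z \<and> z \<le> x \<and> z < y then 1 else 0) * a y \<partial>lborel) \<partial>lborel)"
    unfolding \<S>_def
  proof (intro nn_integral_cong, goal_cases)
    case (1 z)
    show ?case
    proof (cases "z \<in> {0..x}")
      case True
      then show ?thesis by (auto intro!: nn_integral_cong simp: indicator_def)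
    qed auto
  qed
  also have "\<dots> = (\<integral>\<^sup>+y. (\<integral>\<^sup>+z. (if 0 \<le> z \<and> z \<le> x \<and> z < y then 1 else 0) * a y \<partial>lborel) \<partial>lborel)"
    by (rule lborel_pair.Fubini') measurable
  also have "\<dots> = (\<integral>\<^sup>+y. ennreal (min x y) * a y \<partial>lborel)"
  proof (intro nn_integral_cong, goal_cases)
    case (1 y)
    have "(\<integral>\<^sup>+z. (if 0 \<le> z \<and> z \<le> x \<and> z < y then 1 else 0) * a y \<partial>lborel) =
        (\<integral>\<^sup>+z. a y * indicator ({0..x} \<inter> {..<y}) z \<partial>lborel)"
      by (intro nn_integral_cong) (auto simp: indicator_def)
    also have "\<dots> = a y * emeasure lborel ({0..x} \<inter> {..<y})"
      by (rule nn_integral_cmult_indicator) simp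
    also have "emeasure lborel ({0..x} \<inter> {..<y}) = ennreal (min x y)"
    proof (cases "x < y")
      case True
      then have "{0..x} \<inter> {..<y} = {0..x}" by auto
      then show ?thesis using True by (simp add: emeasure_lborel_Icc_eq ennreal_neg)
    next
      case False
      then have "{0..x} \<inter> {..<y} = {0..<y}" by auto
      moreover have "emeasure lborel {0..<y} = ennreal y"
        by (cases "0 \<le> y") (simp_all add: ennreal_neg)
      ultimately show ?thesis using False by simp
    qed
    finally show ?case by (simp add: mult.commute)
  qed
  finally show ?thesis .
qed

text \<open>Taking primitives turns \<open>step\<close> into \<open>T\<close>:
  \<open>\<S>_tail\<close> with weight \<open>Q\<^sub>c y * \<S> h y\<close> gives the min kernel
  against \<mu>, and \<open>survival\<close> gives it against \<nu>.\<close>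

lemma \<S>_iterate_eq_F:
  "0 \<le> x \<Longrightarrow> \<S> ((step ^^ l) survival) x = ennreal (F l x)"
proof (induction l arbitrary: x)
  case 0
  interpret fin: finite_measure nu.dens by (rule nu.finite_measure_dens)
  have "\<S> survival x = (\<integral>\<^sup>+y. ennreal (min x y) * Q\<^sub>0 y \<partial>lborel)"
    unfolding survival_def[abs_def] by (rule \<S>_tail) measurable
  also have "\<dots> = (\<integral>\<^sup>+y. ennreal (min x y) \<partial>nu.dens)"
    by (subst nu.nn_integral_dens) (auto simp: Q\<^sub>0_eq mult.commute)
  also have "\<dots> = ennreal (\<integral>y. min x y \<partial>nu.dens)"
  proof (rule nn_integral_eq_integral)
    show "integrable nu.dens (min x)"
      using nu.integrable_dens_id by (intro Bochner_Integration.integrable_min) auto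
    show "AE y in nu.dens. 0 \<le> min x y"
      using nu.AE_dens_pos by eventually_elim (use 0 in auto)
  qed
  finally show ?case by simp
next
  case (Suc l)
  obtain W where W: "\<And>x. 0 \<le> x \<Longrightarrow> 0 \<le> F l x \<and> F l x \<le> W" using F_nonneg_bounded by blast
  let ?h = "(step ^^ l) survival"
  have hm[measurable]: "?h \<in> borel_measurable borel" by (induction l) auto
  have "step ?h = (\<lambda>z. \<integral>\<^sup>+y. indicator {z<..} y * (Q\<^sub>c y * \<S> ?h y) \<partial>lborel)"
    by (rule ext) (simp only: step_def mult.assoc)
  then have "\<S> (step ?h) x = (\<integral>\<^sup>+y. ennreal (min x y) * (Q\<^sub>c y * \<S> ?h y) \<partial>lborel)"
    by (simp only:) (rule \<S>_tail, measurable)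
  also have "\<dots> = (\<integral>\<^sup>+y. ennreal (indicator {0..} y * egf P 2 y) * ennreal (min x y * F l y) \<partial>lborel)"
  proof (rule nn_integral_cong_AE)
    show "AE y in lborel. ennreal (min x y) * (Q\<^sub>c y * \<S> ?h y) =
        ennreal (indicator {0..} y * egf P 2 y) * ennreal (min x y * F l y)"
      using Q\<^sub>c_AE
    proof eventually_elim
      case (elim y)
      show ?case
      proof (cases "0 \<le> y")
        case True
        then show ?thesis using Suc.IH[OF True] W[OF True] Suc.prems
          by (simp add: elim ennreal_mult mult_ac)
      qed (simp add: elim)
    qed
  qed
  also have "\<dots> = (\<integral>\<^sup>+y. ennreal (min x y * F l y) \<partial>mu.dens)"
    by (rule mu.nn_integral_dens[symmetric]) measurable
  also have "\<dots> = ennreal (ker.T (F l) x)"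
    unfolding ker.T_def
  proof (rule nn_integral_eq_integral)
    show "integrable mu.dens (\<lambda>y. min x y * F l y)"
      by (rule ker.integrable_T[where W = W]) (use W Suc.prems in auto)
    show "AE y in mu.dens. 0 \<le> min x y * F l y"
      using mu.AE_dens_pos by eventually_elim (use W Suc.prems in auto)
  qed
  finally show ?case by simp
qed

lemma expected_generation_size:
  "(\<integral>\<omega>. real (card (ewt_generation (\<lambda>i. n i \<omega>) (\<lambda>i. v i \<omega>) (\<lambda>i. \<zeta> i \<omega>) (Suc l))) \<partial>M) = (\<integral>x. F l x \<partial>nu.dens)"
proof -
  let ?Z = "\<lambda>\<omega>. card (ewt_generation (\<lambda>i. n i \<omega>) (\<lambda>i. v i \<omega>) (\<lambda>i. \<zeta> i \<omega>) (Suc l))"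
  have Zm: "(\<lambda>\<omega>. real (?Z \<omega>)) \<in> borel_measurable M"
  proof -
    have "(\<lambda>\<omega>. \<integral>\<^sup>+u. indicator {u. alive u \<omega>} u \<partial>count_space (words (Suc l))) \<in> borel_measurable M"
      by (rule nn_integral_count_space_measurable) (auto intro: alive_indicator_measurable simp: words_def)
    then have "(\<lambda>\<omega>. of_nat (?Z \<omega>) :: ennreal) \<in> borel_measurable M"
      by (simp only: card_generation)
    then have "(\<lambda>\<omega>. enn2real (of_nat (?Z \<omega>))) \<in> borel_measurable M" by measurable
    then show ?thesis by (simp add: ennreal_of_nat_eq_real_of_nat)
  qed
  have "(\<integral>\<omega>. real (?Z \<omega>) \<partial>M) = enn2real (\<integral>\<^sup>+\<omega>. ennreal (real (?Z \<omega>)) \<partial>M)"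
    by (rule integral_eq_nn_integral[OF Zm]) simp
  also have "(\<integral>\<^sup>+\<omega>. ennreal (real (?Z \<omega>)) \<partial>M) = (\<integral>\<^sup>+y. Q\<^sub>r y * \<S> ((step ^^ l) survival) y \<partial>lborel)"
    using expected_generation[of l] by (simp only: ennreal_of_nat_eq_real_of_nat)
  also have "\<dots> = (\<integral>\<^sup>+y. ennreal (indicator {0..} y * egf P (Suc 0) y) * ennreal (F l y) \<partial>lborel)"
  proof (rule nn_integral_cong_AE)
    show "AE y in lborel. Q\<^sub>r y * \<S> ((step ^^ l) survival) y = ennreal (indicator {0..} y * egf P (Suc 0) y) * ennreal (F l y)"
      using Q\<^sub>r_AE
    proof eventually_elim
      case (elim y)
      then show ?case by (cases "0 \<le> y") (simp_all add: \<S>_iterate_eq_F)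
    qed
  qed
  also have "\<dots> = (\<integral>\<^sup>+y. ennreal (F l y) \<partial>nu.dens)"
    by (rule nu.nn_integral_dens[symmetric]) measurable
  also have "enn2real \<dots> = (\<integral>x. F l x \<partial>nu.dens)"
  proof (rule integral_eq_nn_integral[symmetric])
    show "AE y in nu.dens. 0 \<le> F l y"
      using nu.AE_dens_pos by eventually_elim (simp add: F_nonneg)
  qed simp
  finally show ?thesis .
qed

text \<open>Passing to \<open>Suc l\<close> drops generation 0, and m^2 / D is the square of m /
  sqrt D.\<close>

theorem expected_generation_limit:
  "(\<lambda>l. (\<integral>\<omega>. real (card (ewt_generation (\<lambda>i. n i \<omega>) (\<lambda>i. v i \<omega>) (\<lambda>i. \<zeta> i \<omega>) l)) \<partial>M) / beta0 P ^ l)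
    \<longlonglongrightarrow> f0_mass * f0_mass"
proof (rule LIMSEQ_imp_Suc)
  have "(\<lambda>l. ker.l0 ^ Suc l * (\<integral>x. F l x \<partial>nu.dens)) \<longlonglongrightarrow> (\<integral>x. ker.f x \<partial>nu.dens)\<^sup>2 / ker.D"
    by (rule ker.iterate_integral_limit[OF nu.finite_measure_dens nu.sets_dens nu.AE_dens_pos nu.integrable_dens_id]) simp_all
  also have "(\<integral>x. ker.f x \<partial>nu.dens)\<^sup>2 / ker.D = f0_mass * f0_mass"
    using ker.D_pos by (simp add: f0_mass_def power2_eq_square)
  finally show "(\<lambda>l. (\<integral>\<omega>. real (card (ewt_generation (\<lambda>i. n i \<omega>) (\<lambda>i. v i \<omega>) (\<lambda>i. \<zeta> i \<omega>) (Suc l))) \<partial>M) / beta0 P ^ Suc l)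
    \<longlonglongrightarrow> f0_mass * f0_mass"
    unfolding expected_generation_size beta0_eq by (simp add: power_one_over mult.commute)
qed

end

section \<open>The geometric tail of the degree distribution\<close>

context erlang_weighted_tree
begin

text \<open>With all other marks left free the uniform laws contribute 1, and so does the zeroth
  moment of the Erlang density.\<close>

lemma root_degree_law: "emeasure M {\<omega> \<in> space M. n [] \<omega> = k} = ennreal (pmf P k)"
proof -
  have "emeasure M {\<omega> \<in> space M. n [] \<omega> = k} =
      ennreal (pmf P k) * (\<integral>\<^sup>+y\<in>UNIV. ennreal (erlang_density k 1 y) *
        (\<Prod>j=1..k. emeasure (uniform_measure lborel {0..y}) UNIV) \<partial>lborel)"
    using marks_law[of "[]" UNIV "\<lambda>_. UNIV" k] by (simp add: potential_degree_prob_def)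
  also have "(\<integral>\<^sup>+y\<in>UNIV. ennreal (erlang_density k 1 y) *
        (\<Prod>j=1..k. emeasure (uniform_measure lborel {0..y}) UNIV) \<partial>lborel) =
      (\<integral>\<^sup>+y. ennreal (erlang_density k 1 y * y ^ 0) \<partial>lborel)"
  proof (rule nn_integral_cong_AE)
    show "AE y in lborel. ennreal (erlang_density k 1 y) *
        (\<Prod>j=1..k. emeasure (uniform_measure lborel {0..y}) UNIV) * indicator UNIV y =
        ennreal (erlang_density k 1 y * y ^ 0)"
      using AE_lborel_singleton[of "0::real"]
    proof eventually_elim
      case (elim y)
      show ?case
      proof (cases "0 < y")
        case True
        have "emeasure (uniform_measure lborel {0..y}) UNIV = 1"
          using True by (simp add: divide_ennreal)
        then show ?thesis by (simp del: emeasure_uniform_measure)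
      next
        case False
        with elim have "erlang_density k 1 y = 0" by (simp add: erlang_density_def)
        then show ?thesis by simp
      qed
    qed
  qed
  also have "\<dots> = 1" using nn_integral_erlang_ith_moment[of 1 k 0] by simp
  finally show ?thesis by simp
qed

text \<open>Chernoff's bound: exp (\<theta> k) times the indicator of n [] = k is at most exp
  (\<theta> n []). The moment becomes the constant \<open>E\<close>, and exp (- \<theta>) the ratio
  \<open>r\<close>.\<close>

lemma exponential_tail:
  assumes "0 < \<theta>" and int: "integrable M (\<lambda>\<omega>. exp (\<theta> * real (n [] \<omega>)))"
  shows "pmf P k \<le> (\<integral>\<omega>. exp (\<theta> * real (n [] \<omega>)) \<partial>M) * exp (- \<theta>) ^ k"
proof -
  note [measurable] = n_measurable[of "[]"]
  have S: "{\<omega> \<in> space M. n [] \<omega> = k} \<in> sets M" by measurable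
  have p: "measure M {\<omega> \<in> space M. n [] \<omega> = k} = pmf P k"
    using root_degree_law[of k] by (simp add: measure_def)
  have "exp (\<theta> * real k) * pmf P k = (\<integral>\<omega>. exp (\<theta> * real k) * indicator {\<omega> \<in> space M. n [] \<omega> = k} \<omega> \<partial>M)"
    using S by (simp add: p)
  also have "\<dots> \<le> (\<integral>\<omega>. exp (\<theta> * real (n [] \<omega>)) \<partial>M)"
    by (rule integral_mono[OF _ int]) (use S in \<open>auto split: split_indicator intro!: integrable_real_indicator simp: emeasure_eq_measure\<close>)
  finally have "pmf P k \<le> (\<integral>\<omega>. exp (\<theta> * real (n [] \<omega>)) \<partial>M) / exp (\<theta> * real k)"
    by (simp add: field_simps)
  also have "\<dots> = (\<integral>\<omega>. exp (\<theta> * real (n [] \<omega>)) \<partial>M) * exp (- \<theta>) ^ k"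
    by (simp only: divide_inverse exp_minus[symmetric] exp_of_nat_mult[symmetric] mult_minus_right
        mult.commute[of \<theta>])
  finally show ?thesis .
qed

lemma pmf_ge_2:
  assumes "pmf P 1 < 1"
  shows "\<exists>k\<ge>2. 0 < pmf P k"
proof (rule ccontr)
  assume none: "\<not> ?thesis"
  have "x = 1" if x: "x \<in> set_pmf P" for x
  proof -
    have "1 \<le> x" using degree_pos x by auto
    moreover have "\<not> 2 \<le> x" using none pmf_positive[OF x] by blast
    ultimately show ?thesis by simp
  qed
  then have "set_pmf P \<subseteq> {1}" by blast
  then have "P = return_pmf 1" by (simp only: set_pmf_subset_singleton)
  then have "pmf P 1 = 1" by simp
  with assms show False by simp
qed

end

theorem corollary5p19:
  fixes M :: "'w measure"
    and P :: "nat pmf"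
    and n :: "nat list \<Rightarrow> 'w \<Rightarrow> nat"
    and v \<zeta> :: "nat list \<Rightarrow> 'w \<Rightarrow> real"
    and Z :: "nat \<Rightarrow> 'w \<Rightarrow> nat"
    and \<theta> :: real
  assumes ewt: "erlang_weighted_tree M P n v \<zeta>"
    and P1: "pmf P 1 < 1"
    and theta: "\<theta> > 0" "integrable M (\<lambda>\<omega>. exp (\<theta> * real (n [] \<omega>)))"
    and Z: "\<And>l \<omega>. Z l \<omega> = card (ewt_generation (\<lambda>i. n i \<omega>) (\<lambda>i. v i \<omega>) (\<lambda>i. \<zeta> i \<omega>) l)"
  shows "(\<lambda>l. (\<integral>\<omega>. real (Z l \<omega>) \<partial>M) / beta0 P ^ l) \<longlonglongrightarrow>
           (\<Sum>\<^sub>\<infinity>m\<in>{1..}. pmf P m *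
              (LBINT x:{0..}. exp (- x) * x ^ m / fact m * (real m / x) * f0 P x)) *
           (LBINT z:{0..}. (\<Sum>\<^sub>\<infinity>k\<in>{1..}. pmf P k * (exp (- z) * z ^ (k - 1) / fact (k - 1)) * f0 P z))"
proof -
  interpret T: erlang_weighted_tree M P n v \<zeta> by (rule ewt)
  interpret ewt_exp_tail M P n v \<zeta> "\<integral>\<omega>. exp (\<theta> * real (n [] \<omega>)) \<partial>M" "exp (- \<theta>)"
    by unfold_locales (use theta T.exponential_tail T.pmf_ge_2[OF P1] in auto)
  show ?thesis
    unfolding Z first_factor second_factor by (rule expected_generation_limit)
qed

end
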